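(* Let $m$ be a positive integer, and let $q_1,q_2,\ldots,q_s$ ($s\ge 1$) be prime powers such that $2m\mid q_i+1$ for every $i=1,\ldots,s$. For $i=1,\ldots,s$, let $G_i$ be an elementary abelian group of order $q_i^4$. Put $u=q_1^2q_2^2\cdots q_s^2$. Then, for every integer $c$ having either of the following forms: 1. $c=(h+j)(u-1)/m+j$ for some $h\in\{0,1,\ldots,m-2\}$ and $j\in\{0,1,2\}$; 2. $c=(h+j)(u-1)/m+2j$ for some $h\in\{0,1,\ldots,m-1\}$ and $j\in\{0,1\}$; there exists a strongly regular Cayley graph on $G_1\times G_2\times\cdots\times G_s$ with Latin square type parameters $$(u^2,\; c(u-1),\; u+c^2-3c,\; c^2-c).$$ (For $m=1$ the first form is empty.)
   Context: A strongly regular graph with parameters $(v,k,\lambda,\mu)$ is a simple undirected graph such that (i) it is regular of order $v$ and valency $k$; (ii) any two adjacent vertices have exactly $\lambda$ common neighbours; (iii) any two distinct nonadjacent vertices have exactly $\mu$ common neighbours. Here the edgeless graph (case $c=0$) and the complete graph (case $c=u+1$) are allowed as degenerate cases; a condition that concerns no pair of vertices is vacuous. For an additively written finite abelian group $G$ and a subset $D\subseteq G$ with $0_G\notin D$ and $-D=D$, the Cayley graph $\mathrm{Cay}(G,D)$ has vertex set $G$, with $x,y$ adjacent if and only if $x-y\in D$. A Cayley graph on $G$ is a graph of this form. *)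

theory Defs
  imports
    Complex_Main
    "HOL-Algebra.Product_Groups"
    "HOL-Number_Theory.Prime_Powers"
    "Graph_Theory.Pair_Digraph"
begin

text \<open>Groups are written multiplicatively, as in HOL-Algebra, so that a difference of
  \<open>x\<close> and \<open>y\<close> becomes \<open>x \<otimes> inv y\<close>.\<close>

definition elementary_abelian_group :: "('a, 'b) monoid_scheme \<Rightarrow> bool" where
  "elementary_abelian_group G \<longleftrightarrow>
     comm_group G \<and> (\<exists>p::nat. prime p \<and> (\<forall>x\<in>carrier G. x [^]\<^bsub>G\<^esub> p = \<one>\<^bsub>G\<^esub>))"

text \<open>A simple undirected graph is a \<open>pair_graph\<close>: a finite loop-free digraph with a
  symmetric set of arcs, an edge being represented by its two opposite arcs.\<close>

definition neighbours :: "'a pair_pre_digraph \<Rightarrow> 'a \<Rightarrow> 'a set" where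
  "neighbours \<Gamma> x = {y. (x, y) \<in> parcs \<Gamma>}"

text \<open>The edgeless and the complete graph are not excluded: for them the condition on
  \<open>lam\<close>, respectively on \<open>mu\<close>, is vacuous. The parameters are integers so that
  differences in them do not truncate.\<close>

definition strongly_regular_graph ::
  "'a pair_pre_digraph \<Rightarrow> int \<Rightarrow> int \<Rightarrow> int \<Rightarrow> int \<Rightarrow> bool" where
  "strongly_regular_graph \<Gamma> v k lam mu \<longleftrightarrow>
     pair_graph \<Gamma> \<and>
     int (card (pverts \<Gamma>)) = v \<and>
     (\<forall>x\<in>pverts \<Gamma>. int (card (neighbours \<Gamma> x)) = k) \<and>
     (\<forall>x\<in>pverts \<Gamma>. \<forall>y\<in>pverts \<Gamma>. (x, y) \<in> parcs \<Gamma> \<longrightarrow>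
        int (card (neighbours \<Gamma> x \<inter> neighbours \<Gamma> y)) = lam) \<and>
     (\<forall>x\<in>pverts \<Gamma>. \<forall>y\<in>pverts \<Gamma>. x \<noteq> y \<and> (x, y) \<notin> parcs \<Gamma> \<longrightarrow>
        int (card (neighbours \<Gamma> x \<inter> neighbours \<Gamma> y)) = mu)"

definition Cay :: "('a, 'b) monoid_scheme \<Rightarrow> 'a set \<Rightarrow> 'a pair_pre_digraph" where
  "Cay G D = \<lparr>pverts = carrier G,
     parcs = {(x, y). x \<in> carrier G \<and> y \<in> carrier G \<and> x \<otimes>\<^bsub>G\<^esub> inv\<^bsub>G\<^esub> y \<in> D}\<rparr>"

definition Cayley_graph_on :: "('a, 'b) monoid_scheme \<Rightarrow> 'a pair_pre_digraph \<Rightarrow> bool" where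
  "Cayley_graph_on G \<Gamma> \<longleftrightarrow>
     (\<exists>D \<subseteq> carrier G. \<one>\<^bsub>G\<^esub> \<notin> D \<and> (\<lambda>x. inv\<^bsub>G\<^esub> x) ` D = D \<and> \<Gamma> = Cay G D)"

end

theory Submission
  imports
    Defs
    "HOL-Library.Indicator_Function"
    "HOL-Number_Theory.Residues"
    "HOL-Algebra.Algebraic_Closure"
begin

text \<open>A Cayley graph on \<open>G\<close> is strongly regular with Latin square type parameters once the nontrivial
character sums of its connection set take only the values \<open>-c\<close> and \<open>u - c\<close>
(\<open>strongly_regular_Cayley_graph_if_transform_two_valued\<close>). Such sets are unions of classes of a
labelling of \<open>G\<close> by residues modulo \<open>m\<close>. Suppose that for every \<open>m\<close>-th root of unity \<open>\<zeta> \<noteq> 1\<close> the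
function \<open>\<zeta>\<close> to the power of the label, with value \<open>1 + \<zeta>^s\<close> at the identity, has as Fourier transform
\<open>u\<close> times a function of the same kind on the characters. Averaging over \<open>\<zeta>\<close> shows that the class
with label \<open>l\<close> has the two values above with \<open>c = (u - 1) / m + [l = 0] + [l = s]\<close>. Unions of classes
give all the required \<open>c\<close>: \<open>s = 1\<close> for the first form and \<open>s = 0\<close> for the second one.

On one factor such labellings are easy to find, but a product of two functions that are \<open>1 + \<zeta>^s\<close> at
the identity is not a root of unity on the two coordinate axes of a product group. Therefore
the nonidentity elements are split into two halves, indexed by a truth value \<open>\<beta>\<close>, and each half
carries two functions built from labels: \<open>P \<beta>\<close>, extended by the value \<open>1\<close> at the identity, with
transform \<open>u\<close> times a function \<open>P \<beta>\<close> of the same kind, and \<open>N \<beta>\<close>, which vanishes at the identity, with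
transform \<open>-u\<close> times a function \<open>N (\<not> \<beta>)\<close> of the same kind. The products
\<open>P \<beta> \<otimes> P \<beta> + N \<beta> \<otimes> N (\<not> \<beta>)\<close> and \<open>P \<beta> \<otimes> N \<beta> + N \<beta> \<otimes> P (\<not> \<beta>)\<close> are again functions of these two
kinds: in each of these sums the two supports are disjoint, and the two signs cancel in
\<open>N \<otimes> N\<close>. Hence the structure passes to products (\<open>has_dual_labellings_DirProd\<close>), and only the
final function \<open>P True + \<zeta>^s P False\<close> has the value \<open>1 + \<zeta>^s\<close> at the identity.

For a single factor take the additive group of the field \<open>V\<close> with \<open>q^4\<close> elements, and put \<open>u = q\<^sup>2\<close>. Let \<open>K\<close>
and \<open>k\<close> be the subfields with \<open>u\<close> and \<open>q\<close> elements. The nonzero elements are split into the even and the odd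
powers of a generator. Together with zero, each half is a union of \<open>(u + 1) / 2\<close> lines over \<open>K\<close>, and this number is
\<open>1\<close> modulo \<open>m\<close>; labelling the lines as evenly as possible gives \<open>P\<close>, because the transform of the
indicator of a line is \<open>u\<close> times that of the orthogonal line. The functions \<open>N\<close> come from
multiplicative characters of order dividing \<open>2m\<close>. Since \<open>2m\<close> divides \<open>q + 1\<close>, these are trivial
on \<open>k\<close>, so their Gauss sum over \<open>K\<close> is \<open>q\<close> (\<open>gauss_sum_K\<close>). Comparing elements of \<open>V\<close> with pairs
of elements of \<open>K\<close> that have the same trace and norm (\<open>norm_trace_split_count\<close>) shows that the Gauss sum over \<open>V\<close> is
\<open>- q\<^sup>2\<close> (\<open>gauss_sum\<close>); this is the quadratic case of the Davenport-Hasse relation and the source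
of the minus sign. Finally, elementary abelian groups of equal order are isomorphic, so the
labellings can be carried from \<open>V\<close> to the given groups.\<close>

section \<open>Character sums and strongly regular Cayley graphs\<close>

text \<open>The group serves as its own index set for its characters: \<open>\<lambda>g. W g y\<close> is the character with
index \<open>y\<close>, and the identity indexes the trivial one.\<close>

definition self_pairing :: "('a, 'b) monoid_scheme \<Rightarrow> ('a \<Rightarrow> 'a \<Rightarrow> complex) \<Rightarrow> bool" where
  "self_pairing G W \<longleftrightarrow>
     (\<forall>g\<in>carrier G. \<forall>h\<in>carrier G. \<forall>y\<in>carrier G. W (g \<otimes>\<^bsub>G\<^esub> h) y = W g y * W h y) \<and>
     (\<forall>y\<in>carrier G. W \<one>\<^bsub>G\<^esub> y = 1) \<and>
     (\<forall>g\<in>carrier G. W g \<one>\<^bsub>G\<^esub> = 1) \<and>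
     (\<forall>g\<in>carrier G. g \<noteq> \<one>\<^bsub>G\<^esub> \<longrightarrow> (\<Sum>y\<in>carrier G. W g y) = 0) \<and>
     (\<forall>y\<in>carrier G. y \<noteq> \<one>\<^bsub>G\<^esub> \<longrightarrow> (\<Sum>g\<in>carrier G. W g y) = 0)"

definition transform ::
  "('a, 'b) monoid_scheme \<Rightarrow> ('a \<Rightarrow> 'a \<Rightarrow> complex) \<Rightarrow> ('a \<Rightarrow> complex) \<Rightarrow> 'a \<Rightarrow> complex" where
  "transform G W f y = (\<Sum>g\<in>carrier G. f g * W g y)"

lemma transform_linear:
  "transform G W (\<lambda>g. f g + h g) y = transform G W f y + transform G W h y"
  "transform G W (\<lambda>g. f g - h g) y = transform G W f y - transform G W h y"
  "transform G W (\<lambda>g. r * f g) y = r * transform G W f y"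
  "transform G W (\<lambda>g. \<Sum>i\<in>I. F i g) y = (\<Sum>i\<in>I. transform G W (F i) y)"
  by (simp_all add: transform_def ring_distribs sum.distrib sum_subtractf sum_distrib_left
      sum_distrib_right mult.assoc sum.swap[of _ I])

lemma transform_cong:
  assumes "\<And>g. g \<in> carrier G \<Longrightarrow> f g = h g"
  shows "transform G W f y = transform G W h y"
  using assms by (simp add: transform_def)

lemma transform_at_one:
  assumes "self_pairing G W"
  shows "transform G W f \<one>\<^bsub>G\<^esub> = (\<Sum>g\<in>carrier G. f g)"
  using assms by (simp add: transform_def self_pairing_def)

lemma transform_delta:
  assumes "self_pairing G W" "finite (carrier G)" "y \<in> carrier G" "group G"
  shows "transform G W (\<lambda>g. if g = \<one>\<^bsub>G\<^esub> then r else 0) y = r"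
proof -
  interpret group G by fact
  have "transform G W (\<lambda>g. if g = \<one>\<^bsub>G\<^esub> then r else 0) y
      = (\<Sum>g\<in>carrier G. if g = \<one>\<^bsub>G\<^esub> then r * W g y else 0)"
    unfolding transform_def by (rule sum.cong) auto
  then show ?thesis
    using assms by (simp add: self_pairing_def)
qed

lemma fourier_inversion:
  fixes G (structure)
  assumes G: "group G" and fin: "finite (carrier G)" and W: "self_pairing G W"
    and g: "g \<in> carrier G"
  shows "(\<Sum>y\<in>carrier G. transform G W f y * W (inv\<^bsub>G\<^esub> g) y) = of_nat (card (carrier G)) * f g"
proof -
  interpret group G by fact
  have "(\<Sum>y\<in>carrier G. transform G W f y * W (inv g) y)
      = (\<Sum>h\<in>carrier G. f h * (\<Sum>y\<in>carrier G. W (h \<otimes> inv g) y))"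
    using W g unfolding transform_def sum_distrib_left sum_distrib_right
    by (subst sum.swap, intro sum.cong) (auto simp: self_pairing_def)
  also have "\<dots> = (\<Sum>h\<in>carrier G. if h = g then of_nat (card (carrier G)) * f g else 0)"
  proof (rule sum.cong)
    fix h assume h: "h \<in> carrier G"
    show "f h * (\<Sum>y\<in>carrier G. W (h \<otimes> inv g) y)
        = (if h = g then of_nat (card (carrier G)) * f g else 0)"
    proof (cases "h = g")
      case True
      then show ?thesis using W g by (simp add: self_pairing_def)
    next
      case False
      then have "h \<otimes> inv g \<noteq> \<one>"
        using g h by (metis inv_closed inv_equality inv_inv)
      then have "(\<Sum>y\<in>carrier G. W (h \<otimes> inv g) y) = 0"
        using W g h unfolding self_pairing_def by (metis inv_closed m_closed)
      then show ?thesis using False by (simp only: if_False mult_zero_right)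
    qed
  qed simp
  finally show ?thesis using fin g by simp
qed

text \<open>By Fourier inversion only the trivial character contributes.\<close>

lemma constant_if_transform_vanishes:
  fixes G (structure)
  assumes G: "group G" and fin: "finite (carrier G)" and W: "self_pairing G W"
    and zero: "\<And>y. y \<in> carrier G \<Longrightarrow> y \<noteq> \<one>\<^bsub>G\<^esub> \<Longrightarrow> transform G W f y = 0"
    and g: "g \<in> carrier G"
  shows "of_nat (card (carrier G)) * f g = (\<Sum>h\<in>carrier G. f h)"
proof -
  interpret group G by fact
  have "of_nat (card (carrier G)) * f g
      = (\<Sum>y\<in>carrier G. transform G W f y * W (inv g) y)"
    using fourier_inversion[OF G fin W g] by simp
  also have "\<dots> = (\<Sum>y\<in>carrier G. if y = \<one> then transform G W f \<one> else 0)"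
    using W g zero by (intro sum.cong) (auto simp: self_pairing_def)
  also have "\<dots> = transform G W f \<one>" using fin by simp
  finally show ?thesis using transform_at_one[OF W] by simp
qed

text \<open>Counting the ways to write \<open>g\<close> as a quotient of two elements of \<open>D\<close> is a convolution, which
the transform turns into a product; the two factors agree because \<open>D\<close> is closed under inverses.\<close>

lemma transform_autocorrelation:
  fixes G (structure)
  assumes G: "comm_group G" and fin: "finite (carrier G)" and W: "self_pairing G W"
    and D: "D \<subseteq> carrier G" and symm: "\<And>d. d \<in> D \<Longrightarrow> inv\<^bsub>G\<^esub> d \<in> D" and y: "y \<in> carrier G"
  shows "transform G W (\<lambda>g. of_nat (card {d \<in> D. g \<otimes>\<^bsub>G\<^esub> d \<in> D})) y
       = (transform G W (indicator D) y)\<^sup>2"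
proof -
  interpret comm_group G by fact
  have finD: "finite D" using D fin finite_subset by blast
  have hat: "transform G W (indicator D) y = (\<Sum>d\<in>D. W d y)"
    unfolding transform_def
    by (rule sum.mono_neutral_cong_right) (use D fin in \<open>auto simp: indicator_def\<close>)
  have mult: "W (g \<otimes> h) y = W g y * W h y" if "g \<in> carrier G" "h \<in> carrier G" for g h
    using W that y by (simp add: self_pairing_def)
  have "transform G W (\<lambda>g. of_nat (card {d \<in> D. g \<otimes> d \<in> D})) y
      = (\<Sum>g\<in>carrier G. \<Sum>d\<in>D. if g \<otimes> d \<in> D then W g y else 0)"
    unfolding transform_def using finD
    by (simp add: sum.If_cases Int_def)
  also have "\<dots> = (\<Sum>d\<in>D. \<Sum>g\<in>carrier G. if g \<otimes> d \<in> D then W g y else 0)"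
    by (rule sum.swap)
  also have "\<dots> = (\<Sum>d\<in>D. \<Sum>e\<in>D. W e y * W (inv d) y)"
  proof (rule sum.cong)
    fix d assume d: "d \<in> D"
    with D have dc: "d \<in> carrier G" by auto
    have "(\<Sum>g\<in>carrier G. if g \<otimes> d \<in> D then W g y else 0)
        = (\<Sum>g\<in>{g\<in>carrier G. g \<otimes> d \<in> D}. W g y)"
      using fin by (simp add: sum.inter_filter)
    also have "\<dots> = (\<Sum>e\<in>D. W (e \<otimes> inv d) y)"
      using D dc by (intro sum.reindex_bij_witness[of _ "\<lambda>e. e \<otimes> inv d" "\<lambda>g. g \<otimes> d"])
        (auto simp: m_assoc)
    also have "\<dots> = (\<Sum>e\<in>D. W e y * W (inv d) y)"
      using D dc by (intro sum.cong) (auto intro!: mult)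
    finally show "(\<Sum>g\<in>carrier G. if g \<otimes> d \<in> D then W g y else 0) = \<dots>" .
  qed simp
  also have "\<dots> = (\<Sum>e\<in>D. W e y) * (\<Sum>d\<in>D. W (inv d) y)"
    by (subst sum.swap) (simp add: sum_product)
  also have "(\<Sum>d\<in>D. W (inv d) y) = (\<Sum>d\<in>D. W d y)"
    using D symm by (intro sum.reindex_bij_witness[of _ "\<lambda>d. inv d" "\<lambda>d. inv d"]) auto
  finally show ?thesis using hat by (simp add: power2_eq_square)
qed

text \<open>Both possible values \<open>t\<close> of the transform are roots of \<open>(t + c) (t + c - u)\<close>. Hence the number of
representations of \<open>g\<close> as a quotient of elements of \<open>D\<close>, corrected by multiples of the
indicators of \<open>D\<close> and of the identity, has a transform that vanishes at all nontrivial characters, and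
so it is constant. The constant is found by summing over the group.\<close>

lemma strongly_regular_Cayley_graph_if_transform_two_valued:
  fixes G (structure) and u :: nat and c :: int
  assumes G: "comm_group G" and fin: "finite (carrier G)" and W: "self_pairing G W"
    and order: "card (carrier G) = u\<^sup>2"
    and D: "D \<subseteq> carrier G" "\<one>\<^bsub>G\<^esub> \<notin> D" and symm: "\<And>d. d \<in> D \<Longrightarrow> inv\<^bsub>G\<^esub> d \<in> D"
    and cardD: "int (card D) = c * (int u - 1)"
    and two: "\<And>y. y \<in> carrier G \<Longrightarrow> y \<noteq> \<one>\<^bsub>G\<^esub> \<Longrightarrow>
      transform G W (indicator D) y = of_int (- c) \<or> transform G W (indicator D) y = of_int (int u - c)"
  shows "strongly_regular_graph (Cay G D) ((int u)\<^sup>2) (c * (int u - 1))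
           (int u + c\<^sup>2 - 3 * c) (c\<^sup>2 - c) \<and> Cayley_graph_on G (Cay G D)"
proof -
  interpret comm_group G by fact
  define r where "r g = card {d \<in> D. g \<otimes> d \<in> D}" for g
  have finD: "finite D" using D fin finite_subset by blast
  have upos: "u > 0" using order fin one_closed by (cases "u = 0") auto
  \<comment> \<open>the coefficients come from \<open>t\<^sup>2 = (u - 2c) t + c (u - c)\<close>\<close>
  define f :: "_ \<Rightarrow> complex" where
    "f g = of_nat (r g) - of_int (int u - 2 * c) * indicator D g - (if g = \<one> then of_int (c * (int u - c)) else 0)"
    for g
  have vanish: "transform G W f y = 0" if y: "y \<in> carrier G" "y \<noteq> \<one>" for y
  proof -
    let ?t = "transform G W (indicator D) y"
    have "transform G W f y = ?t\<^sup>2 - of_int (int u - 2 * c) * ?t - of_int (c * (int u - c))"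
      unfolding f_def transform_linear r_def
      using transform_autocorrelation[OF G fin W D(1) symm y(1)] transform_delta[OF W fin y(1) is_group]
      by simp
    also have "\<dots> = (?t + of_int c) * (?t + of_int c - of_nat u)"
      by (simp add: power2_eq_square algebra_simps)
    finally show ?thesis using two[OF y] by auto
  qed
  have total: "(\<Sum>g\<in>carrier G. f g) = of_int ((c\<^sup>2 - c) * (int u)\<^sup>2)"
  proof -
    have sumD: "(\<Sum>g\<in>carrier G. indicator D g) = (of_int (c * (int u - 1)) :: complex)"
    proof -
      have "(\<Sum>g\<in>carrier G. indicator D g) = (\<Sum>g\<in>D. 1 :: complex)"
        by (rule sum.mono_neutral_cong_right) (use D fin in \<open>auto simp: indicator_def\<close>)
      also have "\<dots> = of_int (int (card D))" by simp
      finally show ?thesis using cardD by simp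
    qed
    have "(\<Sum>g\<in>carrier G. of_nat (r g)) = (of_int (c * (int u - 1)) :: complex)\<^sup>2"
      using transform_autocorrelation[OF G fin W D(1) symm one_closed] sumD
      by (simp add: transform_at_one[OF W] r_def)
    then have "(\<Sum>g\<in>carrier G. f g) = (of_int (c * (int u - 1)))\<^sup>2
        - of_int (int u - 2 * c) * of_int (c * (int u - 1)) - of_int (c * (int u - c))"
      unfolding f_def sum_subtractf sum_distrib_left[symmetric] sumD using fin by simp
    then show ?thesis
      by (simp only: of_int_power[symmetric] of_int_mult[symmetric] of_int_diff[symmetric] of_int_eq_iff)
         (simp add: power2_eq_square algebra_simps)
  qed
  have fval: "f g = of_int (c\<^sup>2 - c)" if "g \<in> carrier G" for g
  proof -
    have "of_nat (card (carrier G)) * f g = of_int ((c\<^sup>2 - c) * (int u)\<^sup>2)"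
      using constant_if_transform_vanishes[OF is_group fin W vanish that] total by simp
    then have "of_nat (u\<^sup>2) * f g = of_nat (u\<^sup>2) * of_int (c\<^sup>2 - c)"
      unfolding order by (simp add: mult.commute)
    then show ?thesis using upos by simp
  qed
  have rval: "int (r g) = c\<^sup>2 - c + (if g \<in> D then int u - 2 * c else 0)"
    if "g \<in> carrier G" "g \<noteq> \<one>" for g
  proof -
    have "of_int (int (r g)) = (of_int (c\<^sup>2 - c + (if g \<in> D then int u - 2 * c else 0)) :: complex)"
      using fval[OF that(1)] that(2) by (auto simp: f_def indicator_def algebra_simps)
    then show ?thesis by (simp only: of_int_eq_iff)
  qed
  have inv_mem: "inv d \<in> D \<longleftrightarrow> d \<in> D" if "d \<in> carrier G" for d
    using symm that by (metis inv_inv)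
  have nb: "neighbours (Cay G D) x = {y \<in> carrier G. x \<otimes> inv y \<in> D}" if "x \<in> carrier G" for x
    using that by (auto simp: neighbours_def Cay_def)
  have deg: "card (neighbours (Cay G D) x) = card D" if x: "x \<in> carrier G" for x
    unfolding nb[OF x]
    by (rule bij_betw_same_card[of "\<lambda>y. x \<otimes> inv y"], rule bij_betw_byWitness[where f' = "\<lambda>d. inv d \<otimes> x"])
       (use x D in \<open>auto simp: inv_mult_group m_assoc[symmetric] subsetD\<close>,
        auto simp: m_assoc)
  have common: "card (neighbours (Cay G D) x \<inter> neighbours (Cay G D) y) = r (y \<otimes> inv x)"
    if x: "x \<in> carrier G" and y: "y \<in> carrier G" for x y
  proof -
    have 1: "y \<otimes> inv x \<otimes> (x \<otimes> inv z) = y \<otimes> inv z" if "z \<in> carrier G" for z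
      using x y that by (metis inv_closed inv_solve_right m_assoc m_closed)
    have 2: "x \<otimes> inv (inv d \<otimes> x) = d" "y \<otimes> inv (inv d \<otimes> x) = y \<otimes> inv x \<otimes> d" if "d \<in> carrier G" for d
      using x y that by (simp_all add: inv_mult_group m_assoc[symmetric])
    have 3: "inv (x \<otimes> inv z) \<otimes> x = z" if "z \<in> carrier G" for z
      using x that by (simp add: inv_mult_group m_assoc)
    have "neighbours (Cay G D) x \<inter> neighbours (Cay G D) y
        = {z \<in> carrier G. x \<otimes> inv z \<in> D \<and> y \<otimes> inv z \<in> D}"
      using nb[OF x] nb[OF y] by auto
    then show ?thesis unfolding r_def
      by (simp, intro bij_betw_same_card[of "\<lambda>z. x \<otimes> inv z"] bij_betw_byWitness[where f' = "\<lambda>d. inv d \<otimes> x"])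
         (use x y D 1 2 3 in \<open>auto simp: subsetD\<close>)
  qed
  have arcs: "(x, y) \<in> parcs (Cay G D) \<longleftrightarrow> y \<otimes> inv x \<in> D" if x: "x \<in> carrier G" and y: "y \<in> carrier G" for x y
  proof -
    have "inv (y \<otimes> inv x) = x \<otimes> inv y" using x y by (simp add: inv_mult_group)
    then show ?thesis using x y inv_mem[of "y \<otimes> inv x"] by (simp add: Cay_def)
  qed
  have ne: "y \<otimes> inv x \<noteq> \<one>" if "x \<in> carrier G" "y \<in> carrier G" "x \<noteq> y" for x y
    using that by (metis inv_closed inv_equality inv_inv)
  have verts: "pverts (Cay G D) = carrier G" by (simp add: Cay_def)
  have "pair_graph (Cay G D)"
  proof
    show "finite (pverts (Cay G D))" using fin by (simp add: Cay_def)
    show "finite (parcs (Cay G D))"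
      by (rule finite_subset[of _ "carrier G \<times> carrier G"]) (auto simp: Cay_def fin)
    show "fst e \<in> pverts (Cay G D)" "snd e \<in> pverts (Cay G D)" if "e \<in> parcs (Cay G D)" for e
      using that by (auto simp: Cay_def)
    show "fst e \<noteq> snd e" if "e \<in> parcs (Cay G D)" for e
      using that D by (auto simp: Cay_def)
    show "symmetric (with_proj (Cay G D))"
      unfolding symmetric_def sym_def using arcs inv_mem
      by (auto simp: Cay_def)
  qed
  have "(\<lambda>x. inv x) ` D = D"
    using D symm by (auto simp: image_iff) (metis inv_inv subsetD)
  then have "Cayley_graph_on G (Cay G D)"
    using D by (auto simp: Cayley_graph_on_def)
  moreover have "strongly_regular_graph (Cay G D) ((int u)\<^sup>2) (c * (int u - 1))
           (int u + c\<^sup>2 - 3 * c) (c\<^sup>2 - c)"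
    unfolding strongly_regular_graph_def verts
  proof (intro conjI ballI impI)
    show "int (card (carrier G)) = (int u)\<^sup>2" by (simp add: order)
    fix x assume x: "x \<in> carrier G"
    show "int (card (neighbours (Cay G D) x)) = c * (int u - 1)"
      using deg[OF x] cardD by simp
    fix y assume y: "y \<in> carrier G"
    have yx: "y \<otimes> inv x \<in> carrier G" using x y by simp
    {
      assume "(x, y) \<in> parcs (Cay G D)"
      then have "y \<otimes> inv x \<in> D" using arcs[OF x y] by simp
      moreover from this have "y \<otimes> inv x \<noteq> \<one>" using D(2) by auto
      ultimately show "int (card (neighbours (Cay G D) x \<inter> neighbours (Cay G D) y)) = int u + c\<^sup>2 - 3 * c"
        unfolding common[OF x y] using rval[OF yx] by simp
    }
    {
      assume xy: "x \<noteq> y \<and> (x, y) \<notin> parcs (Cay G D)"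
      then have "y \<otimes> inv x \<notin> D" using arcs[OF x y] by simp
      moreover have "y \<otimes> inv x \<noteq> \<one>" using ne[OF x y] xy by simp
      ultimately show "int (card (neighbours (Cay G D) x \<inter> neighbours (Cay G D) y)) = c\<^sup>2 - c"
        unfolding common[OF x y] using rval[OF yx] by simp
    }
  qed (fact \<open>pair_graph (Cay G D)\<close>)
  ultimately show ?thesis by blast
qed

section \<open>Labellings in two halves and their products\<close>

text \<open>The field \<open>half\<close> says to which half a nonidentity element belongs. The labels are exponents of
roots of unity and matter only modulo the order of the root.\<close>

record 'a labelling =
  half :: "'a \<Rightarrow> bool"
  plus_label :: "'a \<Rightarrow> nat"
  minus_label :: "'a \<Rightarrow> nat"

definition plus_fun :: "'a \<Rightarrow> 'a labelling \<Rightarrow> complex \<Rightarrow> bool \<Rightarrow> 'a \<Rightarrow> complex" where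
  "plus_fun e L \<zeta> \<beta> g = (if g = e \<or> half L g = \<beta> then \<zeta> ^ plus_label L g else 0)"

definition minus_fun :: "'a \<Rightarrow> 'a labelling \<Rightarrow> complex \<Rightarrow> bool \<Rightarrow> 'a \<Rightarrow> complex" where
  "minus_fun e L \<zeta> \<beta> g = (if g \<noteq> e \<and> half L g = \<beta> then \<zeta> ^ minus_label L g else 0)"

definition relabel :: "('b \<Rightarrow> 'a) \<Rightarrow> 'a labelling \<Rightarrow> 'b labelling" where
  "relabel \<phi> L = \<lparr>half = half L \<circ> \<phi>, plus_label = plus_label L \<circ> \<phi>, minus_label = minus_label L \<circ> \<phi>\<rparr>"

text \<open>The lexicographic rule for \<open>half\<close> and the case distinctions for the labels are forced by the product formulas in
\<open>combine_funs\<close>: at every point at most one of the two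
tensor products on the right is nonzero.\<close>

definition combine :: "'a \<Rightarrow> 'a labelling \<Rightarrow> 'b \<Rightarrow> 'b labelling \<Rightarrow> ('a \<times> 'b) labelling" where
  "combine d K e L =
     \<lparr>half = (\<lambda>(g, h). if g = d then half L h else half K g),
      plus_label = (\<lambda>(g, h). if g = d \<or> h = e \<or> half K g = half L h
        then plus_label K g + plus_label L h else minus_label K g + minus_label L h),
      minus_label = (\<lambda>(g, h). if h \<noteq> e \<and> (g = d \<or> half K g = half L h)
        then plus_label K g + minus_label L h else minus_label K g + plus_label L h)\<rparr>"

lemma relabel_funs:
  assumes "\<phi> g = \<phi> e \<longleftrightarrow> g = e"
  shows "plus_fun e (relabel \<phi> L) \<zeta> \<beta> g = plus_fun (\<phi> e) L \<zeta> \<beta> (\<phi> g)"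
    and "minus_fun e (relabel \<phi> L) \<zeta> \<beta> g = minus_fun (\<phi> e) L \<zeta> \<beta> (\<phi> g)"
  using assms by (simp_all add: plus_fun_def minus_fun_def relabel_def)

lemma combine_funs:
  assumes "plus_label K d = 0" "plus_label L e = 0"
  shows "plus_fun (d, e) (combine d K e L) \<zeta> \<beta> (g, h) =
      plus_fun d K \<zeta> \<beta> g * plus_fun e L \<zeta> \<beta> h + minus_fun d K \<zeta> \<beta> g * minus_fun e L \<zeta> (\<not> \<beta>) h"
    and "minus_fun (d, e) (combine d K e L) \<zeta> \<beta> (g, h) =
      plus_fun d K \<zeta> \<beta> g * minus_fun e L \<zeta> \<beta> h + minus_fun d K \<zeta> \<beta> g * plus_fun e L \<zeta> (\<not> \<beta>) h"
  using assms by (auto simp: plus_fun_def minus_fun_def combine_def power_add)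

text \<open>The labelling \<open>L\<close> describes the transforms of the functions given by \<open>K\<close>. The minus functions change sign and
switch the half. The condition on inverses makes the classes of the labelling symmetric.\<close>

definition dual_labellings ::
  "('a, 'b) monoid_scheme \<Rightarrow> nat \<Rightarrow> nat \<Rightarrow> ('a \<Rightarrow> 'a \<Rightarrow> complex) \<Rightarrow> 'a labelling \<Rightarrow> 'a labelling \<Rightarrow> bool" where
  "dual_labellings G m u W K L \<longleftrightarrow>
     comm_group G \<and> finite (carrier G) \<and> card (carrier G) = u\<^sup>2 \<and> self_pairing G W \<and>
     plus_label K \<one>\<^bsub>G\<^esub> = 0 \<and> plus_label L \<one>\<^bsub>G\<^esub> = 0 \<and>
     (\<forall>g\<in>carrier G. half K (inv\<^bsub>G\<^esub> g) = half K g \<and> plus_label K (inv\<^bsub>G\<^esub> g) = plus_label K g \<and>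
        minus_label K (inv\<^bsub>G\<^esub> g) = minus_label K g) \<and>
     (\<forall>\<zeta> \<beta>. \<zeta> ^ m = 1 \<and> \<zeta> \<noteq> 1 \<longrightarrow> (\<forall>y\<in>carrier G.
        transform G W (plus_fun \<one>\<^bsub>G\<^esub> K \<zeta> \<beta>) y = of_nat u * plus_fun \<one>\<^bsub>G\<^esub> L \<zeta> \<beta> y \<and>
        transform G W (minus_fun \<one>\<^bsub>G\<^esub> K \<zeta> \<beta>) y = - of_nat u * minus_fun \<one>\<^bsub>G\<^esub> L \<zeta> (\<not> \<beta>) y))"

definition has_dual_labellings :: "('a, 'b) monoid_scheme \<Rightarrow> nat \<Rightarrow> nat \<Rightarrow> bool" where
  "has_dual_labellings G m u \<longleftrightarrow> (\<exists>W K L. dual_labellings G m u W K L)"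

lemma has_dual_labellings_iso:
  assumes H: "comm_group H" and iso: "\<phi> \<in> iso H G" and G: "has_dual_labellings G m u"
  shows "has_dual_labellings H m u"
proof -
  from G obtain W K L where dl: "dual_labellings G m u W K L"
    by (auto simp: has_dual_labellings_def)
  interpret G: comm_group G using dl by (simp add: dual_labellings_def)
  interpret H: comm_group H by fact
  have hom: "\<phi> \<in> hom H G" and bij: "bij_betw \<phi> (carrier H) (carrier G)"
    using iso by (auto simp: iso_def)
  interpret \<phi>: group_hom H G \<phi> using hom by unfold_locales
  have inj: "\<phi> g = \<phi> h \<longleftrightarrow> g = h" if "g \<in> carrier H" "h \<in> carrier H" for g h
    using bij that by (auto simp: bij_betw_def inj_on_def)
  have inj1: "\<phi> g = \<one>\<^bsub>G\<^esub> \<longleftrightarrow> g = \<one>\<^bsub>H\<^esub>" if "g \<in> carrier H" for g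
    using inj[OF that H.one_closed] by simp
  have sum: "(\<Sum>g\<in>carrier H. f (\<phi> g)) = (\<Sum>g\<in>carrier G. f g)" for f :: "_ \<Rightarrow> complex"
    by (rule sum.reindex_bij_betw[OF bij])
  have sumW: "(\<Sum>g\<in>carrier H. W (\<phi> g) z) = (\<Sum>g\<in>carrier G. W g z)" for z
    by (rule sum)
  let ?W = "\<lambda>g y. W (\<phi> g) (\<phi> y)"
  have W: "self_pairing H ?W"
    using dl unfolding dual_labellings_def self_pairing_def by (simp add: sum sumW inj1)
  have tr: "transform H ?W (\<lambda>g. f (\<phi> g)) y = transform G W f (\<phi> y)" for f y
    unfolding transform_def by (rule sum)
  have trp: "transform H ?W (plus_fun \<one>\<^bsub>H\<^esub> (relabel \<phi> K) \<zeta> \<beta>) y = transform G W (plus_fun \<one>\<^bsub>G\<^esub> K \<zeta> \<beta>) (\<phi> y)"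
    and trm: "transform H ?W (minus_fun \<one>\<^bsub>H\<^esub> (relabel \<phi> K) \<zeta> \<beta>) y = transform G W (minus_fun \<one>\<^bsub>G\<^esub> K \<zeta> \<beta>) (\<phi> y)"
    for \<zeta> :: complex and \<beta> :: bool and y
    unfolding tr[symmetric] by (rule transform_cong, simp add: relabel_funs inj1)+
  have "dual_labellings H m u ?W (relabel \<phi> K) (relabel \<phi> L)"
    using dl W H bij_betw_finite[OF bij] bij_betw_same_card[OF bij]
    unfolding dual_labellings_def trp trm
    by (simp add: relabel_funs inj1) (simp add: relabel_def)
  then show ?thesis by (auto simp: has_dual_labellings_def)
qed

text \<open>The transform of a tensor product is the tensor product of the transforms. Since minus functions
switch the half, the transformed products are those of the combined dual labellings with the two
factors in exchanged order, which is why the dual labelling is formed with \<open>prod.swap\<close>.\<close>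

lemma has_dual_labellings_DirProd:
  assumes G: "has_dual_labellings G m u" and H: "has_dual_labellings H m v"
  shows "has_dual_labellings (G \<times>\<times> H) m (u * v)"
proof -
  from G obtain W K L where dG: "dual_labellings G m u W K L"
    by (auto simp: has_dual_labellings_def)
  from H obtain W' K' L' where dH: "dual_labellings H m v W' K' L'"
    by (auto simp: has_dual_labellings_def)
  interpret G: comm_group G using dG by (simp add: dual_labellings_def)
  interpret H: comm_group H using dH by (simp add: dual_labellings_def)
  let ?P = "G \<times>\<times> H"
  let ?W = "\<lambda>(g, h) (y, z). W g y * W' h z"
  let ?K = "combine \<one>\<^bsub>G\<^esub> K \<one>\<^bsub>H\<^esub> K'"
  let ?L = "relabel prod.swap (combine \<one>\<^bsub>H\<^esub> L' \<one>\<^bsub>G\<^esub> L)"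
  have P: "comm_group ?P"
    by (rule comm_groupI) (auto simp: G.m_ac H.m_ac intro: G.l_inv_ex H.l_inv_ex)
  have sum: "(\<Sum>(g, h)\<in>carrier G \<times> carrier H. f g * f' h)
      = (\<Sum>g\<in>carrier G. f g) * (\<Sum>h\<in>carrier H. f' h)" for f f' :: "_ \<Rightarrow> complex"
    by (simp add: sum_product sum.cartesian_product)
  have sumW: "(\<Sum>x\<in>carrier G \<times> carrier H. ?W x (y, z)) = (\<Sum>g\<in>carrier G. W g y) * (\<Sum>h\<in>carrier H. W' h z)"
    for y z
    unfolding sum[symmetric] by (intro sum.cong) auto
  have W: "self_pairing ?P ?W"
    using dG dH unfolding dual_labellings_def self_pairing_def
    by (auto simp: sum sumW)
  have tr: "transform ?P ?W (\<lambda>(g, h). f g * f' h) (y, z) = transform G W f y * transform H W' f' z"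
    for f f' y z
    unfolding transform_def sum[symmetric] by (auto intro!: sum.cong)
  have Kp: "plus_fun \<one>\<^bsub>?P\<^esub> ?K \<zeta> \<beta> = (\<lambda>x. (case x of (g, h) \<Rightarrow> plus_fun \<one>\<^bsub>G\<^esub> K \<zeta> \<beta> g * plus_fun \<one>\<^bsub>H\<^esub> K' \<zeta> \<beta> h)
      + (case x of (g, h) \<Rightarrow> minus_fun \<one>\<^bsub>G\<^esub> K \<zeta> \<beta> g * minus_fun \<one>\<^bsub>H\<^esub> K' \<zeta> (\<not> \<beta>) h))"
   and Km: "minus_fun \<one>\<^bsub>?P\<^esub> ?K \<zeta> \<beta> = (\<lambda>x. (case x of (g, h) \<Rightarrow> plus_fun \<one>\<^bsub>G\<^esub> K \<zeta> \<beta> g * minus_fun \<one>\<^bsub>H\<^esub> K' \<zeta> \<beta> h)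
      + (case x of (g, h) \<Rightarrow> minus_fun \<one>\<^bsub>G\<^esub> K \<zeta> \<beta> g * plus_fun \<one>\<^bsub>H\<^esub> K' \<zeta> (\<not> \<beta>) h))"
   for \<zeta> :: complex and \<beta> :: bool
    using dG dH by (auto simp: dual_labellings_def combine_funs fun_eq_iff)
  have swap: "prod.swap x = prod.swap \<one>\<^bsub>?P\<^esub> \<longleftrightarrow> x = \<one>\<^bsub>?P\<^esub>" for x by (cases x) auto
  have Lp: "plus_fun \<one>\<^bsub>?P\<^esub> ?L \<zeta> \<beta> (y, z) = plus_fun \<one>\<^bsub>H\<^esub> L' \<zeta> \<beta> z * plus_fun \<one>\<^bsub>G\<^esub> L \<zeta> \<beta> y
      + minus_fun \<one>\<^bsub>H\<^esub> L' \<zeta> \<beta> z * minus_fun \<one>\<^bsub>G\<^esub> L \<zeta> (\<not> \<beta>) y"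
   and Lm: "minus_fun \<one>\<^bsub>?P\<^esub> ?L \<zeta> \<beta> (y, z) = plus_fun \<one>\<^bsub>H\<^esub> L' \<zeta> \<beta> z * minus_fun \<one>\<^bsub>G\<^esub> L \<zeta> \<beta> y
      + minus_fun \<one>\<^bsub>H\<^esub> L' \<zeta> \<beta> z * plus_fun \<one>\<^bsub>G\<^esub> L \<zeta> (\<not> \<beta>) y"
   for \<zeta> :: complex and \<beta> :: bool and y z
    using dG dH unfolding relabel_funs[where \<phi> = prod.swap, OF swap] by (simp_all add: dual_labellings_def combine_funs)
  have card: "card (carrier ?P) = (u * v)\<^sup>2"
    using dG dH by (simp add: dual_labellings_def card_cartesian_product power_mult_distrib)
  have inv: "inv\<^bsub>?P\<^esub> (g, h) = (inv\<^bsub>G\<^esub> g, inv\<^bsub>H\<^esub> h)" if "g \<in> carrier G" "h \<in> carrier H" for g h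
    using that by (simp add: inv_DirProd G.is_group H.is_group)
  have inv1: "inv\<^bsub>G\<^esub> g = \<one>\<^bsub>G\<^esub> \<longleftrightarrow> g = \<one>\<^bsub>G\<^esub>" if "g \<in> carrier G" for g
    using that by (metis G.inv_inv G.inv_one)
  have inv2: "inv\<^bsub>H\<^esub> g = \<one>\<^bsub>H\<^esub> \<longleftrightarrow> g = \<one>\<^bsub>H\<^esub>" if "g \<in> carrier H" for g
    using that by (metis H.inv_inv H.inv_one)
  have "dual_labellings ?P m (u * v) ?W ?K ?L"
    unfolding dual_labellings_def
  proof (intro conjI allI impI ballI)
    show "finite (carrier ?P)" using dG dH by (simp add: dual_labellings_def)
    show "plus_label ?K \<one>\<^bsub>?P\<^esub> = 0" "plus_label ?L \<one>\<^bsub>?P\<^esub> = 0"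
      using dG dH by (simp_all add: dual_labellings_def combine_def relabel_def)
    fix x assume x: "x \<in> carrier ?P"
    then show "half ?K (inv\<^bsub>?P\<^esub> x) = half ?K x" "plus_label ?K (inv\<^bsub>?P\<^esub> x) = plus_label ?K x"
      "minus_label ?K (inv\<^bsub>?P\<^esub> x) = minus_label ?K x"
      using dG dH by (auto simp: dual_labellings_def combine_def inv inv1 inv2)
  next
    fix \<zeta> :: complex and \<beta> x assume \<zeta>: "\<zeta> ^ m = 1 \<and> \<zeta> \<noteq> 1" and x: "x \<in> carrier ?P"
    obtain y z where yz: "x = (y, z)" "y \<in> carrier G" "z \<in> carrier H" using x by auto
    show "transform ?P ?W (plus_fun \<one>\<^bsub>?P\<^esub> ?K \<zeta> \<beta>) x = of_nat (u * v) * plus_fun \<one>\<^bsub>?P\<^esub> ?L \<zeta> \<beta> x"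
      "transform ?P ?W (minus_fun \<one>\<^bsub>?P\<^esub> ?K \<zeta> \<beta>) x = - of_nat (u * v) * minus_fun \<one>\<^bsub>?P\<^esub> ?L \<zeta> (\<not> \<beta>) x"
      using dG dH \<zeta> yz(2,3) unfolding yz(1) Kp Km Lp Lm transform_linear tr
      by (simp_all add: dual_labellings_def algebra_simps)
  qed (use P W card in auto)
  then show ?thesis by (auto simp: has_dual_labellings_def)
qed

text \<open>The induction can start with the empty product: on the trivial group all functions are determined by
their value at the identity.\<close>

lemma has_dual_labellings_product_group:
  assumes "finite I" and "\<And>i. i \<in> I \<Longrightarrow> has_dual_labellings (G i) m (v i)"
  shows "has_dual_labellings (product_group I G) m (\<Prod>i\<in>I. v i)"
  using assms
proof (induction I rule: finite_induct)
  case empty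
  let ?P = "product_group {} G"
  have "comm_group ?P"
    by (rule comm_groupI) auto
  then have "dual_labellings ?P m 1 (\<lambda>_ _. 1) \<lparr>half = \<lambda>_. True, plus_label = \<lambda>_. 0, minus_label = \<lambda>_. 0\<rparr>
      \<lparr>half = \<lambda>_. True, plus_label = \<lambda>_. 0, minus_label = \<lambda>_. 0\<rparr>"
    by (auto simp: dual_labellings_def self_pairing_def transform_def plus_fun_def minus_fun_def)
  then show ?case by (auto simp: has_dual_labellings_def)
next
  case (insert k I)
  have grp: "comm_group (G i)" if "i \<in> insert k I" for i
    using insert.prems[OF that] by (auto simp: has_dual_labellings_def dual_labellings_def)
  let ?P = "product_group (insert k I) G" and ?Q = "product_group I G \<times>\<times> G k"
  have "group ?P" by (rule product_group) (rule comm_group.axioms(2)[OF grp])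
  moreover have "x \<otimes>\<^bsub>?P\<^esub> y = y \<otimes>\<^bsub>?P\<^esub> x" if "x \<in> carrier ?P" "y \<in> carrier ?P" for x y
    using that by (auto simp: PiE_def Pi_def restrict_def fun_eq_iff intro!: comm_groupE(4)[OF grp])
  ultimately have comm: "comm_group ?P" by (rule group.group_comm_groupI)
  have "(\<lambda>x. (restrict x I, x k)) \<in> iso ?P ?Q"
  proof -
    have "(\<lambda>x. (restrict x I, x k)) \<in> hom ?P ?Q"
      by (rule homI) (auto simp: fun_eq_iff restrict_def)
    moreover have "bij_betw (\<lambda>x. (restrict x I, x k)) (carrier ?P) (carrier ?Q)"
      by (rule bij_betw_byWitness[where f' = "\<lambda>(x, a). x(k := a)"])
         (use insert.hyps in \<open>auto simp: fun_eq_iff restrict_def PiE_def extensional_def Pi_def\<close>)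
    ultimately show ?thesis by (simp add: iso_def)
  qed
  moreover have "has_dual_labellings ?Q m ((\<Prod>i\<in>I. v i) * v k)"
    using insert by (intro has_dual_labellings_DirProd) auto
  ultimately have "has_dual_labellings ?P m ((\<Prod>i\<in>I. v i) * v k)"
    by (rule has_dual_labellings_iso[OF comm])
  then show ?case using insert.hyps by (simp add: mult.commute)
qed

section \<open>From labellings to strongly regular graphs\<close>

text \<open>Multiplication by a primitive root permutes the roots and multiplies the sum by a factor different from
\<open>1\<close>, unless \<open>m\<close> divides \<open>k\<close>.\<close>

lemma sum_powers_of_roots_of_unity:
  assumes "m > 0"
  shows "(\<Sum>\<zeta> | \<zeta> ^ m = 1. \<zeta> ^ k) = (if m dvd k then of_nat m else (0 :: complex))"
proof (cases "m dvd k")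
  case True
  then have "\<zeta> ^ k = 1" if "\<zeta> ^ m = 1" for \<zeta> :: complex
    using that by (auto simp: power_mult)
  then show ?thesis using True card_roots_unity_eq[OF assms] by simp
next
  case False
  define \<omega> where "\<omega> = cis (2 * pi / m)"
  have \<omega>m: "\<omega> ^ m = 1" using assms by (simp add: \<omega>_def DeMoivre)
  have "bij_betw (\<lambda>j. cis (2 * pi * real j / real m)) {..<m} {z. z ^ m = 1}"
    using assms by (rule bij_betw_roots_unity)
  then have inj: "inj_on (\<lambda>j. cis (2 * pi * real j / real m)) {..<m}" by (rule bij_betw_imp_inj_on)
  have pw: "\<omega> ^ j = cis (2 * pi * real j / real m)" for j
    by (simp add: \<omega>_def DeMoivre mult.commute)
  have "\<omega> ^ k = \<omega> ^ (k mod m)"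
    using \<omega>m by (metis mult_div_mod_eq power_add power_mult power_one mult_1)
  also have "\<dots> \<noteq> \<omega> ^ 0"
  proof
    assume "\<omega> ^ (k mod m) = \<omega> ^ 0"
    then have "k mod m = 0"
      unfolding pw by (rule inj_onD[OF inj]) (use assms in simp_all)
    then show False using False by (simp add: dvd_eq_mod_eq_0)
  qed
  finally have ne: "\<omega> ^ k \<noteq> 1" by simp
  have "\<omega> \<noteq> 0" by (simp add: \<omega>_def)
  have "(\<Sum>\<zeta> | \<zeta> ^ m = 1. \<zeta> ^ k) = (\<Sum>\<zeta> | \<zeta> ^ m = 1. (\<omega> * \<zeta>) ^ k)"
    using \<omega>m \<open>\<omega> \<noteq> 0\<close> by (intro sum.reindex_bij_witness[of _ "\<lambda>\<zeta>. \<omega> * \<zeta>" "\<lambda>\<zeta>. \<zeta> / \<omega>"])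
      (simp_all add: power_mult_distrib power_divide)
  also have "\<dots> = \<omega> ^ k * (\<Sum>\<zeta> | \<zeta> ^ m = 1. \<zeta> ^ k)"
    by (simp add: power_mult_distrib sum_distrib_left)
  finally have "(1 - \<omega> ^ k) * (\<Sum>\<zeta> | \<zeta> ^ m = 1. \<zeta> ^ k) = 0" by (simp add: left_diff_distrib)
  then show ?thesis using ne False by simp
qed

text \<open>The elements of the second half get their label shifted by \<open>s\<close>, which corresponds to the function
\<open>P True + \<zeta>^s P False\<close>. The indicator of a label class is the average of the functions
\<open>\<zeta>^(label - l)\<close> over all \<open>m\<close>-th roots of unity \<open>\<zeta>\<close>. The root \<open>\<zeta> = 1\<close> contributes the indicator of
the nonidentity elements, and removing the value \<open>1 + \<zeta>^s\<close> at the identity from the others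
produces the two extra terms in \<open>c\<close>.\<close>

lemma strongly_regular_Cayley_graph_of_labelling:
  assumes G: "has_dual_labellings G m u" and m: "m > 0" "m dvd u - 1"
    and s: "s < m" and I: "I \<subseteq> {..<m}"
    and c: "c = int (card I) * ((int u - 1) div int m) + of_bool (0 \<in> I) + of_bool (s \<in> I)"
  shows "\<exists>\<Gamma>. Cayley_graph_on G \<Gamma> \<and> strongly_regular_graph \<Gamma> ((int u)\<^sup>2) (c * (int u - 1))
             (int u + c\<^sup>2 - 3 * c) (c\<^sup>2 - c)"
proof -
  from G obtain W K L where dl: "dual_labellings G m u W K L"
    by (auto simp: has_dual_labellings_def)
  interpret comm_group G using dl by (simp add: dual_labellings_def)
  have fin: "finite (carrier G)" and cardG: "card (carrier G) = u\<^sup>2" and W: "self_pairing G W"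
    using dl by (auto simp: dual_labellings_def)
  have u: "u \<ge> 1" using cardG fin by (cases "u = 0") auto
  have trivial_at: "plus_label K \<one>\<^bsub>G\<^esub> = 0" "plus_label L \<one>\<^bsub>G\<^esub> = 0"
    using dl by (auto simp: dual_labellings_def)
  define R where "R = {\<zeta> :: complex. \<zeta> ^ m = 1}"
  have finR: "finite R" using m by (auto simp: R_def intro: finite_roots_unity)
  have R1: "1 \<in> R" by (simp add: R_def)
  define lab where "lab M g = plus_label M g + (if half M g then 0 else s)" for M :: "'a labelling" and g
  define e where "e l = (u - 1) div m + of_bool (l = 0) + of_bool (l = s)" for l
  define Dl where "Dl l = {g \<in> carrier G. g \<noteq> \<one>\<^bsub>G\<^esub> \<and> lab K g mod m = l}" for l
  have dvd_iff: "m dvd m - l + k \<longleftrightarrow> k mod m = l" if "l < m" for l k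
  proof -
    have "m dvd m - l + k \<longleftrightarrow> m dvd m - l + k mod m"
      by (metis mod_add_right_eq dvd_eq_mod_eq_0)
    also have "\<dots> \<longleftrightarrow> k mod m = l"
    proof
      assume "m dvd m - l + k mod m"
      then obtain t where t: "m - l + k mod m = m * t" by (auto simp: dvd_def)
      have "m * t < m * 2" unfolding t[symmetric] using m(1) mod_less_divisor[of m k] by linarith
      moreover have "m * t > 0" unfolding t[symmetric] using that by simp
      ultimately have "t = 1" by simp
      then show "k mod m = l" using t that by simp
    qed (use that in simp)
    finally show ?thesis .
  qed
  define \<Phi> where "\<Phi> \<zeta> g = (if g = \<one>\<^bsub>G\<^esub> then 0 else \<zeta> ^ lab K g)" for \<zeta> :: complex and g
  have ind: "of_nat m * indicator (Dl l) g = (\<Sum>\<zeta>\<in>R. \<zeta> ^ (m - l) * \<Phi> \<zeta> g)"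
    if l: "l < m" and g: "g \<in> carrier G" for l g
  proof (cases "g = \<one>\<^bsub>G\<^esub>")
    case False
    then have "(\<Sum>\<zeta>\<in>R. \<zeta> ^ (m - l) * \<Phi> \<zeta> g) = (\<Sum>\<zeta>\<in>R. \<zeta> ^ (m - l + lab K g))"
      by (simp add: \<Phi>_def power_add)
    also have "\<dots> = (if lab K g mod m = l then of_nat m else 0)"
      unfolding R_def sum_powers_of_roots_of_unity[OF m(1)] dvd_iff[OF l] ..
    finally show ?thesis using g False by (simp add: Dl_def indicator_def)
  qed (simp add: \<Phi>_def Dl_def)
  have hat\<Phi>: "transform G W (\<Phi> \<zeta>) y = of_nat u * (if y = \<one>\<^bsub>G\<^esub> then 1 + \<zeta> ^ s else \<zeta> ^ lab L y) - (1 + \<zeta> ^ s)"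
    if \<zeta>: "\<zeta> \<in> R - {1}" and y: "y \<in> carrier G" for \<zeta> y
  proof -
    let ?p = "plus_fun \<one>\<^bsub>G\<^esub>"
    have "transform G W (\<Phi> \<zeta>) y = transform G W (\<lambda>g. ?p K \<zeta> True g + \<zeta> ^ s * ?p K \<zeta> False g
       - (if g = \<one>\<^bsub>G\<^esub> then 1 + \<zeta> ^ s else 0)) y"
      using trivial_at by (intro transform_cong) (auto simp: \<Phi>_def plus_fun_def lab_def power_add)
    also have "\<dots> = of_nat u * (?p L \<zeta> True y + \<zeta> ^ s * ?p L \<zeta> False y) - (1 + \<zeta> ^ s)"
      unfolding transform_linear transform_delta[OF W fin y is_group]
      using dl \<zeta> y by (simp add: dual_labellings_def R_def algebra_simps)
    also have "?p L \<zeta> True y + \<zeta> ^ s * ?p L \<zeta> False y = (if y = \<one>\<^bsub>G\<^esub> then 1 + \<zeta> ^ s else \<zeta> ^ lab L y)"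
      using trivial_at by (auto simp: plus_fun_def lab_def power_add)
    finally show ?thesis .
  qed
  have hat1: "transform G W (\<Phi> 1) y = (if y = \<one>\<^bsub>G\<^esub> then of_nat (u\<^sup>2) else 0) - 1" if y: "y \<in> carrier G" for y
  proof -
    have "transform G W (\<Phi> 1) y = transform G W (\<lambda>g. 1 - (if g = \<one>\<^bsub>G\<^esub> then 1 else 0)) y"
      by (intro transform_cong) (auto simp: \<Phi>_def)
    also have "\<dots> = transform G W (\<lambda>g. 1) y - 1"
      unfolding transform_linear transform_delta[OF W fin y is_group] ..
    also have "transform G W (\<lambda>g. 1) y = (if y = \<one>\<^bsub>G\<^esub> then of_nat (u\<^sup>2) else 0)"
      using W y cardG by (simp add: transform_def self_pairing_def)
    finally show ?thesis .
  qed
  have rootsum: "(\<Sum>\<zeta>\<in>R - {1}. \<zeta> ^ (m - l) * \<zeta> ^ k) = of_nat m * of_bool (k mod m = l) - 1" if "l < m" for l k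
    using sum_powers_of_roots_of_unity[OF m(1), of "m - l + k"] dvd_iff[OF that, of k] finR R1
    by (simp add: sum_diff1 R_def power_add)
  have split1: "(\<Sum>\<zeta>\<in>R. f \<zeta>) = (\<Sum>\<zeta>\<in>R - {1}. f \<zeta>) + f 1" for f :: "complex \<Rightarrow> complex"
    using finR R1 by (simp add: sum_diff1)
  have um: "of_nat m * of_nat ((u - 1) div m) = (of_nat u - 1 :: complex)"
    using m(2) u by (metis dvd_mult_div_cancel of_nat_1 of_nat_diff of_nat_mult)
  have me: "of_nat m * of_nat (e l) = (of_nat u - 1 + of_nat m * of_bool (l = 0) + of_nat m * of_bool (l = s) :: complex)" for l
    unfolding e_def of_nat_add distrib_left um by simp
  have rs0: "(\<Sum>\<zeta>\<in>R - {1}. \<zeta> ^ (m - l)) = of_nat m * of_bool (l = 0) - 1"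
    and rss: "(\<Sum>\<zeta>\<in>R - {1}. \<zeta> ^ (m - l) * \<zeta> ^ s) = of_nat m * of_bool (l = s) - 1" if "l < m" for l
  proof -
    have "0 mod m = l \<longleftrightarrow> l = 0" "s mod m = l \<longleftrightarrow> l = s" using s by auto
    then show "(\<Sum>\<zeta>\<in>R - {1}. \<zeta> ^ (m - l)) = of_nat m * of_bool (l = 0) - 1"
      "(\<Sum>\<zeta>\<in>R - {1}. \<zeta> ^ (m - l) * \<zeta> ^ s) = of_nat m * of_bool (l = s) - 1"
      using rootsum[OF that, of 0] rootsum[OF that, of s] by simp_all
  qed
  have hatD: "transform G W (indicator (Dl l)) y =
      (if y = \<one>\<^bsub>G\<^esub> then of_nat (e l) * (of_nat u - 1) else of_nat u * of_bool (lab L y mod m = l) - of_nat (e l))"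
    if l: "l < m" and y: "y \<in> carrier G" for l y
  proof -
    have "of_nat m * transform G W (indicator (Dl l)) y = transform G W (\<lambda>g. \<Sum>\<zeta>\<in>R. \<zeta> ^ (m - l) * \<Phi> \<zeta> g) y"
      unfolding transform_linear(3)[symmetric] by (intro transform_cong) (rule ind[OF l])
    also have "\<dots> = (\<Sum>\<zeta>\<in>R - {1}. \<zeta> ^ (m - l) * transform G W (\<Phi> \<zeta>) y) + transform G W (\<Phi> 1) y"
      unfolding transform_linear split1 by simp
    also have "\<dots> = of_nat m * (if y = \<one>\<^bsub>G\<^esub> then of_nat (e l) * (of_nat u - 1)
        else of_nat u * of_bool (lab L y mod m = l) - of_nat (e l))"
    proof (cases "y = \<one>\<^bsub>G\<^esub>")
      case True
      have "(\<Sum>\<zeta>\<in>R - {1}. \<zeta> ^ (m - l) * transform G W (\<Phi> \<zeta>) y)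
          = (\<Sum>\<zeta>\<in>R - {1}. (of_nat u - 1) * (\<zeta> ^ (m - l) + \<zeta> ^ (m - l) * \<zeta> ^ s))"
        by (intro sum.cong refl, subst hat\<Phi>[OF _ y]) (simp_all add: True algebra_simps)
      also have "\<dots> = (of_nat u - 1) * ((of_nat m * of_bool (l = 0) - 1) + (of_nat m * of_bool (l = s) - 1))"
        unfolding sum_distrib_left[symmetric] sum.distrib rs0[OF l] rss[OF l] ..
      finally have "(\<Sum>\<zeta>\<in>R - {1}. \<zeta> ^ (m - l) * transform G W (\<Phi> \<zeta>) y) + transform G W (\<Phi> 1) y
          = (of_nat u - 1 + of_nat m * of_bool (l = 0) + of_nat m * of_bool (l = s)) * (of_nat u - 1)"
        unfolding hat1[OF y] using True by (simp add: ring_distribs power2_eq_square)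
      then show ?thesis unfolding me[symmetric] using True by simp
    next
      case False
      have "(\<Sum>\<zeta>\<in>R - {1}. \<zeta> ^ (m - l) * transform G W (\<Phi> \<zeta>) y)
          = (\<Sum>\<zeta>\<in>R - {1}. of_nat u * (\<zeta> ^ (m - l) * \<zeta> ^ lab L y) - (\<zeta> ^ (m - l) + \<zeta> ^ (m - l) * \<zeta> ^ s))"
        by (intro sum.cong refl, subst hat\<Phi>[OF _ y]) (simp_all add: False algebra_simps)
      also have "\<dots> = of_nat u * (of_nat m * of_bool (lab L y mod m = l) - 1)
          - ((of_nat m * of_bool (l = 0) - 1) + (of_nat m * of_bool (l = s) - 1))"
        unfolding sum_subtractf sum_distrib_left[symmetric] sum.distrib rs0[OF l] rss[OF l] rootsum[OF l] ..
      finally have "(\<Sum>\<zeta>\<in>R - {1}. \<zeta> ^ (m - l) * transform G W (\<Phi> \<zeta>) y) + transform G W (\<Phi> 1) y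
          = of_nat m * (of_nat u * of_bool (lab L y mod m = l))
            - (of_nat u - 1 + of_nat m * of_bool (l = 0) + of_nat m * of_bool (l = s))"
        unfolding hat1[OF y] using False by (simp add: ring_distribs)
      then show ?thesis unfolding me[symmetric] using False by (simp add: ring_distribs)
    qed
    finally show ?thesis using m(1) by simp
  qed
  define D where "D = {g \<in> carrier G. g \<noteq> \<one>\<^bsub>G\<^esub> \<and> lab K g mod m \<in> I}"
  have finI: "finite I" using I finite_subset by blast
  have c': "of_int c = (\<Sum>l\<in>I. of_nat (e l) :: complex)"
  proof -
    have "int (\<Sum>l\<in>I. e l) = int (card I) * (int ((u - 1) div m)) + of_bool (0 \<in> I) + of_bool (s \<in> I)"
      using finI by (simp add: e_def sum.distrib of_bool_def)
    also have "int ((u - 1) div m) = (int u - 1) div int m" using u by (simp add: zdiv_int of_nat_diff)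
    finally have "c = int (\<Sum>l\<in>I. e l)" using c by simp
    then show ?thesis by simp
  qed
  have indD: "indicator D g = (\<Sum>l\<in>I. indicator (Dl l) g :: complex)" if "g \<in> carrier G" for g
    using finI that by (auto simp: D_def Dl_def indicator_def)
  have hatD': "transform G W (indicator D) y = (\<Sum>l\<in>I. transform G W (indicator (Dl l)) y)" for y
    unfolding transform_linear(4)[symmetric] by (intro transform_cong) (rule indD)
  have two: "transform G W (indicator D) y = of_int (- c) \<or> transform G W (indicator D) y = of_int (int u - c)"
    if y: "y \<in> carrier G" "y \<noteq> \<one>\<^bsub>G\<^esub>" for y
  proof -
    have "transform G W (indicator D) y = (\<Sum>l\<in>I. of_nat u * of_bool (lab L y mod m = l) - of_nat (e l))"
      unfolding hatD' using hatD y I by (intro sum.cong) auto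
    also have "\<dots> = of_nat u * of_bool (lab L y mod m \<in> I) - of_int c"
      using finI unfolding c' sum_subtractf sum_distrib_left[symmetric] by (simp add: of_bool_def)
    finally show ?thesis by (cases "lab L y mod m \<in> I") auto
  qed
  have "of_int (int (card D)) = (of_int (c * (int u - 1)) :: complex)"
  proof -
    have "of_int (int (card D)) = (\<Sum>g\<in>D. 1 :: complex)" by simp
    also have "\<dots> = transform G W (indicator D) \<one>\<^bsub>G\<^esub>"
      unfolding transform_at_one[OF W]
      by (rule sum.mono_neutral_cong_left) (use fin in \<open>auto simp: D_def indicator_def\<close>)
    also have "\<dots> = (\<Sum>l\<in>I. of_nat (e l) * (of_nat u - 1))"
      unfolding hatD' using hatD I by (intro sum.cong) auto
    finally show ?thesis by (simp add: c' sum_distrib_right)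
  qed
  then have cardD: "int (card D) = c * (int u - 1)" by (simp only: of_int_eq_iff)
  have symm: "inv\<^bsub>G\<^esub> g \<in> D" if "g \<in> D" for g
  proof -
    have "inv\<^bsub>G\<^esub> g \<noteq> \<one>\<^bsub>G\<^esub>" using that by (metis (mono_tags, lifting) D_def inv_inv inv_one mem_Collect_eq)
    then show ?thesis using that dl by (simp add: D_def lab_def dual_labellings_def)
  qed
  show ?thesis
    using strongly_regular_Cayley_graph_if_transform_two_valued[OF comm_group_axioms fin W cardG _ _ symm cardD two]
    by (auto simp: D_def)
qed

section \<open>Homomorphisms of elementary abelian groups\<close>

text \<open>An inverse of \<open>k\<close> modulo \<open>p\<close> expresses \<open>g\<close> as a power of \<open>g [^] k\<close>.\<close>

lemma (in group) mem_subgroup_if_coprime_power_mem: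
  assumes S: "subgroup S G" and g: "g \<in> carrier G" "g [^] (p::nat) = \<one>"
    and p: "Factorial_Ring.prime p" and k: "g [^] (k::nat) \<in> S" "\<not> p dvd k"
  shows "g \<in> S"
proof -
  have "coprime k p" using p k(2) by (metis coprime_commute prime_imp_coprime)
  then obtain a where "[k * a = 1] (mod p)" using cong_solve_coprime_nat by auto
  then have "k * a mod p = 1" using prime_gt_1_nat[OF p] by (simp add: cong_def)
  then obtain c where ka: "k * a = Suc (p * c)" by (metis mult_div_mod_eq add.commute plus_1_eq_Suc)
  then have "g [^] (k * a) = (g [^] p) [^] c \<otimes> g"
    using g(1) by (simp add: ka nat_pow_pow)
  then have "g = (g [^] k) [^] a" using g by (simp add: nat_pow_pow)
  moreover have "x [^] (n::nat) \<in> S" if "x \<in> S" for x n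
    using S that by (induction n) (auto simp: subgroup.one_closed subgroup.m_closed)
  ultimately show ?thesis using k(1) by metis
qed

text \<open>The subgroup generated by \<open>S\<close> and \<open>g\<close> consists of the products of an element of \<open>S\<close> with a power of
\<open>g\<close>, and this representation is unique up to changing the exponent modulo \<open>p\<close>. So the image of \<open>g\<close>
can be any element of \<open>H\<close> whose \<open>p\<close>-th power is the identity. The same argument, applied in \<open>H\<close>, shows that
the extension stays injective if the image of \<open>g\<close> is new.\<close>

lemma elementary_abelian_hom_extension:
  fixes G (structure) and H (structure)
  assumes G: "comm_group G" and H: "comm_group H" and p: "Factorial_Ring.prime p"
    and expG: "\<And>x. x \<in> carrier G \<Longrightarrow> x [^]\<^bsub>G\<^esub> (p::nat) = \<one>\<^bsub>G\<^esub>"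
    and S: "subgroup S G" and g: "g \<in> carrier G" "g \<notin> S"
    and w: "w \<in> carrier H" "w [^]\<^bsub>H\<^esub> p = \<one>\<^bsub>H\<^esub>"
    and \<phi>: "\<phi> \<in> hom (G\<lparr>carrier := S\<rparr>) H"
  obtains S' \<phi>' where "subgroup S' G" "S \<subseteq> S'" "g \<in> S'" "\<phi>' \<in> hom (G\<lparr>carrier := S'\<rparr>) H"
    "\<And>x. x \<in> S \<Longrightarrow> \<phi>' x = \<phi> x" "\<phi>' g = w"
    "inj_on \<phi> S \<Longrightarrow> w \<notin> \<phi> ` S \<Longrightarrow> inj_on \<phi>' S'"
proof -
  interpret G: comm_group G by fact
  interpret H: comm_group H by fact
  have SG: "x \<in> carrier G" if "x \<in> S" for x using S that by (rule subgroup.mem_carrier)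
  have \<phi>c: "\<phi> x \<in> carrier H" if "x \<in> S" for x using \<phi> that by (auto simp: hom_def)
  have \<phi>m: "\<phi> (x \<otimes>\<^bsub>G\<^esub> y) = \<phi> x \<otimes>\<^bsub>H\<^esub> \<phi> y" if "x \<in> S" "y \<in> S" for x y
    using \<phi> that by (auto simp: hom_def)
  have \<phi>1: "\<phi> \<one>\<^bsub>G\<^esub> = \<one>\<^bsub>H\<^esub>"
    using \<phi>m[of "\<one>\<^bsub>G\<^esub>" "\<one>\<^bsub>G\<^esub>"] \<phi>c subgroup.one_closed[OF S] by (simp add: H.l_cancel_one')
  have gpow: "g [^]\<^bsub>G\<^esub> (p * k) = \<one>\<^bsub>G\<^esub>" and wpow: "w [^]\<^bsub>H\<^esub> (p * k) = \<one>\<^bsub>H\<^esub>" for k :: nat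
    using g w expG[OF g(1)] by (simp_all add: G.nat_pow_pow[symmetric] H.nat_pow_pow[symmetric])
  have key: "p dvd k" if "g [^]\<^bsub>G\<^esub> k \<in> S" for k :: nat
    using G.mem_subgroup_if_coprime_power_mem[OF S g(1) expG[OF g(1)] p that] g(2) by auto
  \<comment> \<open>adding a multiple of \<open>p\<close> to an exponent changes nothing and allows subtraction\<close>
  have well_defined: "\<phi> s \<otimes>\<^bsub>H\<^esub> w [^]\<^bsub>H\<^esub> i = \<phi> t \<otimes>\<^bsub>H\<^esub> w [^]\<^bsub>H\<^esub> j"
    if "s \<in> S" "t \<in> S" and eq: "s \<otimes>\<^bsub>G\<^esub> g [^]\<^bsub>G\<^esub> i = t \<otimes>\<^bsub>G\<^esub> g [^]\<^bsub>G\<^esub> j" for s t and i j :: nat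
  proof -
    have "j \<le> p * j" using prime_gt_0_nat[OF p] by simp
    define d where "d = i + p * j - j"
    have d: "i + p * j = d + j" using trans_le_add2[OF \<open>j \<le> p * j\<close>, of i] unfolding d_def by (rule le_add_diff_inverse2[symmetric])
    have "g [^]\<^bsub>G\<^esub> i = g [^]\<^bsub>G\<^esub> (i + p * j)"
      using g gpow by (simp add: G.nat_pow_mult[symmetric])
    also have "\<dots> = g [^]\<^bsub>G\<^esub> d \<otimes>\<^bsub>G\<^esub> g [^]\<^bsub>G\<^esub> j" using g by (simp add: d G.nat_pow_mult)
    finally have "(s \<otimes>\<^bsub>G\<^esub> g [^]\<^bsub>G\<^esub> d) \<otimes>\<^bsub>G\<^esub> g [^]\<^bsub>G\<^esub> j = t \<otimes>\<^bsub>G\<^esub> g [^]\<^bsub>G\<^esub> j"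
      using eq that g by (simp add: G.m_assoc SG)
    then have sd: "s \<otimes>\<^bsub>G\<^esub> g [^]\<^bsub>G\<^esub> d = t" using that g by (simp add: SG)
    then have "g [^]\<^bsub>G\<^esub> d = inv\<^bsub>G\<^esub> s \<otimes>\<^bsub>G\<^esub> t" using that g SG by (metis G.inv_solve_left' G.nat_pow_closed)
    then have "g [^]\<^bsub>G\<^esub> d \<in> S" using S that by (simp add: subgroup.m_closed subgroup.m_inv_closed)
    then obtain k where k: "d = p * k" using key by (auto simp: dvd_def)
    have "s = t" using sd that(1) by (simp add: k gpow SG)
    moreover have "w [^]\<^bsub>H\<^esub> i = w [^]\<^bsub>H\<^esub> j"
    proof -
      have "w [^]\<^bsub>H\<^esub> i = w [^]\<^bsub>H\<^esub> (i + p * j)" using w wpow by (simp add: H.nat_pow_mult[symmetric])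
      also have "\<dots> = w [^]\<^bsub>H\<^esub> j" unfolding d k using w wpow by (simp add: H.nat_pow_mult[symmetric])
      finally show ?thesis .
    qed
    ultimately show ?thesis by simp
  qed
  define S' where "S' = {s \<otimes>\<^bsub>G\<^esub> g [^]\<^bsub>G\<^esub> i | s i. s \<in> S \<and> (i::nat) \<in> UNIV}"
  define \<phi>' where "\<phi>' x = (SOME v. \<exists>s\<in>S. \<exists>i::nat. x = s \<otimes>\<^bsub>G\<^esub> g [^]\<^bsub>G\<^esub> i \<and> v = \<phi> s \<otimes>\<^bsub>H\<^esub> w [^]\<^bsub>H\<^esub> i)" for x
  have \<phi>': "\<phi>' (s \<otimes>\<^bsub>G\<^esub> g [^]\<^bsub>G\<^esub> i) = \<phi> s \<otimes>\<^bsub>H\<^esub> w [^]\<^bsub>H\<^esub> i" if "s \<in> S" for s and i :: nat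
    unfolding \<phi>'_def by (rule someI2_ex) (use that in blast, metis that well_defined)
  have S'E: "\<exists>s\<in>S. \<exists>i::nat. x = s \<otimes>\<^bsub>G\<^esub> g [^]\<^bsub>G\<^esub> i" if "x \<in> S'" for x
    using that by (auto simp: S'_def)
  have prodS': "(s \<otimes>\<^bsub>G\<^esub> g [^]\<^bsub>G\<^esub> i) \<otimes>\<^bsub>G\<^esub> (t \<otimes>\<^bsub>G\<^esub> g [^]\<^bsub>G\<^esub> j) = (s \<otimes>\<^bsub>G\<^esub> t) \<otimes>\<^bsub>G\<^esub> g [^]\<^bsub>G\<^esub> (i + j)"
    if "s \<in> S" "t \<in> S" for s t and i j :: nat
    using that g by (simp add: SG G.nat_pow_mult[symmetric] G.m_ac)
  have sub: "S \<subseteq> S'"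
  proof
    fix x assume "x \<in> S"
    then have "x = x \<otimes>\<^bsub>G\<^esub> g [^]\<^bsub>G\<^esub> (0::nat)" by (simp add: SG)
    then show "x \<in> S'" using \<open>x \<in> S\<close> unfolding S'_def by blast
  qed
  have gS': "g \<in> S'"
  proof -
    have "g = \<one>\<^bsub>G\<^esub> \<otimes>\<^bsub>G\<^esub> g [^]\<^bsub>G\<^esub> (1::nat)" using g by simp
    then show ?thesis using subgroup.one_closed[OF S] unfolding S'_def by blast
  qed
  have "subgroup S' G"
  proof (rule G.subgroupI)
    show "S' \<subseteq> carrier G" using g by (auto simp: S'_def SG)
    show "S' \<noteq> {}" using gS' by auto
    fix x assume "x \<in> S'"
    then obtain s and i :: nat where x: "s \<in> S" "x = s \<otimes>\<^bsub>G\<^esub> g [^]\<^bsub>G\<^esub> i" using S'E by blast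
    have "i \<le> p * i" using prime_gt_0_nat[OF p] by simp
    have "inv\<^bsub>G\<^esub> x = inv\<^bsub>G\<^esub> s \<otimes>\<^bsub>G\<^esub> g [^]\<^bsub>G\<^esub> (p * i - i)"
    proof (rule G.inv_equality)
      have "(inv\<^bsub>G\<^esub> s \<otimes>\<^bsub>G\<^esub> g [^]\<^bsub>G\<^esub> (p * i - i)) \<otimes>\<^bsub>G\<^esub> x
          = (inv\<^bsub>G\<^esub> s \<otimes>\<^bsub>G\<^esub> s) \<otimes>\<^bsub>G\<^esub> g [^]\<^bsub>G\<^esub> (p * i - i + i)"
        unfolding x(2) by (rule prodS') (use S x in \<open>auto simp: subgroup.m_inv_closed\<close>)
      then show "(inv\<^bsub>G\<^esub> s \<otimes>\<^bsub>G\<^esub> g [^]\<^bsub>G\<^esub> (p * i - i)) \<otimes>\<^bsub>G\<^esub> x = \<one>\<^bsub>G\<^esub>"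
        using x \<open>i \<le> p * i\<close> gpow by (simp add: SG)
    qed (use x g in \<open>auto simp: SG\<close>)
    then show "inv\<^bsub>G\<^esub> x \<in> S'" using S x unfolding S'_def by (auto simp: subgroup.m_inv_closed)
    fix y assume "y \<in> S'"
    then obtain t and j :: nat where y: "t \<in> S" "y = t \<otimes>\<^bsub>G\<^esub> g [^]\<^bsub>G\<^esub> j" using S'E by blast
    show "x \<otimes>\<^bsub>G\<^esub> y \<in> S'"
      unfolding x(2) y(2) prodS'[OF x(1) y(1)] S'_def using subgroup.m_closed[OF S x(1) y(1)] by blast
  qed
  moreover have hom': "\<phi>' \<in> hom (G\<lparr>carrier := S'\<rparr>) H"
  proof (rule homI)
    fix x assume "x \<in> carrier (G\<lparr>carrier := S'\<rparr>)"
    then have "x \<in> S'" by simp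
    then obtain s and i :: nat where x: "s \<in> S" "x = s \<otimes>\<^bsub>G\<^esub> g [^]\<^bsub>G\<^esub> i" using S'E by blast
    then show "\<phi>' x \<in> carrier H" using \<phi>' w by (simp add: \<phi>c)
    fix y assume "y \<in> carrier (G\<lparr>carrier := S'\<rparr>)"
    then have "y \<in> S'" by simp
    then obtain t and j :: nat where y: "t \<in> S" "y = t \<otimes>\<^bsub>G\<^esub> g [^]\<^bsub>G\<^esub> j" using S'E by blast
    show "\<phi>' (x \<otimes>\<^bsub>G\<lparr>carrier := S'\<rparr>\<^esub> y) = \<phi>' x \<otimes>\<^bsub>H\<^esub> \<phi>' y"
      using x(1) y(1) subgroup.m_closed[OF S x(1) y(1)] w
      by (simp add: x(2) y(2) prodS' \<phi>' \<phi>m \<phi>c H.nat_pow_mult[symmetric] H.m_ac)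
  qed
  moreover have ext: "\<phi>' x = \<phi> x" if "x \<in> S" for x
    using \<phi>'[OF that, of 0] that by (simp add: SG \<phi>c)
  moreover have "\<phi>' g = w"
    using \<phi>'[OF subgroup.one_closed[OF S], of 1] g w by (simp add: \<phi>1)
  moreover have "inj_on \<phi>' S'" if inj: "inj_on \<phi> S" and w': "w \<notin> \<phi> ` S"
  proof -
    have img: "subgroup (\<phi> ` S) H"
    proof -
      interpret \<phi>: group_hom "G\<lparr>carrier := S\<rparr>" H \<phi>
        using \<phi> S by (intro group_hom.intro group_hom_axioms.intro) (auto intro: G.subgroup_imp_group)
      show ?thesis using \<phi>.img_is_subgroup by simp
    qed
    show ?thesis
    proof (rule inj_onI)
      fix x y assume "x \<in> S'" "y \<in> S'" and eq: "\<phi>' x = \<phi>' y"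
      then obtain s t and i j :: nat where x: "s \<in> S" "x = s \<otimes>\<^bsub>G\<^esub> g [^]\<^bsub>G\<^esub> i"
        and y: "t \<in> S" "y = t \<otimes>\<^bsub>G\<^esub> g [^]\<^bsub>G\<^esub> j" using S'E by metis
      have "j \<le> p * j" using prime_gt_0_nat[OF p] by simp
      define d where "d = i + p * j - j"
      have d: "i + p * j = d + j" using trans_le_add2[OF \<open>j \<le> p * j\<close>, of i] unfolding d_def by (rule le_add_diff_inverse2[symmetric])
      have "w [^]\<^bsub>H\<^esub> i = w [^]\<^bsub>H\<^esub> (i + p * j)" using w wpow by (simp add: H.nat_pow_mult[symmetric])
      also have "\<dots> = w [^]\<^bsub>H\<^esub> d \<otimes>\<^bsub>H\<^esub> w [^]\<^bsub>H\<^esub> j" using w by (simp add: d H.nat_pow_mult)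
      finally have "(\<phi> s \<otimes>\<^bsub>H\<^esub> w [^]\<^bsub>H\<^esub> d) \<otimes>\<^bsub>H\<^esub> w [^]\<^bsub>H\<^esub> j = \<phi> t \<otimes>\<^bsub>H\<^esub> w [^]\<^bsub>H\<^esub> j"
        using eq x y w by (simp add: \<phi>' H.m_assoc \<phi>c)
      then have sd: "\<phi> s \<otimes>\<^bsub>H\<^esub> w [^]\<^bsub>H\<^esub> d = \<phi> t" using x y w by (simp add: \<phi>c)
      then have "w [^]\<^bsub>H\<^esub> d = inv\<^bsub>H\<^esub> (\<phi> s) \<otimes>\<^bsub>H\<^esub> \<phi> t"
        using x y w \<phi>c by (metis H.inv_solve_left' H.nat_pow_closed)
      then have "w [^]\<^bsub>H\<^esub> d \<in> \<phi> ` S" using img x y by (simp add: subgroup.m_closed subgroup.m_inv_closed)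
      then have "p dvd d" using H.mem_subgroup_if_coprime_power_mem[OF img w p] w' by auto
      then obtain k where k: "d = p * k" by (auto simp: dvd_def)
      have "\<phi> s = \<phi> t" using sd x by (simp add: k wpow \<phi>c)
      then have "s = t" using inj x y by (auto dest: inj_onD)
      moreover have "g [^]\<^bsub>G\<^esub> i = g [^]\<^bsub>G\<^esub> j"
      proof -
        have "g [^]\<^bsub>G\<^esub> i = g [^]\<^bsub>G\<^esub> (i + p * j)" using g gpow by (simp add: G.nat_pow_mult[symmetric])
        also have "\<dots> = g [^]\<^bsub>G\<^esub> j" unfolding d k using g gpow by (simp add: G.nat_pow_mult[symmetric])
        finally show ?thesis .
      qed
      ultimately show "x = y" using x y by simp
    qed
  qed
  ultimately show thesis using that sub gS' by blast
qed

text \<open>A subgroup of maximal size with an injective homomorphism to \<open>H\<close> must be all of \<open>G\<close>; otherwise its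
image is not all of \<open>H\<close> and the homomorphism extends.\<close>

lemma elementary_abelian_groups_isomorphic:
  fixes G (structure) and H (structure)
  assumes G: "comm_group G" and H: "comm_group H" and p: "Factorial_Ring.prime p"
    and expG: "\<And>x. x \<in> carrier G \<Longrightarrow> x [^]\<^bsub>G\<^esub> (p::nat) = \<one>\<^bsub>G\<^esub>"
    and expH: "\<And>x. x \<in> carrier H \<Longrightarrow> x [^]\<^bsub>H\<^esub> (p::nat) = \<one>\<^bsub>H\<^esub>"
    and fin: "finite (carrier G)" "finite (carrier H)" and card: "card (carrier G) = card (carrier H)"
  obtains \<phi> where "\<phi> \<in> iso G H"
proof -
  interpret G: comm_group G by fact
  interpret H: comm_group H by fact
  let ?P = "\<lambda>S. subgroup S G \<and> (\<exists>\<phi>. \<phi> \<in> hom (G\<lparr>carrier := S\<rparr>) H \<and> inj_on \<phi> S)"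
  have "?P {\<one>\<^bsub>G\<^esub>}"
    by (auto simp: G.triv_subgroup hom_def intro!: exI[of _ "\<lambda>_. \<one>\<^bsub>H\<^esub>"])
  moreover have "card S < Suc (card (carrier G))" if "?P S" for S
    using that fin(1) by (simp add: less_Suc_eq_le card_mono subgroup.subset)
  ultimately have "\<exists>S. ?P S \<and> (\<forall>S'. ?P S' \<longrightarrow> card S' \<le> card S)"
    by (intro ex_has_greatest_nat[of ?P "{\<one>\<^bsub>G\<^esub>}" card "Suc (card (carrier G))"]) blast+
  then obtain S where S: "?P S" and max: "\<And>S'. ?P S' \<Longrightarrow> card S' \<le> card S"
    by blast
  then obtain \<phi> where sub: "subgroup S G" and \<phi>: "\<phi> \<in> hom (G\<lparr>carrier := S\<rparr>) H" "inj_on \<phi> S" by auto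
  have SG: "S \<subseteq> carrier G" using sub by (rule subgroup.subset)
  have img: "\<phi> ` S \<subseteq> carrier H" using \<phi>(1) by (auto simp: hom_def)
  have cardS: "card (\<phi> ` S) = card S" using \<phi>(2) by (rule card_image)
  have "S = carrier G"
  proof (rule ccontr)
    assume "S \<noteq> carrier G"
    then obtain g where g: "g \<in> carrier G" "g \<notin> S" using SG by auto
    have "card S < card (carrier G)" using SG g fin(1) by (intro psubset_card_mono) auto
    then have "\<phi> ` S \<noteq> carrier H" using cardS card by auto
    then obtain w where w: "w \<in> carrier H" "w \<notin> \<phi> ` S" using img by auto
    obtain S' \<phi>' where S': "subgroup S' G" "S \<subseteq> S'" "g \<in> S'" "\<phi>' \<in> hom (G\<lparr>carrier := S'\<rparr>) H" "inj_on \<phi>' S'"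
      using elementary_abelian_hom_extension[OF G H p expG sub g w(1) expH[OF w(1)] \<phi>(1)] \<phi>(2) w(2) by metis
    then have "card S' \<le> card S" using max by blast
    moreover have "card S < card S'"
      using S' g fin(1) by (intro psubset_card_mono) (auto intro: finite_subset[OF subgroup.subset])
    ultimately show False by simp
  qed
  moreover have "\<phi> ` S = carrier H"
    using img fin(2) cardS card \<open>S = carrier G\<close> by (simp add: card_subset_eq)
  ultimately have "\<phi> \<in> iso G H"
    using \<phi> by (auto simp: iso_def bij_betw_def)
  then show thesis by (rule that)
qed

definition complex_units :: "complex monoid" where
  "complex_units = \<lparr>carrier = - {0}, monoid.mult = (*), one = 1\<rparr>"

lemma comm_group_complex_units: "comm_group complex_units"
  by (rule comm_groupI) (auto simp: complex_units_def intro!: bexI[of _ "inverse _"])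

lemma complex_units_pow: "z [^]\<^bsub>complex_units\<^esub> (n::nat) = z ^ n"
  by (induction n) (simp_all add: complex_units_def nat_pow_def mult.commute)

text \<open>Extend the trivial character of \<open>S\<close> by sending \<open>g\<close> to a primitive \<open>p\<close>-th root of unity, and then
extend as far as possible.\<close>

lemma elementary_abelian_separating_character:
  fixes G (structure)
  assumes G: "comm_group G" and p: "Factorial_Ring.prime p"
    and expG: "\<And>x. x \<in> carrier G \<Longrightarrow> x [^]\<^bsub>G\<^esub> (p::nat) = \<one>\<^bsub>G\<^esub>"
    and fin: "finite (carrier G)" and S: "subgroup S G" and g: "g \<in> carrier G" "g \<notin> S"
  obtains \<psi> :: "_ \<Rightarrow> complex" where "\<And>x y. x \<in> carrier G \<Longrightarrow> y \<in> carrier G \<Longrightarrow> \<psi> (x \<otimes> y) = \<psi> x * \<psi> y"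
    "\<And>x. x \<in> S \<Longrightarrow> \<psi> x = 1" "\<psi> g \<noteq> 1"
proof -
  interpret G: comm_group G by fact
  let ?U = complex_units
  interpret U: comm_group ?U by (rule comm_group_complex_units)
  define \<omega> where "\<omega> = cis (2 * pi / p)"
  have p1: "p > 1" using p by (rule prime_gt_1_nat)
  have \<omega>: "\<omega> \<in> carrier ?U" "\<omega> [^]\<^bsub>?U\<^esub> p = \<one>\<^bsub>?U\<^esub>"
    using p1 by (simp_all add: complex_units_pow \<omega>_def DeMoivre) (simp_all add: complex_units_def)
  have "\<omega> \<noteq> 1"
  proof
    assume "\<omega> = 1"
    moreover have "inj_on (\<lambda>j. cis (2 * pi * real j / real p)) {..<p}"
      using p1 by (intro bij_betw_imp_inj_on[OF bij_betw_roots_unity]) simp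
    ultimately show False using p1 inj_onD[of _ _ 1 0] by (force simp: \<omega>_def)
  qed
  let ?P = "\<lambda>T. subgroup T G \<and> S \<subseteq> T \<and> g \<in> T \<and>
     (\<exists>\<phi>. \<phi> \<in> hom (G\<lparr>carrier := T\<rparr>) ?U \<and> (\<forall>x\<in>S. \<phi> x = 1) \<and> \<phi> g \<noteq> 1)"
  have hom1: "(\<lambda>_. 1) \<in> hom (G\<lparr>carrier := S\<rparr>) ?U" by (auto simp: hom_def complex_units_def)
  obtain T0 where "?P T0"
    using elementary_abelian_hom_extension[OF G comm_group_complex_units p expG S g \<omega> hom1] \<open>\<omega> \<noteq> 1\<close> by metis
  moreover have "card T < Suc (card (carrier G))" if "?P T" for T
    using that fin by (simp add: less_Suc_eq_le card_mono subgroup.subset)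
  ultimately have "\<exists>T. ?P T \<and> (\<forall>T'. ?P T' \<longrightarrow> card T' \<le> card T)"
    by (intro ex_has_greatest_nat[of ?P T0 card "Suc (card (carrier G))"]) blast+
  then obtain T where T: "?P T" and max: "\<And>T'. ?P T' \<Longrightarrow> card T' \<le> card T"
    by blast
  then obtain \<psi> where sub: "subgroup T G" "S \<subseteq> T" "g \<in> T" and \<psi>: "\<psi> \<in> hom (G\<lparr>carrier := T\<rparr>) ?U"
    "\<forall>x\<in>S. \<psi> x = 1" "\<psi> g \<noteq> 1" by auto
  have TG: "T \<subseteq> carrier G" using sub(1) by (rule subgroup.subset)
  have "T = carrier G"
  proof (rule ccontr)
    assume "T \<noteq> carrier G"
    then obtain h where h: "h \<in> carrier G" "h \<notin> T" using TG by auto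
    obtain T' \<phi>' where T': "subgroup T' G" "T \<subseteq> T'" "h \<in> T'" "\<phi>' \<in> hom (G\<lparr>carrier := T'\<rparr>) ?U"
      "\<And>x. x \<in> T \<Longrightarrow> \<phi>' x = \<psi> x"
      using elementary_abelian_hom_extension[OF G comm_group_complex_units p expG sub(1) h U.one_closed U.nat_pow_one \<psi>(1)]
      by metis
    then have "?P T'" using sub \<psi> by (metis subset_iff)
    then have "card T' \<le> card T" by (rule max)
    moreover have "card T < card T'"
      using T' h fin by (intro psubset_card_mono) (auto intro: finite_subset[OF subgroup.subset])
    ultimately show False by simp
  qed
  then have "\<psi> (x \<otimes> y) = \<psi> x * \<psi> y" if "x \<in> carrier G" "y \<in> carrier G" for x y
    using \<psi>(1) that by (auto simp: hom_def complex_units_def)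
  then show thesis using that[of \<psi>] \<psi> by blast
qed

section \<open>Frobenius maps and the existence of finite fields\<close>

lemma (in cring) add_pow_nat_add: "x \<in> carrier R \<Longrightarrow> [(m + n :: nat)] \<cdot> x = [m] \<cdot> x \<oplus> [n] \<cdot> x"
  by (simp add: add.nat_pow_mult)

lemma (in cring) binomial_theorem:
  assumes x: "x \<in> carrier R" and y: "y \<in> carrier R"
  shows "(x \<oplus> y) [^] (n::nat) = (\<Oplus>k\<in>{..n}. [(n choose k)] \<cdot> (x [^] k \<otimes> y [^] (n - k)))"
proof (induction n)
  case 0
  then show ?case using x y by simp
next
  case (Suc n)
  let ?t = "\<lambda>k. x [^] k \<otimes> y [^] (Suc n - k)"
  have t: "?t k \<in> carrier R" for k using x y by simp
  have 1: "(\<Oplus>k\<in>{..n}. [(n choose k)] \<cdot> (x [^] k \<otimes> y [^] (n - k))) \<otimes> x = (\<Oplus>k\<in>{..n}. [(n choose k)] \<cdot> ?t (Suc k))"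
    using x y by (subst finsum_ldistr) (auto intro!: finsum_cong' simp: add_pow_ldistr add_pow_rdistr m_ac)
  have 2: "(\<Oplus>k\<in>{..n}. [(n choose k)] \<cdot> (x [^] k \<otimes> y [^] (n - k))) \<otimes> y = (\<Oplus>k\<in>{..n}. [(n choose k)] \<cdot> ?t k)"
    using x y by (subst finsum_ldistr) (auto intro!: finsum_cong' simp: add_pow_ldistr m_assoc Suc_diff_le)
  have 3: "(\<Oplus>k\<in>{..n}. [(n choose Suc k)] \<cdot> ?t (Suc k)) \<oplus> ?t 0 = (\<Oplus>k\<in>{..n}. [(n choose k)] \<cdot> ?t k)"
  proof -
    have "(\<Oplus>k\<in>{..Suc n}. [(n choose k)] \<cdot> ?t k) = (\<Oplus>k\<in>{..n}. [(n choose Suc k)] \<cdot> ?t (Suc k)) \<oplus> [(n choose 0)] \<cdot> ?t 0"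
      by (rule finsum_Suc2) (use t in auto)
    moreover have "(\<Oplus>k\<in>{..Suc n}. [(n choose k)] \<cdot> ?t k) = [(n choose Suc n)] \<cdot> ?t (Suc n) \<oplus> (\<Oplus>k\<in>{..n}. [(n choose k)] \<cdot> ?t k)"
      by (rule finsum_Suc) (use t in auto)
    ultimately show ?thesis using t x y by (simp add: binomial_eq_0)
  qed
  have "(\<Oplus>k\<in>{..Suc n}. [(Suc n choose k)] \<cdot> ?t k)
      = (\<Oplus>k\<in>{..n}. [(Suc n choose Suc k)] \<cdot> ?t (Suc k)) \<oplus> [(Suc n choose 0)] \<cdot> ?t 0"
    by (rule finsum_Suc2) (use t in auto)
  also have "(\<Oplus>k\<in>{..n}. [(Suc n choose Suc k)] \<cdot> ?t (Suc k))
      = (\<Oplus>k\<in>{..n}. [(n choose k)] \<cdot> ?t (Suc k) \<oplus> [(n choose Suc k)] \<cdot> ?t (Suc k))"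
    by (rule finsum_cong') (use x y in \<open>auto simp: add_pow_nat_add\<close>)
  also have "\<dots> = (\<Oplus>k\<in>{..n}. [(n choose k)] \<cdot> ?t (Suc k)) \<oplus> (\<Oplus>k\<in>{..n}. [(n choose Suc k)] \<cdot> ?t (Suc k))"
    by (rule finsum_addf) (use x y in auto)
  finally have rhs: "(\<Oplus>k\<in>{..Suc n}. [(Suc n choose k)] \<cdot> ?t k)
      = (\<Oplus>k\<in>{..n}. [(n choose k)] \<cdot> ?t (Suc k)) \<oplus> (\<Oplus>k\<in>{..n}. [(n choose k)] \<cdot> ?t k)"
    using 3 t x y by (simp add: a_assoc finsum_closed)
  have "(x \<oplus> y) [^] Suc n = (\<Oplus>k\<in>{..n}. [(n choose k)] \<cdot> (x [^] k \<otimes> y [^] (n - k))) \<otimes> (x \<oplus> y)"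
    using Suc by simp
  also have "\<dots> = (\<Oplus>k\<in>{..Suc n}. [(Suc n choose k)] \<cdot> ?t k)"
    unfolding rhs using x y by (subst r_distr) (auto simp: 1 2)
  finally show ?case .
qed

lemma (in cring) char_add_pow:
  assumes "[(p::nat)] \<cdot> \<one> = \<zero>" and "x \<in> carrier R"
  shows "[(p * k)] \<cdot> x = \<zero>"
proof -
  have "[p] \<cdot> x = ([p] \<cdot> \<one>) \<otimes> x" using assms(2) by (simp add: add_pow_ldistr)
  then have "[p] \<cdot> x = \<zero>" using assms by simp
  then show ?thesis using assms(2) by (metis add.nat_pow_pow add.nat_pow_one)
qed

text \<open>All inner binomial coefficients of a prime \<open>p\<close> are divisible by \<open>p\<close>.\<close>

lemma (in cring) frobenius_additive:
  assumes p: "Factorial_Ring.prime p" and char: "[(p::nat)] \<cdot> \<one> = \<zero>"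
    and x: "x \<in> carrier R" and y: "y \<in> carrier R"
  shows "(x \<oplus> y) [^] p ^ n = x [^] p ^ n \<oplus> y [^] p ^ n"
proof -
  have one: "(x \<oplus> y) [^] p = x [^] p \<oplus> y [^] p" if x: "x \<in> carrier R" and y: "y \<in> carrier R" for x y
  proof -
    obtain r where r: "p = Suc (Suc r)" using prime_ge_2_nat[OF p] by (metis add_2_eq_Suc le_Suc_ex)
    let ?f = "\<lambda>k. [(p choose k)] \<cdot> (x [^] k \<otimes> y [^] (p - k))"
    have f: "?f k \<in> carrier R" for k using x y by simp
    have zero: "?f (Suc k) = \<zero>" if "k \<le> r" for k
    proof -
      have "p dvd p choose Suc k" using p that r by (intro dvd_choose_prime) auto
      then obtain c where "p choose Suc k = p * c" by (auto simp: dvd_def)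
      then show ?thesis using x y by (simp add: char_add_pow[OF char])
    qed
    have "(x \<oplus> y) [^] p = (\<Oplus>k\<in>{..Suc (Suc r)}. ?f k)"
      unfolding binomial_theorem[OF x y] r ..
    also have "\<dots> = ?f (Suc (Suc r)) \<oplus> (\<Oplus>k\<in>{..Suc r}. ?f k)"
      by (rule finsum_Suc) (use f in auto)
    also have "(\<Oplus>k\<in>{..Suc r}. ?f k) = (\<Oplus>k\<in>{..r}. ?f (Suc k)) \<oplus> ?f 0"
      by (rule finsum_Suc2) (use f in auto)
    also have "(\<Oplus>k\<in>{..r}. ?f (Suc k)) = (\<Oplus>k\<in>{..r}. \<zero>)"
      by (rule finsum_cong') (use zero in auto)
    finally show ?thesis using x y by (simp add: r)
  qed
  show ?thesis
  proof (induction n)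
    case (Suc n)
    have "(x \<oplus> y) [^] p ^ Suc n = ((x \<oplus> y) [^] p ^ n) [^] p"
      using x y by (simp add: nat_pow_pow mult.commute)
    also have "\<dots> = x [^] p ^ Suc n \<oplus> y [^] p ^ Suc n"
      using x y unfolding Suc by (simp add: one nat_pow_pow mult.commute)
    finally show ?case .
  qed (use x y in simp)
qed

text \<open>The fixed points are the roots of \<open>X^Q - X\<close> with \<open>Q = p^n\<close>, which splits over \<open>L\<close>. All roots are
simple: by additivity of the Frobenius map in the polynomial ring, \<open>X^Q - X = A^Q - A\<close> for
\<open>A = X - a\<close> and a root \<open>a\<close>; if \<open>A\<^sup>2\<close> divided this, then \<open>A\<close> would divide \<open>A^(Q - 1) - 1\<close>.\<close>

lemma (in algebraic_closure) card_frobenius_fixed_points: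
  assumes p: "Factorial_Ring.prime p" and char: "[(p::nat)] \<cdot>\<^bsub>L\<^esub> \<one>\<^bsub>L\<^esub> = \<zero>\<^bsub>L\<^esub>" and n: "n > 0"
  shows "finite {x \<in> carrier L. x [^]\<^bsub>L\<^esub> p ^ n = x}" "card {x \<in> carrier L. x [^]\<^bsub>L\<^esub> p ^ n = x} = p ^ n"
proof -
  let ?R = "poly_ring L" and ?Q = "p ^ n"
  interpret UP: domain ?R by (rule univ_poly_is_domain[OF carrier_is_subring])
  have Q: "?Q > 1" using prime_gt_1_nat[OF p] n by (rule one_less_power)
  have X: "X \<in> carrier ?R" by (rule var_closed(1)[OF carrier_is_subring])
  have XQ: "X [^]\<^bsub>?R\<^esub> ?Q \<in> carrier ?R" using X by simp
  define P where "P = X [^]\<^bsub>?R\<^esub> ?Q \<ominus>\<^bsub>?R\<^esub> X"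
  have P: "P \<in> carrier ?R" using X by (simp add: P_def)
  have degX: "degree X = 1" by (simp add: var_def)
  have degXQ: "degree (X [^]\<^bsub>?R\<^esub> ?Q) = ?Q"
    using polynomial_pow_degree[OF X, of ?Q] degX by simp
  have degP: "degree P = ?Q"
  proof -
    have deg: "degree (\<ominus>\<^bsub>?R\<^esub> X) = 1"
      using univ_poly_a_inv_degree[OF carrier_is_subring X] degX by simp
    have "degree P = max (degree (X [^]\<^bsub>?R\<^esub> ?Q)) (degree (\<ominus>\<^bsub>?R\<^esub> X))"
      unfolding P_def a_minus_def univ_poly_add
    proof (rule poly_add_degree_eq[OF carrier_is_subring])
      show "polynomial (carrier L) (X [^]\<^bsub>?R\<^esub> ?Q)"
        by (rule iffD2[OF univ_poly_carrier]) (rule XQ)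
      show "polynomial (carrier L) (\<ominus>\<^bsub>?R\<^esub> X)"
        by (rule iffD2[OF univ_poly_carrier]) (rule UP.a_inv_closed[OF X])
      show "degree (X [^]\<^bsub>?R\<^esub> ?Q) \<noteq> degree (\<ominus>\<^bsub>?R\<^esub> X)"
        unfolding degXQ deg using less_imp_neq[OF Q] by (rule not_sym)
    qed
    then show ?thesis unfolding degXQ deg using max_absorb1[OF less_imp_le[OF Q]] by (rule trans)
  qed
  have evP: "eval P a = a [^]\<^bsub>L\<^esub> ?Q \<ominus>\<^bsub>L\<^esub> a" if a: "a \<in> carrier L" for a
  proof -
    interpret ev: ring_hom_ring ?R L "\<lambda>f. eval f a"
      by (rule eval_ring_hom[OF carrier_is_subring a])
    have "eval (X [^]\<^bsub>?R\<^esub> k) a = a [^]\<^bsub>L\<^esub> k" for k :: nat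
      by (induction k) (use X a in \<open>simp_all add: eval_var del: eval.simps\<close>)
    then show ?thesis using X a by (simp add: P_def a_minus_def eval_var del: eval.simps)
  qed
  have P0: "P \<noteq> []"
  proof
    assume "P = []"
    then have "degree P = 0" by simp
    then show False using degP Q by linarith
  qed
  have root: "is_root P a \<longleftrightarrow> a \<in> carrier L \<and> a [^]\<^bsub>L\<^esub> ?Q = a" for a
    using P0 evP by (auto simp: is_root_def)
  have mult: "count (roots P) a \<le> 1" for a
  proof (rule ccontr)
    assume "\<not> count (roots P) a \<le> 1"
    then have two: "alg_mult P a \<ge> 2" using alg_mult_eq_count_roots[OF P] by simp
    then have "alg_mult P a > 0" by linarith
    then have "is_root P a" by (rule iffD1[OF alg_mult_gt_zero_iff_is_root[OF P]])
    then have a: "a \<in> carrier L" "a [^]\<^bsub>L\<^esub> ?Q = a" using root by auto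
    let ?A = "[\<one>\<^bsub>L\<^esub>, \<ominus>\<^bsub>L\<^esub> a]"
    have A: "?A \<in> carrier ?R" using a by (simp add: univ_poly_carrier[symmetric] polynomial_def)
    \<comment> \<open>write \<open>X\<close> as \<open>A\<close> plus a constant to apply the Frobenius map of the polynomial ring\<close>
    interpret c: ring_hom_ring L ?R poly_of_const
      using canonical_embedding_ring_hom[OF carrier_is_subring] by simp
    have c: "poly_of_const a \<in> carrier ?R" using a by simp
    have X_eq: "X = ?A \<oplus>\<^bsub>?R\<^esub> poly_of_const a"
      using a by (auto simp: univ_poly_add poly_of_const_def var_def l_neg)
    have "[p] \<cdot>\<^bsub>?R\<^esub> \<one>\<^bsub>?R\<^esub> = poly_of_const ([p] \<cdot>\<^bsub>L\<^esub> \<one>\<^bsub>L\<^esub>)"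
      by (induction p) simp_all
    then have charR: "[p] \<cdot>\<^bsub>?R\<^esub> \<one>\<^bsub>?R\<^esub> = \<zero>\<^bsub>?R\<^esub>" using char by simp
    have "X [^]\<^bsub>?R\<^esub> ?Q = ?A [^]\<^bsub>?R\<^esub> ?Q \<oplus>\<^bsub>?R\<^esub> poly_of_const a [^]\<^bsub>?R\<^esub> ?Q"
      unfolding X_eq by (rule UP.frobenius_additive[OF p charR A c])
    also have "poly_of_const a [^]\<^bsub>?R\<^esub> ?Q = poly_of_const a"
    proof -
      have "poly_of_const a [^]\<^bsub>?R\<^esub> k = poly_of_const (a [^]\<^bsub>L\<^esub> k)" for k :: nat
        by (induction k) (use a in simp_all)
      then show ?thesis using a by simp
    qed
    finally have P_eq: "P = ?A [^]\<^bsub>?R\<^esub> ?Q \<ominus>\<^bsub>?R\<^esub> ?A"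
      unfolding P_def X_eq using A c UP.nat_pow_closed[OF A, of ?Q] by (simp only:) algebra
    obtain r where r: "?Q = Suc (Suc r)" using Q by (metis Suc_lessE One_nat_def less_iff_Suc_add)
    have "[\<one>\<^bsub>L\<^esub>, \<ominus>\<^bsub>L\<^esub> a] [^]\<^bsub>?R\<^esub> (2::nat) pdivides P"
      using le_alg_mult_imp_pdivides[OF a(1) P two] .
    then obtain h where h: "h \<in> carrier ?R" "P = ?A [^]\<^bsub>?R\<^esub> (2::nat) \<otimes>\<^bsub>?R\<^esub> h"
      by (auto simp: pdivides_def factor_def)
    have Ar: "?A [^]\<^bsub>?R\<^esub> r \<in> carrier ?R" using A by simp
    have cancel: "?A \<otimes>\<^bsub>?R\<^esub> (?A \<otimes>\<^bsub>?R\<^esub> h) = ?A \<otimes>\<^bsub>?R\<^esub> (?A \<otimes>\<^bsub>?R\<^esub> ?A [^]\<^bsub>?R\<^esub> r \<ominus>\<^bsub>?R\<^esub> \<one>\<^bsub>?R\<^esub>)"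
    proof -
      have "?A \<otimes>\<^bsub>?R\<^esub> (?A \<otimes>\<^bsub>?R\<^esub> h) = P" using h A by (simp add: numeral_2_eq_2 UP.m_assoc)
      also have "\<dots> = ?A [^]\<^bsub>?R\<^esub> r \<otimes>\<^bsub>?R\<^esub> ?A \<otimes>\<^bsub>?R\<^esub> ?A \<ominus>\<^bsub>?R\<^esub> ?A" unfolding P_eq r by simp
      also have "\<dots> = ?A \<otimes>\<^bsub>?R\<^esub> (?A \<otimes>\<^bsub>?R\<^esub> ?A [^]\<^bsub>?R\<^esub> r \<ominus>\<^bsub>?R\<^esub> \<one>\<^bsub>?R\<^esub>)"
        using A Ar by algebra
      finally show ?thesis .
    qed
    have A0: "?A \<noteq> \<zero>\<^bsub>?R\<^esub>" by (simp add: univ_poly_zero)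
    have eq: "?A \<otimes>\<^bsub>?R\<^esub> h = ?A \<otimes>\<^bsub>?R\<^esub> ?A [^]\<^bsub>?R\<^esub> r \<ominus>\<^bsub>?R\<^esub> \<one>\<^bsub>?R\<^esub>"
      using cancel by (subst (asm) UP.m_lcancel[OF A0 A]) (use A Ar h(1) in simp_all)
    interpret ev: ring_hom_ring ?R L "\<lambda>f. eval f a"
      by (rule eval_ring_hom[OF carrier_is_subring a(1)])
    have "eval ?A a = \<zero>\<^bsub>L\<^esub>" using a by (simp add: r_neg)
    then have "\<zero>\<^bsub>L\<^esub> = \<ominus>\<^bsub>L\<^esub> \<one>\<^bsub>L\<^esub>"
      using arg_cong[OF eq, of "\<lambda>f. eval f a"] A h(1) Ar by (simp add: a_minus_def del: eval.simps)
    then have "\<ominus>\<^bsub>L\<^esub> \<zero>\<^bsub>L\<^esub> = \<ominus>\<^bsub>L\<^esub> (\<ominus>\<^bsub>L\<^esub> \<one>\<^bsub>L\<^esub>)" by (rule arg_cong)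
    then show False by simp
  qed
  have "{x \<in> carrier L. x [^]\<^bsub>L\<^esub> ?Q = x} = set_mset (roots P)"
    using roots_mem_iff_is_root[OF P] root by auto
  moreover have "card (set_mset (roots P)) = size (roots P)"
  proof -
    have "size (roots P) = (\<Sum>a\<in>set_mset (roots P). count (roots P) a)"
      by (rule size_multiset_overloaded_eq)
    also have "\<dots> = (\<Sum>a\<in>set_mset (roots P). 1)"
    proof (rule sum.cong)
      fix a assume "a \<in># roots P"
      then show "count (roots P) a = 1" using mult[of a] by (simp add: le_less_trans antisym Suc_leI)
    qed simp
    finally show ?thesis by simp
  qed
  moreover have "size (roots P) = ?Q"
    using roots_over_carrier[OF P] degP by (simp add: splitted_def)
  ultimately show "finite {x \<in> carrier L. x [^]\<^bsub>L\<^esub> ?Q = x}" "card {x \<in> carrier L. x [^]\<^bsub>L\<^esub> ?Q = x} = ?Q"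
    by simp_all
qed


text \<open>The field is the fixed field of a power of the Frobenius map in an algebraic closure of the prime field.\<close>

theorem exists_finite_field:
  assumes p: "Factorial_Ring.prime (p::nat)" and n: "n > 0"
  obtains R :: "((int list \<times> nat) multiset \<Rightarrow> int) ring"
  where "field R" "finite (carrier R)" "card (carrier R) = p ^ n" "[p] \<cdot>\<^bsub>R\<^esub> \<one>\<^bsub>R\<^esub> = \<zero>\<^bsub>R\<^esub>"
proof -
  let ?F = "residue_ring (int p)"
  have rp: "residues_prime p" using p by unfold_locales
  interpret F: residues_prime p ?F by (rule rp) simp
  have charF: "[p] \<cdot>\<^bsub>?F\<^esub> \<one>\<^bsub>?F\<^esub> = \<zero>\<^bsub>?F\<^esub>"
  proof -
    have "[k] \<cdot>\<^bsub>?F\<^esub> \<one>\<^bsub>?F\<^esub> = int k mod int p" for k :: nat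
      by (induction k) (simp_all add: F.res_add_eq F.res_zero_eq F.res_one_eq mod_simps add.commute)
    then show ?thesis by (simp add: F.res_zero_eq)
  qed
  define L where "L = F.alg_closure"
  have hom: "F.indexed_const \<in> ring_hom ?F L" unfolding L_def by (rule F.alg_closureE(2))
  interpret L: algebraic_closure L "F.indexed_const ` carrier ?F"
    unfolding L_def by (rule F.alg_closureE(1))
  interpret h: ring_hom_ring ?F L F.indexed_const
    using hom by (intro ring_hom_ringI2 F.ring_axioms L.ring_axioms)
  have charL: "[p] \<cdot>\<^bsub>L\<^esub> \<one>\<^bsub>L\<^esub> = \<zero>\<^bsub>L\<^esub>"
  proof -
    have "F.indexed_const ([k] \<cdot>\<^bsub>?F\<^esub> \<one>\<^bsub>?F\<^esub>) = [k] \<cdot>\<^bsub>L\<^esub> \<one>\<^bsub>L\<^esub>" for k :: nat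
      by (induction k) simp_all
    from this[of p] show ?thesis unfolding charF by simp
  qed
  let ?V = "{x \<in> carrier L. x [^]\<^bsub>L\<^esub> p ^ n = x}"
  let ?R = "L\<lparr>carrier := ?V\<rparr>"
  have pn: "p ^ n > 0" using prime_gt_0_nat[OF p] by simp
  have "subring ?V L"
  proof (rule L.subringI)
    fix x assume x: "x \<in> ?V"
    have "(\<ominus>\<^bsub>L\<^esub> x) [^]\<^bsub>L\<^esub> p ^ n \<oplus>\<^bsub>L\<^esub> x [^]\<^bsub>L\<^esub> p ^ n = \<zero>\<^bsub>L\<^esub> [^]\<^bsub>L\<^esub> p ^ n"
      using L.frobenius_additive[OF p charL, of "\<ominus>\<^bsub>L\<^esub> x" x n] x by (simp add: L.l_neg)
    then have "(\<ominus>\<^bsub>L\<^esub> x) [^]\<^bsub>L\<^esub> p ^ n \<oplus>\<^bsub>L\<^esub> x = \<zero>\<^bsub>L\<^esub>"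
      using x pn by (simp add: L.nat_pow_zero)
    then show "\<ominus>\<^bsub>L\<^esub> x \<in> ?V" using x by (auto intro: L.minus_equality[symmetric])
  qed (use L.frobenius_additive[OF p charL] in \<open>auto simp: L.nat_pow_distrib\<close>)
  moreover have "inv\<^bsub>L\<^esub> x \<in> ?V" if "x \<in> ?V - {\<zero>\<^bsub>L\<^esub>}" for x
  proof -
    have x: "x \<in> carrier L" "x \<noteq> \<zero>\<^bsub>L\<^esub>" "x [^]\<^bsub>L\<^esub> p ^ n = x" using that by auto
    then have ix: "inv\<^bsub>L\<^esub> x \<in> carrier L" "x \<otimes>\<^bsub>L\<^esub> inv\<^bsub>L\<^esub> x = \<one>\<^bsub>L\<^esub>"
      using L.field_Units by (simp_all add: L.Units_r_inv)
    then have "x \<otimes>\<^bsub>L\<^esub> (inv\<^bsub>L\<^esub> x) [^]\<^bsub>L\<^esub> p ^ n = \<one>\<^bsub>L\<^esub>"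
      using x by (metis L.nat_pow_distrib L.nat_pow_one)
    then have "(inv\<^bsub>L\<^esub> x) [^]\<^bsub>L\<^esub> p ^ n = inv\<^bsub>L\<^esub> x"
      using x ix by (metis L.comm_inv_char L.nat_pow_closed)
    then show ?thesis using ix by simp
  qed
  ultimately have "subfield ?V L" by (rule L.subfieldI')
  then have "field ?R" by (rule L.subfield_iff(2))
  moreover have "[k] \<cdot>\<^bsub>?R\<^esub> \<one>\<^bsub>?R\<^esub> = [k] \<cdot>\<^bsub>L\<^esub> \<one>\<^bsub>L\<^esub>" for k :: nat
    by (simp add: add_pow_def nat_pow_def)
  ultimately show thesis
    using that[of ?R] L.card_frobenius_fixed_points[OF p charL n] charL by simp
qed

section \<open>The field with fourth power order and its subfields\<close>

text \<open>The ring \<open>R\<close> is the field with \<open>q^4\<close> elements. The additivity of \<open>x [^] q\<close> is what makes the fixed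
points of this map and of its square subfields.\<close>

locale quartic_extension = field R for R (structure) +
  fixes q m :: nat
  assumes finite_carrier: "finite (carrier R)" and card_carrier: "card (carrier R) = q ^ 4"
    and frobenius: "\<lbrakk>x \<in> carrier R; y \<in> carrier R\<rbrakk> \<Longrightarrow> (x \<oplus> y) [^] q = x [^] q \<oplus> y [^] q"
    and m_pos: "m > 0" and q_gt_1: "q > 1" and dvd_q: "2 * m dvd q + 1"
begin

definition u where "u = q\<^sup>2"
text \<open>The order of the multiplicative group.\<close>

definition N where "N = q ^ 4 - 1"
text \<open>This number is chosen such that \<open>u = 1 + 2 * (m * M)\<close>.\<close>

definition M where "M = (q + 1) div (2 * m) * (q - 1)"

lemma q_odd: "odd q" using dvd_q by (metis dvd_mult_left even_plus_one_iff)

lemma u_eq: "u = 1 + 2 * (m * M)"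
proof -
  have "2 * (m * M) = (q + 1) * (q - 1)"
    using dvd_q by (simp add: M_def mult.assoc[symmetric])
  moreover have "u = 1 + (q + 1) * (q - 1)"
  proof -
    obtain r where "q = Suc r" using q_gt_1 by (cases q) auto
    then have "q * q = 1 + (q + 1) * (q - 1)" by simp
    then show ?thesis by (simp only: u_def power2_eq_square)
  qed
  ultimately show ?thesis by simp
qed

lemma M_even: "even M" using q_odd by (simp add: M_def)

lemma u_gt_1: "u > 1" unfolding u_def using q_gt_1 by (rule one_less_power) simp

lemma N_eq: "N = (u + 1) * (u - 1)" and N_eq': "N = (u + 1) * (q + 1) * (q - 1)"
proof -
  have "q ^ 4 = u * u" by (simp add: u_def power2_eq_square power4_eq_xxxx mult.assoc)
  then show "N = (u + 1) * (u - 1)" using u_gt_1 by (simp add: N_def algebra_simps diff_mult_distrib2)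
  moreover have "(q + 1) * (q - 1) = u - 1" by (simp add: u_def power2_eq_square algebra_simps diff_mult_distrib2)
  ultimately show "N = (u + 1) * (q + 1) * (q - 1)" by (simp only: mult.assoc)
qed

lemma N_pos: "N > 0" using N_eq u_gt_1 by simp

definition gen where "gen = (SOME g. g \<in> carrier R - {\<zero>} \<and> carrier R - {\<zero>} = {g [^] i | i :: nat. i \<in> UNIV})"

lemma gen: "gen \<in> carrier R" "gen \<noteq> \<zero>" and gen_powers: "carrier R - {\<zero>} = {gen [^] i | i :: nat. i \<in> UNIV}"
proof -
  have "\<exists>g. g \<in> carrier R - {\<zero>} \<and> carrier R - {\<zero>} = {g [^] i | i :: nat. i \<in> UNIV}"
    using finite_field_mult_group_has_gen[OF finite_carrier] by (auto simp: Multiplicative_Group.nat_pow_mult_of)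
  from someI_ex[OF this] show "gen \<in> carrier R" "gen \<noteq> \<zero>" "carrier R - {\<zero>} = {gen [^] i | i :: nat. i \<in> UNIV}"
    unfolding gen_def by auto
qed

lemma gen_pow_closed [simp]: "gen [^] (i :: nat) \<in> carrier R" and gen_pow_nonzero [simp]: "gen [^] (i :: nat) \<noteq> \<zero>"
  using gen gen_powers by auto

lemma gen_pow_eq_one_iff: "gen [^] (i :: nat) = \<one> \<longleftrightarrow> N dvd i"
proof -
  interpret mg: group "Multiplicative_Group.mult_of R" by (rule field_mult_group)
  have fin: "finite (carrier (Multiplicative_Group.mult_of R))" using finite_carrier by simp
  have g: "gen \<in> carrier (Multiplicative_Group.mult_of R)" using gen by simp
  have "mg.ord gen = card (generate (Multiplicative_Group.mult_of R) {gen})"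
    using mg.generate_pow_card[OF g] .
  also have "generate (Multiplicative_Group.mult_of R) {gen} = carrier (Multiplicative_Group.mult_of R)"
    using mg.generate_pow_on_finite_carrier[OF fin g] gen_powers by (auto simp: Multiplicative_Group.nat_pow_mult_of)
  also have "card (carrier (Multiplicative_Group.mult_of R)) = N"
    using finite_carrier card_carrier by (simp add: N_def)
  finally show ?thesis using mg.pow_eq_id[OF g, of i] by (simp add: Multiplicative_Group.nat_pow_mult_of)
qed

lemma gen_pow_eq_iff: "gen [^] (i :: nat) = gen [^] j \<longleftrightarrow> i mod N = j mod N"
proof -
  have *: "gen [^] i = gen [^] j \<longleftrightarrow> i mod N = j mod N" if "i \<le> j" for i j :: nat
  proof -
    have "gen [^] j = gen [^] i \<otimes> gen [^] (j - i)" using gen that by (simp add: nat_pow_mult)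
    then have "gen [^] i = gen [^] j \<longleftrightarrow> gen [^] i \<otimes> \<one> = gen [^] i \<otimes> gen [^] (j - i)" by simp
    also have "\<dots> \<longleftrightarrow> gen [^] (j - i) = \<one>" by (subst m_lcancel) auto
    also have "\<dots> \<longleftrightarrow> i mod N = j mod N"
      unfolding gen_pow_eq_one_iff using that by (metis mod_eq_dvd_iff_nat)
    finally show ?thesis .
  qed
  show ?thesis using *[of i j] *[of j i] by (cases "i \<le> j") auto
qed

text \<open>The discrete logarithm to the base \<open>gen\<close>; only its residue modulo \<open>N\<close> has a meaning.\<close>

definition lg where "lg x = (SOME i :: nat. gen [^] i = x)"

lemma gen_lg: "x \<in> carrier R \<Longrightarrow> x \<noteq> \<zero> \<Longrightarrow> gen [^] lg x = x"
proof -
  assume "x \<in> carrier R" "x \<noteq> \<zero>"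
  then have "x \<in> {gen [^] i | i :: nat. i \<in> UNIV}" unfolding gen_powers[symmetric] by simp
  then have "\<exists>i :: nat. gen [^] i = x" by auto
  then show ?thesis unfolding lg_def by (rule someI_ex)
qed

lemma lg_gen_pow: "lg (gen [^] (i :: nat)) mod N = i mod N"
  using gen_lg[of "gen [^] i"] gen_pow_eq_iff by auto

lemma lg_mult:
  assumes "x \<in> carrier R" "x \<noteq> \<zero>" "y \<in> carrier R" "y \<noteq> \<zero>"
  shows "lg (x \<otimes> y) mod N = (lg x + lg y) mod N"
proof -
  have "x \<otimes> y = gen [^] (lg x + lg y)"
    using gen_lg[OF assms(1,2)] gen_lg[OF assms(3,4)] gen by (metis nat_pow_mult)
  then show ?thesis by (simp add: lg_gen_pow)
qed

lemma lg_pow: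
  assumes "x \<in> carrier R" "x \<noteq> \<zero>"
  shows "lg (x [^] (k :: nat)) mod N = (k * lg x) mod N"
proof -
  have "x [^] k = gen [^] (k * lg x)"
    using gen_lg[OF assms] gen by (metis nat_pow_pow mult.commute)
  then show ?thesis by (simp add: lg_gen_pow)
qed

lemma mod_dvd_cong: "d dvd (N :: nat) \<Longrightarrow> i mod N = j mod N \<Longrightarrow> i mod d = j mod d"
  by (metis mod_mod_cancel)

lemma pow_eq_one_iff:
  assumes "x \<in> carrier R" "x \<noteq> \<zero>" and de: "d * e = N"
  shows "x [^] e = \<one> \<longleftrightarrow> d dvd lg x"
proof -
  have e: "e > 0" using de N_pos by (cases e) auto
  have "x [^] e = gen [^] (lg x * e)"
    using gen_lg[OF assms(1,2)] gen by (metis nat_pow_pow)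
  then have "x [^] e = \<one> \<longleftrightarrow> d * e dvd lg x * e" using gen_pow_eq_one_iff de by simp
  then show ?thesis using e by simp
qed

lemma power_Suc_fixed_iff:
  assumes "x \<in> carrier R" "x \<noteq> \<zero>"
  shows "x [^] Suc e = x \<longleftrightarrow> x [^] e = \<one>"
proof -
  have "x [^] Suc e = x \<longleftrightarrow> x \<otimes> x [^] e = x \<otimes> \<one>" using assms by (simp add: m_comm)
  also have "\<dots> \<longleftrightarrow> x [^] e = \<one>" using assms by (subst m_lcancel) auto
  finally show ?thesis .
qed

lemma card_fixed:
  assumes de: "d * e = N"
  shows "card {x \<in> carrier R. x [^] Suc e = x} = Suc e"
proof -
  have e: "e > 0" and d: "d > 0" using de N_pos by (auto intro: Nat.gr0I)
  have "{x \<in> carrier R. x [^] Suc e = x} = insert \<zero> ((\<lambda>j :: nat. gen [^] (d * j)) ` {..<e})" (is "?A = insert _ ?B")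
  proof
    show "insert \<zero> ?B \<subseteq> ?A"
    proof -
      have "(gen [^] (d * j)) [^] Suc e = gen [^] (d * j)" for j :: nat
        using gen by (subst power_Suc_fixed_iff) (simp_all only: gen_pow_closed gen_pow_nonzero not_False_eq_True,
           simp add: nat_pow_pow gen_pow_eq_one_iff de[symmetric])
      then show ?thesis by (auto simp: nat_pow_zero)
    qed
    show "?A \<subseteq> insert \<zero> ?B"
    proof
      fix x assume x: "x \<in> ?A"
      show "x \<in> insert \<zero> ?B"
      proof (cases "x = \<zero>")
        case False
        then have "d dvd lg x" using x power_Suc_fixed_iff pow_eq_one_iff[OF _ False de] by auto
        then obtain k where k: "lg x = d * k" by (auto simp: dvd_def)
        have "x = gen [^] (d * k)" using gen_lg[of x] x False k by auto
        also have "\<dots> = gen [^] (d * (k mod e))"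
          unfolding gen_pow_eq_iff de[symmetric] by (simp only: mult_mod_right[symmetric] mod_mod_trivial)
        finally show ?thesis using e by auto
      qed simp
    qed
  qed
  moreover have "inj_on (\<lambda>j :: nat. gen [^] (d * j)) {..<e}"
  proof (rule inj_onI)
    fix i j assume ij: "i \<in> {..<e}" "j \<in> {..<e}" "gen [^] (d * i) = gen [^] (d * j)"
    then have "d * (i mod e) = d * (j mod e)"
      unfolding gen_pow_eq_iff de[symmetric] mult_mod_right by simp
    then show "i = j" using d ij by simp
  qed
  moreover have "\<zero> \<notin> ?B" using gen_pow_nonzero by (metis (no_types, lifting) imageE)
  ultimately show ?thesis by (simp add: card_image)
qed

text \<open>The subfields with \<open>u\<close> and with \<open>q\<close> elements.\<close>

definition K where "K = {x \<in> carrier R. x [^] u = x}"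
definition k where "k = {x \<in> carrier R. x [^] q = x}"

lemma K_closed: "x \<in> K \<Longrightarrow> x \<in> carrier R" and k_closed: "x \<in> k \<Longrightarrow> x \<in> carrier R"
  by (auto simp: K_def k_def)

lemma finite_K: "finite K" and finite_k: "finite k"
  using finite_carrier by (auto simp: K_def k_def)

lemma card_K: "card K = u"
  using card_fixed[of "u + 1" "u - 1"] N_eq u_gt_1 by (simp add: K_def)

lemma card_k: "card k = q"
  using card_fixed[of "(u + 1) * (q + 1)" "q - 1"] N_eq' q_gt_1 by (simp add: k_def)

lemma pow_u: "x \<in> carrier R \<Longrightarrow> x [^] u = (x [^] q) [^] q"
  by (simp add: u_def nat_pow_pow power2_eq_square)

lemma frobenius_u: "\<lbrakk>x \<in> carrier R; y \<in> carrier R\<rbrakk> \<Longrightarrow> (x \<oplus> y) [^] u = x [^] u \<oplus> y [^] u"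
  by (simp add: pow_u frobenius)

lemma frobenius_minus:
  assumes "x \<in> carrier R" shows "(\<ominus> x) [^] u = \<ominus> (x [^] u)"
proof -
  have "(\<ominus> x) [^] u \<oplus> x [^] u = \<zero>"
    using frobenius_u[of "\<ominus> x" x] assms u_gt_1 by (simp add: l_neg nat_pow_zero)
  then show ?thesis using assms by (metis a_inv_closed minus_equality nat_pow_closed)
qed

lemma k_subset_K: "k \<subseteq> K" using pow_u by (auto simp: k_def K_def)

lemma zero_k: "\<zero> \<in> k" and one_k: "\<one> \<in> k" using q_gt_1 by (auto simp: k_def nat_pow_zero)

lemma zero_K: "\<zero> \<in> K" and one_K: "\<one> \<in> K" using k_subset_K zero_k one_k by auto

lemma K_add: "x \<in> K \<Longrightarrow> y \<in> K \<Longrightarrow> x \<oplus> y \<in> K" by (auto simp: K_def frobenius_u)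
lemma K_mult: "x \<in> K \<Longrightarrow> y \<in> K \<Longrightarrow> x \<otimes> y \<in> K" by (auto simp: K_def nat_pow_distrib)
lemma K_minus: "x \<in> K \<Longrightarrow> \<ominus> x \<in> K" by (auto simp: K_def frobenius_minus)
lemma k_minus: "x \<in> k \<Longrightarrow> \<ominus> x \<in> k"
proof -
  assume x: "x \<in> k"
  have "(\<ominus> x) [^] q \<oplus> x [^] q = \<zero>"
    using frobenius[of "\<ominus> x" x] k_closed[OF x] q_gt_1 by (simp add: l_neg nat_pow_zero)
  then have "(\<ominus> x) [^] q = \<ominus> (x [^] q)"
    using k_closed[OF x] by (metis a_inv_closed minus_equality nat_pow_closed)
  then show "\<ominus> x \<in> k" using x by (simp add: k_def)
qed
lemma k_mult: "x \<in> k \<Longrightarrow> y \<in> k \<Longrightarrow> x \<otimes> y \<in> k" by (auto simp: k_def nat_pow_distrib)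
lemma k_add: "x \<in> k \<Longrightarrow> y \<in> k \<Longrightarrow> x \<oplus> y \<in> k" by (auto simp: k_def frobenius)

lemma field_inverse: "x \<in> carrier R \<Longrightarrow> x \<noteq> \<zero> \<Longrightarrow> inv x \<in> carrier R \<and> x \<otimes> inv x = \<one> \<and> inv x \<otimes> x = \<one> \<and> inv x \<noteq> \<zero>"
  using field_Units by (metis Diff_iff Units_inv_Units Units_closed Units_l_inv Units_r_inv singletonI singletonD insertI1)

lemma inv_pow_fixed:
  assumes "x \<in> carrier R" "x \<noteq> \<zero>" "x [^] (n :: nat) = x" shows "inv x [^] n = inv x"
proof -
  have i: "inv x \<in> carrier R" "x \<otimes> inv x = \<one>" using field_inverse[OF assms(1,2)] by auto
  have "x \<otimes> inv x [^] n = (x \<otimes> inv x) [^] n" using assms i(1) by (simp add: nat_pow_distrib)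
  also have "\<dots> = x \<otimes> inv x" using i by simp
  finally show ?thesis using assms i(1) by (metis m_lcancel nat_pow_closed)
qed

lemma K_inv: "x \<in> K \<Longrightarrow> x \<noteq> \<zero> \<Longrightarrow> inv x \<in> K"
  using inv_pow_fixed field_inverse by (auto simp: K_def)

lemma K_iff_dvd_lg: "x \<in> carrier R \<Longrightarrow> x \<noteq> \<zero> \<Longrightarrow> x \<in> K \<longleftrightarrow> u + 1 dvd lg x"
  using power_Suc_fixed_iff[of x "u - 1"] pow_eq_one_iff[of x "u + 1" "u - 1"] N_eq u_gt_1 by (simp add: K_def)

lemma k_dvd_lg: "x \<in> k \<Longrightarrow> x \<noteq> \<zero> \<Longrightarrow> (u + 1) * (q + 1) dvd lg x"
  using power_Suc_fixed_iff[of x "q - 1"] pow_eq_one_iff[of x "(u + 1) * (q + 1)" "q - 1"] N_eq' q_gt_1 by (simp add: k_def)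

lemma minus_one_eq: "\<ominus> \<one> = gen [^] ((u + 1) * (m * M))" and minus_one_neq_one: "\<ominus> \<one> \<noteq> \<one>"
proof -
  let ?e = "gen [^] ((u + 1) * (m * M))"
  have N2: "N = (u + 1) * (m * M) * 2" using N_eq u_eq by simp
  have "(u + 1) * (m * M) + (u + 1) * (m * M) = N" unfolding N2 by simp
  then have "?e \<otimes> ?e = \<one>" using gen by (simp only: nat_pow_mult gen_pow_eq_one_iff dvd_refl)
  moreover have ne: "?e \<noteq> \<one>"
    unfolding gen_pow_eq_one_iff N2 using N_pos N2 by (auto dest: dvd_imp_le)
  ultimately have "?e = \<ominus> \<one>"
    using gen_pow_closed square_eq_one by blast
  then show "\<ominus> \<one> = ?e" "\<ominus> \<one> \<noteq> \<one>" using ne by auto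
qed

definition one_half where "one_half = inv (\<one> \<oplus> \<one>)"

lemma one_half_props: "one_half \<in> K" "one_half \<oplus> one_half = \<one>"
proof -
  have ne: "\<one> \<oplus> \<one> \<noteq> \<zero>" using minus_one_neq_one minus_equality[of \<one> \<one>] by auto
  show "one_half \<in> K" unfolding one_half_def by (rule K_inv[OF K_add[OF one_K one_K] ne])
  have "one_half \<otimes> (\<one> \<oplus> \<one>) = \<one>" using field_inverse[of "\<one> \<oplus> \<one>"] ne by (simp add: one_half_def)
  then show "one_half \<oplus> one_half = \<one>" using \<open>one_half \<in> K\<close> by (simp add: K_closed r_distr)
qed

text \<open>The trace from \<open>R\<close> to \<open>K\<close>.\<close>

definition T where "T x = x \<oplus> x [^] u"

lemma frobenius_u_involution: "(x [^] u) [^] u = x" if x: "x \<in> carrier R"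
proof (cases "x = \<zero>")
  case False
  have "(x [^] u) [^] u = gen [^] (lg x * (u * u))"
    using gen_lg[OF x False] gen by (metis nat_pow_pow mult.assoc)
  also have "\<dots> = gen [^] lg x"
    unfolding gen_pow_eq_iff
  proof -
    have "u * u = N + 1" using N_eq u_gt_1 by (simp add: algebra_simps diff_mult_distrib2)
    then show "lg x * (u * u) mod N = lg x mod N" by simp
  qed
  finally show ?thesis using gen_lg[OF x False] by simp
qed (use u_gt_1 in \<open>simp add: nat_pow_zero\<close>)

lemma T_closed: "x \<in> carrier R \<Longrightarrow> T x \<in> K"
  by (simp add: T_def K_def frobenius_u frobenius_u_involution a_comm)

lemma norm_closed: "x \<in> carrier R \<Longrightarrow> x \<otimes> x [^] u \<in> K"
  by (simp add: K_def nat_pow_distrib frobenius_u_involution m_comm)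

lemma T_add: "x \<in> carrier R \<Longrightarrow> y \<in> carrier R \<Longrightarrow> T (x \<oplus> y) = T x \<oplus> T y"
  by (simp add: T_def frobenius_u a_ac)

lemma T_scale: "x \<in> carrier R \<Longrightarrow> c \<in> K \<Longrightarrow> T (x \<otimes> c) = T x \<otimes> c"
  by (simp add: T_def K_def nat_pow_distrib l_distr)

end

section \<open>Gauss sums\<close>

lemma power_cong_mod: "\<omega> ^ d = 1 \<Longrightarrow> i mod d = j mod d \<Longrightarrow> \<omega> ^ i = \<omega> ^ j" for \<omega> :: complex
  by (metis mult_div_mod_eq power_add power_mult power_one mult_1)

lemma sum_over_fibres:
  fixes f :: "'b \<Rightarrow> complex"
  assumes "finite S" "finite Y" "g ` S \<subseteq> Y"
  shows "(\<Sum>a\<in>S. f (g a)) = (\<Sum>y\<in>Y. of_nat (card {a \<in> S. g a = y}) * f y)"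
proof -
  have "(\<Sum>a\<in>S. f (g a)) = (\<Sum>y\<in>Y. \<Sum>a\<in>{a \<in> S. g a = y}. f (g a))"
    by (rule sum.group[OF assms, symmetric])
  then show ?thesis by simp
qed

text \<open>The character \<open>\<psi>\<close> is additive. It is chosen trivial on \<open>k\<close>, so that the Gauss sums over \<open>K\<close> have no further
factor.\<close>

locale quartic_extension_character = quartic_extension +
  fixes \<psi> :: "'a \<Rightarrow> complex" and k0
  assumes \<psi>_add: "\<lbrakk>x \<in> carrier R; y \<in> carrier R\<rbrakk> \<Longrightarrow> \<psi> (x \<oplus> y) = \<psi> x * \<psi> y"
    and \<psi>_k: "x \<in> k \<Longrightarrow> \<psi> x = 1"
    and k0: "k0 \<in> K" "\<psi> k0 \<noteq> 1"
begin

lemma u1_dvd_N: "u + 1 dvd N" by (simp only: N_eq dvd_triv_left)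

lemma \<psi>_zero: "\<psi> \<zero> = 1" by (rule \<psi>_k[OF zero_k])

lemma sum_\<psi>_K:
  assumes t: "t \<in> K"
  shows "(\<Sum>x\<in>K. \<psi> (t \<otimes> x)) = (if t = \<zero> then of_nat u else 0)"
proof (cases "t = \<zero>")
  case True
  then have "(\<Sum>x\<in>K. \<psi> (t \<otimes> x)) = (\<Sum>x\<in>K. 1)"
    by (intro sum.cong) (auto simp: K_closed \<psi>_zero)
  then show ?thesis using True by (simp add: card_K)
next
  case False
  define z where "z = inv t \<otimes> k0"
  have z: "z \<in> K" "t \<otimes> z = k0"
    using field_inverse[OF K_closed[OF t] False] K_mult[OF K_inv[OF t False] k0(1)] K_closed[OF t] K_closed[OF k0(1)]
    by (simp_all add: z_def m_assoc[symmetric])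
  have "(\<Sum>x\<in>K. \<psi> (t \<otimes> x)) = (\<Sum>x\<in>K. \<psi> (t \<otimes> (x \<oplus> z)))"
    by (rule sum.reindex_bij_witness[of _ "\<lambda>x. x \<oplus> z" "\<lambda>x. x \<ominus> z"])
       (use z in \<open>auto simp: K_closed K_add K_minus a_minus_def a_assoc l_neg r_neg\<close>)
  also have "\<dots> = (\<Sum>x\<in>K. \<psi> (t \<otimes> x)) * \<psi> k0"
    unfolding sum_distrib_right using t z k0(1)
    by (intro sum.cong) (auto simp: K_closed r_distr \<psi>_add)
  finally have "(\<Sum>x\<in>K. \<psi> (t \<otimes> x)) * (1 - \<psi> k0) = 0" by (simp add: algebra_simps)
  then show ?thesis using False k0(2) by simp
qed

text \<open>The sum is \<open>q\<close> if \<open>\<psi>\<close> is trivial on \<open>t\<close> times \<open>k\<close>, and \<open>0\<close> otherwise. Summing over all \<open>t\<close> shows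
that exactly \<open>q\<close> elements \<open>t\<close> are of the first kind. All of \<open>k\<close> is among them, so there are no
others.\<close>

lemma sum_\<psi>_k:
  assumes t: "t \<in> K"
  shows "(\<Sum>s\<in>k. \<psi> (t \<otimes> s)) = (if t \<in> k then of_nat q else 0)"
proof -
  let ?W = "{t \<in> K. \<forall>s\<in>k. \<psi> (t \<otimes> s) = 1}"
  have dich: "(\<Sum>s\<in>k. \<psi> (t \<otimes> s)) = (if t \<in> ?W then of_nat q else 0)" if t: "t \<in> K" for t
  proof (cases "t \<in> ?W")
    case True
    then show ?thesis by (simp add: card_k)
  next
    case False
    then obtain s0 where s0: "s0 \<in> k" "\<psi> (t \<otimes> s0) \<noteq> 1" using t by auto
    have min: "\<ominus> s0 \<in> k" by (rule k_minus[OF s0(1)])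
    have "(\<Sum>s\<in>k. \<psi> (t \<otimes> s)) = (\<Sum>s\<in>k. \<psi> (t \<otimes> (s \<oplus> s0)))"
      by (rule sum.reindex_bij_witness[of _ "\<lambda>x. x \<oplus> s0" "\<lambda>x. x \<oplus> \<ominus> s0"])
         (use s0 min in \<open>auto simp: k_closed k_add a_assoc l_neg r_neg\<close>)
    also have "\<dots> = (\<Sum>s\<in>k. \<psi> (t \<otimes> s)) * \<psi> (t \<otimes> s0)"
      unfolding sum_distrib_right using t s0
      by (intro sum.cong) (auto simp: K_closed k_closed r_distr \<psi>_add)
    finally have "(\<Sum>s\<in>k. \<psi> (t \<otimes> s)) * (1 - \<psi> (t \<otimes> s0)) = 0" by (simp add: algebra_simps)
    then show ?thesis using False s0(2) by auto
  qed
  have "of_nat (q * card ?W) = (\<Sum>t\<in>K. \<Sum>s\<in>k. \<psi> (t \<otimes> s))"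
    using finite_K by (simp add: dich sum.If_cases Int_def mult.commute)
  also have "\<dots> = (\<Sum>s\<in>k. \<Sum>t\<in>K. \<psi> (s \<otimes> t))"
    by (subst sum.swap) (intro sum.cong refl arg_cong[of _ _ \<psi>], auto simp: K_closed k_closed m_comm)
  also have "\<dots> = (\<Sum>s\<in>k. if s = \<zero> then of_nat u else 0)"
    using k_subset_K by (intro sum.cong refl sum_\<psi>_K) auto
  also have "\<dots> = of_nat u" using finite_k zero_k by simp
  finally have "q * card ?W = q * q" by (simp only: of_nat_eq_iff u_def power2_eq_square)
  then have "card ?W = card k" using q_gt_1 card_k by simp
  moreover have "k \<subseteq> ?W" using k_subset_K by (auto simp: k_mult \<psi>_k)
  ultimately have "k = ?W" using finite_K by (intro card_subset_eq) auto
  then show ?thesis using dich[OF t] by simp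
qed

lemma sum_\<psi>_T: "(\<Sum>v\<in>carrier R. \<psi> (T (a \<otimes> v))) = (if a = \<zero> then of_nat (u\<^sup>2) else 0)"
  if a: "a \<in> carrier R"
proof (cases "a = \<zero>")
  case True
  then have "(\<Sum>v\<in>carrier R. \<psi> (T (a \<otimes> v))) = (\<Sum>v\<in>carrier R. 1)"
    using u_gt_1 by (intro sum.cong) (auto simp: T_def nat_pow_zero \<psi>_zero)
  then show ?thesis using True card_carrier by (simp add: u_def)
next
  case False
  define z where "z = inv a \<otimes> (one_half \<otimes> k0)"
  note ia = field_inverse[OF a False]
  have hk: "one_half \<otimes> k0 \<in> K" by (rule K_mult[OF one_half_props(1) k0(1)])
  have z: "z \<in> carrier R" "a \<otimes> z = one_half \<otimes> k0"
    using ia a K_closed[OF hk] by (simp_all add: z_def m_assoc[symmetric])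
  have Tz: "T (a \<otimes> z) = k0"
  proof -
    have "T (one_half \<otimes> k0) = one_half \<otimes> k0 \<oplus> one_half \<otimes> k0" using hk by (simp add: T_def K_def)
    also have "\<dots> = (one_half \<oplus> one_half) \<otimes> k0" using K_closed one_half_props(1) k0(1) by (simp add: l_distr)
    also have "\<dots> = k0" using one_half_props(2) K_closed[OF k0(1)] by simp
    finally show ?thesis using z by simp
  qed
  have "(\<Sum>v\<in>carrier R. \<psi> (T (a \<otimes> v))) = (\<Sum>v\<in>carrier R. \<psi> (T (a \<otimes> (v \<oplus> z))))"
    by (rule sum.reindex_bij_witness[of _ "\<lambda>x. x \<oplus> z" "\<lambda>x. x \<oplus> \<ominus> z"])
       (use z in \<open>auto simp: a_assoc l_neg r_neg\<close>)
  also have "\<dots> = (\<Sum>v\<in>carrier R. \<psi> (T (a \<otimes> v))) * \<psi> k0"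
    unfolding sum_distrib_right using a z(1)
    by (intro sum.cong) (auto simp: r_distr T_add \<psi>_add K_closed T_closed Tz K_closed[OF k0(1)])
  finally have "(\<Sum>v\<in>carrier R. \<psi> (T (a \<otimes> v))) * (1 - \<psi> k0) = 0" by (simp add: algebra_simps)
  then show ?thesis using False k0(2) by simp
qed

text \<open>Elements of \<open>K\<close> are powers of \<open>gen\<close> with exponent divisible by \<open>u + 1\<close>, which is even.\<close>

lemma ex_sqrt_of_K:
  assumes d: "d \<in> K" shows "\<exists>z\<in>carrier R. z \<otimes> z = d"
proof (cases "d = \<zero>")
  case False
  have "u + 1 dvd lg d" using K_iff_dvd_lg[OF K_closed[OF d] False] d by simp
  then obtain j where j: "lg d = (u + 1) * j" by (auto simp: dvd_def)
  have "(m * M + 1) * j + (m * M + 1) * j = lg d" unfolding j using u_eq by simp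
  then have "gen [^] ((m * M + 1) * j) \<otimes> gen [^] ((m * M + 1) * j) = d"
    using gen_lg[OF K_closed[OF d] False] gen by (simp only: nat_pow_mult)
  then show ?thesis using gen_pow_closed by blast
qed (auto intro!: bexI[of _ \<zero>])

text \<open>The polynomial \<open>X\<^sup>2 - t X + n\<close> has two roots in \<open>R\<close>, found by completing the square. The map
\<open>x [^] u\<close> either fixes both of them, and they contribute to the second set, or it exchanges them, and they
contribute to the first one; a double root contributes once to each.\<close>

lemma norm_trace_split_count:
  assumes t: "t \<in> K" and n: "n \<in> K"
  shows "card {v \<in> carrier R. T v = t \<and> v \<otimes> v [^] u = n} + card {x \<in> K. x \<otimes> (t \<ominus> x) = n} = 2"
proof -
  define t' where "t' = one_half \<otimes> t"
  have tc: "t \<in> carrier R" and nc: "n \<in> carrier R" using t n by (auto simp: K_closed)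
  have t': "t' \<in> K" using t one_half_props K_mult by (simp add: t'_def)
  have t'c: "t' \<in> carrier R" using t' by (rule K_closed)
  have tt: "t = t' \<oplus> t'"
    using one_half_props K_closed[OF one_half_props(1)] tc by (simp add: t'_def l_distr[symmetric])
  obtain z where z: "z \<in> carrier R" "z \<otimes> z = t' \<otimes> t' \<ominus> n"
    using ex_sqrt_of_K[of "t' \<otimes> t' \<ominus> n"] t' n by (auto simp: a_minus_def K_add K_mult K_minus)
  define r where "r = t' \<oplus> z"
  define r' where "r' = t' \<ominus> z"
  have r: "r \<in> carrier R" "r' \<in> carrier R" using t'c z by (auto simp: r_def r'_def)
  have sum: "r \<oplus> r' = t" unfolding r_def r'_def tt using t'c z(1) by algebra
  have "r \<otimes> r' = t' \<otimes> t' \<ominus> z \<otimes> z" unfolding r_def r'_def using t'c z(1) by algebra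
  also have "\<dots> = n" unfolding z(2) using t'c nc by algebra
  finally have prod: "r \<otimes> r' = n" .
  have tx: "t \<ominus> x = y \<longleftrightarrow> t = y \<oplus> x" if "x \<in> carrier R" "y \<in> carrier R" for x y
    using that tc by (auto simp: a_minus_def a_assoc l_neg r_neg)
  have roots: "x \<otimes> (t \<ominus> x) = n \<longleftrightarrow> x = r \<or> x = r'" if x: "x \<in> carrier R" for x
  proof -
    have "(x \<ominus> r) \<otimes> (x \<ominus> r') = n \<ominus> x \<otimes> (t \<ominus> x)"
      unfolding sum[symmetric] prod[symmetric] using x r by algebra
    then have "x \<otimes> (t \<ominus> x) = n \<longleftrightarrow> (x \<ominus> r) \<otimes> (x \<ominus> r') = \<zero>"
      using x tc nc by (metis minus_closed m_closed r_right_minus_eq)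
    also have "\<dots> \<longleftrightarrow> x = r \<or> x = r'" using x r by (simp add: integral_iff)
    finally show ?thesis .
  qed
  have cr: "t \<ominus> r = r'" "t \<ominus> r' = r"
    unfolding sum[symmetric] using r by algebra+
  have A: "{v \<in> carrier R. T v = t \<and> v \<otimes> v [^] u = n} = {v \<in> {r, r'}. v [^] u = t \<ominus> v}"
  proof -
    have "T v = t \<and> v \<otimes> v [^] u = n \<longleftrightarrow> v [^] u = t \<ominus> v \<and> (v = r \<or> v = r')" if v: "v \<in> carrier R" for v
    proof -
      have "T v = t \<longleftrightarrow> v [^] u = t \<ominus> v"
        unfolding T_def using tx[OF v, of "v [^] u"] v by (auto simp: a_comm)
      then show ?thesis using roots[OF v] by auto
    qed
    then show ?thesis using r by auto
  qed
  have B: "{x \<in> K. x \<otimes> (t \<ominus> x) = n} = {x \<in> {r, r'}. x [^] u = x}"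
    using roots r by (auto simp: K_def)
  have F: "r [^] u = r \<or> r [^] u = r'"
  proof -
    have rr: "(r [^] u) \<oplus> (r' [^] u) = t"
      using frobenius_u[OF r] sum t by (simp add: K_def)
    have "(r [^] u) \<otimes> (r' [^] u) = n"
      using nat_pow_distrib[OF r, of u] prod n by (simp add: K_def)
    moreover have "t \<ominus> r [^] u = r' [^] u"
      using tx[of "r [^] u" "r' [^] u"] rr r by (simp add: a_comm)
    ultimately show ?thesis using roots[of "r [^] u"] r by simp
  qed
  have F': "r' [^] u = t \<ominus> r [^] u"
    using frobenius_u[OF r] sum t r tx[of "r [^] u" "r' [^] u"] by (simp add: K_def a_comm)
  from F show ?thesis
  proof
    assume Fr: "r [^] u = r"
    then have Fr': "r' [^] u = r'" using F' cr by simp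
    show ?thesis
    proof (cases "r = r'")
      case True
      have "{v \<in> {r, r'}. v [^] u = t \<ominus> v} = {r}" "{x \<in> {r, r'}. x [^] u = x} = {r}"
        using True Fr cr by auto
      then show ?thesis unfolding A B by simp
    next
      case False
      have "{v \<in> {r, r'}. v [^] u = t \<ominus> v} = {}" "{x \<in> {r, r'}. x [^] u = x} = {r, r'}"
        using False Fr Fr' cr by auto
      then show ?thesis unfolding A B using False by simp
    qed
  next
    assume Fr: "r [^] u = r'"
    then have Fr': "r' [^] u = r" using F' cr by simp
    show ?thesis
    proof (cases "r = r'")
      case True
      have "{v \<in> {r, r'}. v [^] u = t \<ominus> v} = {r}" "{x \<in> {r, r'}. x [^] u = x} = {r}"
        using True Fr cr by auto
      then show ?thesis unfolding A B by simp
    next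
      case False
      have "{v \<in> {r, r'}. v [^] u = t \<ominus> v} = {r, r'}" "{x \<in> {r, r'}. x [^] u = x} = {}"
        using False Fr Fr' cr by auto
      then show ?thesis unfolding A B using False by simp
    qed
  qed
qed

text \<open>Multiplicative characters of \<open>R\<close> and of \<open>K\<close>; the lemma \<open>chiK_norm\<close> relates the two through the norm.\<close>

definition chi where "chi \<omega> x = (if x = \<zero> then 0 else \<omega> ^ lg x)" for \<omega> :: complex
definition chiK where "chiK \<omega> x = (if x = \<zero> then 0 else \<omega> ^ (lg x div (u + 1)))" for \<omega> :: complex

context
  fixes \<omega> :: complex
  assumes \<omega>: "\<omega> ^ (2 * m) = 1"
begin

lemma two_m_dvd: "2 * m dvd u - 1" "2 * m dvd N"
proof -
  show *: "2 * m dvd u - 1" using u_eq by simp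
  show "2 * m dvd N" unfolding N_eq by (rule dvd_mult[OF *])
qed

lemma omega_power_cong: "i mod N = j mod N \<Longrightarrow> \<omega> ^ i = \<omega> ^ j"
  by (rule power_cong_mod[OF \<omega>]) (rule mod_dvd_cong[OF two_m_dvd(2)])

lemma chi_mult: "x \<in> carrier R \<Longrightarrow> y \<in> carrier R \<Longrightarrow> chi \<omega> (x \<otimes> y) = chi \<omega> x * chi \<omega> y"
  using lg_mult[of x y] by (auto simp: chi_def integral_iff power_add[symmetric] intro!: omega_power_cong)

lemma omega_power_div_cong: "i mod N = j mod N \<Longrightarrow> u + 1 dvd i \<Longrightarrow> \<omega> ^ (i div (u + 1)) = \<omega> ^ (j div (u + 1))"
proof -
  assume ij: "i mod N = j mod N" and i: "u + 1 dvd i"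
  have "i mod (u + 1) = j mod (u + 1)" using ij by (rule mod_dvd_cong[OF u1_dvd_N])
  then have j: "u + 1 dvd j" using i by (simp add: dvd_eq_mod_eq_0)
  obtain i' j' where ij': "i = (u + 1) * i'" "j = (u + 1) * j'" using i j by (auto simp: dvd_def)
  have "(u + 1) * (i' mod (u - 1)) = (u + 1) * (j' mod (u - 1))"
    using ij unfolding ij' N_eq mult_mod_right .
  then have "i' mod (u - 1) = j' mod (u - 1) \<or> u + 1 = 0" by (simp only: mult_cancel1)
  then have "i' mod (u - 1) = j' mod (u - 1)" by simp
  then have "i' mod (2 * m) = j' mod (2 * m)" using two_m_dvd(1) by (metis mod_mod_cancel)
  then have "\<omega> ^ i' = \<omega> ^ j'" by (rule power_cong_mod[OF \<omega>])
  moreover have "(u + 1) * a div (u + 1) = a" for a by (rule nonzero_mult_div_cancel_left) simp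
  ultimately show ?thesis unfolding ij' by (simp only:)
qed

lemma chiK_mult: "x \<in> K \<Longrightarrow> y \<in> K \<Longrightarrow> chiK \<omega> (x \<otimes> y) = chiK \<omega> x * chiK \<omega> y"
proof (cases "x = \<zero> \<or> y = \<zero>")
  case False
  assume x: "x \<in> K" and y: "y \<in> K"
  have nz: "x \<noteq> \<zero>" "y \<noteq> \<zero>" "x \<otimes> y \<noteq> \<zero>" using False x y by (auto simp: K_closed integral_iff)
  have d: "u + 1 dvd lg x" "u + 1 dvd lg y" "u + 1 dvd lg (x \<otimes> y)"
    using K_iff_dvd_lg nz x y K_mult K_closed by auto
  have "\<omega> ^ (lg (x \<otimes> y) div (u + 1)) = \<omega> ^ ((lg x + lg y) div (u + 1))"
    using d(3) nz x y by (intro omega_power_div_cong lg_mult) (auto simp: K_closed)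
  also have "(lg x + lg y) div (u + 1) = lg x div (u + 1) + lg y div (u + 1)" using d by (simp add: div_plus_div_distrib_dvd_left)
  finally show ?thesis using nz by (simp add: chiK_def power_add)
qed (auto simp: chiK_def K_closed)

lemma chiK_norm: "v \<in> carrier R \<Longrightarrow> chiK \<omega> (v \<otimes> v [^] u) = chi \<omega> v"
proof (cases "v = \<zero>")
  case False
  assume v: "v \<in> carrier R"
  have eq: "v \<otimes> v [^] u = v [^] (u + 1)" using v by (simp add: m_comm)
  have "lg (v [^] (u + 1)) mod N = ((u + 1) * lg v) mod N" by (rule lg_pow[OF v False])
  then have "\<omega> ^ (((u + 1) * lg v) div (u + 1)) = \<omega> ^ (lg (v [^] (u + 1)) div (u + 1))"
    by (rule omega_power_div_cong[OF sym dvd_triv_left])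
  moreover have "((u + 1) * lg v) div (u + 1) = lg v" by (rule nonzero_mult_div_cancel_left) simp
  moreover have "v [^] (u + 1) \<noteq> \<zero>" using v False by (metis gen_lg gen gen_pow_nonzero nat_pow_pow)
  ultimately show ?thesis using False unfolding eq chiK_def chi_def by (simp only: if_False)
qed (simp add: chiK_def chi_def)

text \<open>This is where the hypothesis that \<open>2 * m\<close> divides \<open>q + 1\<close> enters.\<close>

lemma chiK_k: "s \<in> k \<Longrightarrow> s \<noteq> \<zero> \<Longrightarrow> chiK \<omega> s = 1"
proof -
  assume s: "s \<in> k" "s \<noteq> \<zero>"
  obtain j where j: "lg s = (u + 1) * (q + 1) * j" using k_dvd_lg[OF s] by (auto simp: dvd_def)
  obtain l where l: "q + 1 = 2 * m * l" using dvd_q by (auto simp: dvd_def)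
  have "lg s = (u + 1) * (2 * m * (l * j))" unfolding j l by (simp only: mult.assoc)
  moreover have "(u + 1) * a div (u + 1) = a" for a by (rule nonzero_mult_div_cancel_left) simp
  ultimately have "lg s div (u + 1) = 2 * m * (l * j)" by (simp only:)
  then show ?thesis using s(2) \<omega> by (simp add: chiK_def power_mult)
qed

context
  assumes \<omega>1: "\<omega> \<noteq> 1"
begin

lemma sum_chi: "(\<Sum>x\<in>carrier R. chi \<omega> x) = 0"
proof -
  have g: "chi \<omega> gen = \<omega>"
    using omega_power_cong[OF lg_gen_pow[of 1]] gen by (simp add: chi_def)
  have "(\<Sum>x\<in>carrier R. chi \<omega> x) = (\<Sum>x\<in>carrier R. chi \<omega> (gen \<otimes> x))"
    by (rule sum.reindex_bij_witness[of _ "\<lambda>x. gen \<otimes> x" "\<lambda>x. inv gen \<otimes> x"])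
       (use field_inverse[OF gen] gen in \<open>auto simp: m_assoc[symmetric]\<close>)
  also have "\<dots> = \<omega> * (\<Sum>x\<in>carrier R. chi \<omega> x)"
    unfolding sum_distrib_left using gen by (intro sum.cong) (auto simp: chi_mult g)
  finally have "(1 - \<omega>) * (\<Sum>x\<in>carrier R. chi \<omega> x) = 0" by (simp add: algebra_simps)
  then show ?thesis using \<omega>1 by simp
qed

lemma sum_chiK: "(\<Sum>x\<in>K. chiK \<omega> x) = 0"
proof -
  define g where "g = gen [^] (u + 1)"
  have g0: "g \<noteq> \<zero>" "g \<in> carrier R" by (simp_all only: g_def gen_pow_nonzero gen_pow_closed not_False_eq_True)
  have lg: "lg g mod N = (u + 1) mod N" unfolding g_def by (rule lg_gen_pow)
  have gK: "g \<in> K"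
  proof -
    have "lg g mod (u + 1) = (u + 1) mod (u + 1)"
      using lg by (rule mod_dvd_cong[OF u1_dvd_N])
    then show ?thesis using K_iff_dvd_lg[OF g0(2,1)] by (simp add: dvd_eq_mod_eq_0)
  qed
  have cg: "chiK \<omega> g = \<omega>"
    using omega_power_div_cong[OF lg[symmetric]] g0 by (simp add: chiK_def)
  have "(\<Sum>x\<in>K. chiK \<omega> x) = (\<Sum>x\<in>K. chiK \<omega> (g \<otimes> x))"
    by (rule sum.reindex_bij_witness[of _ "\<lambda>x. g \<otimes> x" "\<lambda>x. inv g \<otimes> x"])
       (use field_inverse[OF g0(2,1)] g0 gK in \<open>auto simp: m_assoc[symmetric] K_closed K_mult K_inv\<close>)
  also have "\<dots> = \<omega> * (\<Sum>x\<in>K. chiK \<omega> x)"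
    unfolding sum_distrib_left using gK by (intro sum.cong) (auto simp: chiK_mult cg)
  finally have "(1 - \<omega>) * (\<Sum>x\<in>K. chiK \<omega> x) = 0" by (simp add: algebra_simps)
  then show ?thesis using \<omega>1 by simp
qed

text \<open>The sum does not change if \<open>\<psi> t\<close> is replaced by \<open>\<psi> (t \<otimes> s)\<close> for a nonzero \<open>s\<close> in \<open>k\<close>. The average over
all such \<open>s\<close> is evaluated by \<open>sum_\<psi>_k\<close>.\<close>

lemma gauss_sum_K: "(\<Sum>t\<in>K. chiK \<omega> t * \<psi> t) = of_nat q"
proof -
  let ?G = "\<Sum>t\<in>K. chiK \<omega> t * \<psi> t"
  let ?k = "k - {\<zero>}"
  have G: "(\<Sum>t\<in>K. chiK \<omega> t * \<psi> (t \<otimes> s)) = ?G" if s: "s \<in> ?k" for s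
  proof -
    have sK: "s \<in> K" "s \<noteq> \<zero>" using s k_subset_K by auto
    note isv = field_inverse[OF K_closed[OF sK(1)] sK(2)]
    have "?G = (\<Sum>t\<in>K. chiK \<omega> (t \<otimes> s) * \<psi> (t \<otimes> s))"
      by (rule sum.reindex_bij_witness[of _ "\<lambda>x. x \<otimes> s" "\<lambda>x. x \<otimes> inv s"])
         (use isv sK in \<open>auto simp: m_assoc K_closed K_mult K_inv\<close>)
    then show ?thesis using s sK by (simp add: chiK_mult chiK_k cong: sum.cong)
  qed
  have "of_nat (q - 1) * ?G = (\<Sum>s\<in>?k. ?G)"
    using finite_k zero_k card_k by simp
  also have "\<dots> = (\<Sum>s\<in>?k. \<Sum>t\<in>K. chiK \<omega> t * \<psi> (t \<otimes> s))" using G by simp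
  also have "\<dots> = (\<Sum>t\<in>K. chiK \<omega> t * (\<Sum>s\<in>?k. \<psi> (t \<otimes> s)))"
    by (subst sum.swap) (simp add: sum_distrib_left)
  also have "\<dots> = (\<Sum>t\<in>K. chiK \<omega> t * ((if t \<in> k then of_nat q else 0) - 1))"
    using finite_k zero_k by (intro sum.cong) (auto simp: sum_diff1 sum_\<psi>_k K_closed \<psi>_zero)
  also have "\<dots> = (\<Sum>t\<in>K. if t \<in> k then chiK \<omega> t * of_nat q else 0) - (\<Sum>t\<in>K. chiK \<omega> t)"
    unfolding sum_subtractf[symmetric] by (intro sum.cong) (auto simp: right_diff_distrib)
  also have "\<dots> = (\<Sum>t\<in>k. chiK \<omega> t * of_nat q)"
    using finite_K k_subset_K by (simp add: sum_chiK sum.If_cases Int_absorb1 Int_absorb2)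
  also have "\<dots> = (\<Sum>t\<in>?k. of_nat q)"
    by (rule sum.mono_neutral_cong_right) (use finite_k in \<open>auto simp: chiK_k chiK_def[of _ \<zero>]\<close>)
  also have "\<dots> = of_nat (q - 1) * of_nat q" using finite_k zero_k card_k by simp
  finally show ?thesis using q_gt_1 by simp
qed

text \<open>Grouping by trace and norm, the sum over \<open>R\<close> and the square of the sum over \<open>K\<close> add up to twice the
sum of \<open>chiK \<omega> n * \<psi> t\<close> over all pairs, by \<open>norm_trace_split_count\<close>; this sum is \<open>0\<close>.\<close>

lemma gauss_sum: "(\<Sum>v\<in>carrier R. chi \<omega> v * \<psi> (T v)) = - of_nat u"
proof -
  let ?f = "\<lambda>(t, n). chiK \<omega> n * \<psi> t"
  have fin: "finite (K \<times> K)" using finite_K by simp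
  have 1: "(\<Sum>v\<in>carrier R. chi \<omega> v * \<psi> (T v))
      = (\<Sum>(t, n)\<in>K \<times> K. of_nat (card {v \<in> carrier R. T v = t \<and> v \<otimes> v [^] u = n}) * ?f (t, n))"
    using sum_over_fibres[OF finite_carrier fin, of "\<lambda>v. (T v, v \<otimes> v [^] u)" ?f] norm_closed T_closed
    by (simp add: chiK_norm image_subset_iff case_prod_unfold prod_eq_iff)
  have "(\<Sum>t\<in>K. chiK \<omega> t * \<psi> t) * (\<Sum>t\<in>K. chiK \<omega> t * \<psi> t)
      = (\<Sum>(x, y)\<in>K \<times> K. ?f (x \<oplus> y, x \<otimes> y))"
    unfolding sum_product sum.cartesian_product
    by (intro sum.cong) (auto simp: chiK_mult \<psi>_add K_closed)
  also have "\<dots> = (\<Sum>a\<in>K \<times> K. ?f (case a of (x, y) \<Rightarrow> (x \<oplus> y, x \<otimes> y)))"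
    by (simp add: case_prod_unfold)
  also have "\<dots> = (\<Sum>(t, n)\<in>K \<times> K. of_nat (card {a \<in> K \<times> K. (case a of (x, y) \<Rightarrow> (x \<oplus> y, x \<otimes> y)) = (t, n)}) * ?f (t, n))"
    unfolding case_prod_beta' prod.collapse by (rule sum_over_fibres[OF fin fin]) (auto simp: K_add K_mult)
  also have "\<dots> = (\<Sum>(t, n)\<in>K \<times> K. of_nat (card {x \<in> K. x \<otimes> (t \<ominus> x) = n}) * ?f (t, n))"
  proof (intro sum.cong refl, clarify)
    fix t n assume t: "t \<in> K" "n \<in> K"
    have canc: "a \<oplus> (b \<oplus> \<ominus> a) = b" if "a \<in> K" "b \<in> K" for a b
      using K_closed[OF that(1)] K_closed[OF that(2)] by algebra
    have "bij_betw fst {a \<in> K \<times> K. (case a of (x, y) \<Rightarrow> (x \<oplus> y, x \<otimes> y)) = (t, n)} {x \<in> K. x \<otimes> (t \<ominus> x) = n}"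
      by (rule bij_betw_byWitness[where f' = "\<lambda>x. (x, t \<ominus> x)"])
         (use t in \<open>auto simp: K_closed a_minus_def K_add K_minus a_assoc canc\<close>)
    then show "of_nat (card {a \<in> K \<times> K. (case a of (x, y) \<Rightarrow> (x \<oplus> y, x \<otimes> y)) = (t, n)}) * (chiK \<omega> n * \<psi> t)
        = of_nat (card {x \<in> K. x \<otimes> (t \<ominus> x) = n}) * (chiK \<omega> n * \<psi> t)"
      by (simp add: bij_betw_same_card)
  qed
  finally have 2: "of_nat q * of_nat q = (\<Sum>(t, n)\<in>K \<times> K. of_nat (card {x \<in> K. x \<otimes> (t \<ominus> x) = n}) * ?f (t, n))"
    unfolding gauss_sum_K .
  have "(\<Sum>v\<in>carrier R. chi \<omega> v * \<psi> (T v)) + of_nat q * of_nat q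
     = (\<Sum>(t, n)\<in>K \<times> K. 2 * ?f (t, n))"
    unfolding 1 2 sum.distrib[symmetric]
  proof (intro sum.cong refl, clarify)
    fix t n assume tn: "t \<in> K" "n \<in> K"
    let ?A = "card {v \<in> carrier R. T v = t \<and> v \<otimes> v [^] u = n}" and ?B = "card {x \<in> K. x \<otimes> (t \<ominus> x) = n}"
    have "of_nat (?A + ?B) = (2 :: complex)" unfolding norm_trace_split_count[OF tn] by simp
    then show "of_nat ?A * (chiK \<omega> n * \<psi> t) + of_nat ?B * (chiK \<omega> n * \<psi> t) = 2 * (chiK \<omega> n * \<psi> t)"
      unfolding distrib_right[symmetric] of_nat_add by (rule arg_cong)
  qed
  also have "\<dots> = 2 * ((\<Sum>t\<in>K. \<psi> t) * (\<Sum>n\<in>K. chiK \<omega> n))"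
    unfolding sum_product sum.cartesian_product
    by (simp add: case_prod_unfold sum_distrib_left mult.commute)
  also have "\<dots> = 0" by (simp add: sum_chiK)
  finally show ?thesis by (simp add: u_def power2_eq_square eq_neg_iff_add_eq_0)
qed

lemma transform_chi:
  assumes a: "a \<in> carrier R"
  shows "(\<Sum>v\<in>carrier R. chi \<omega> v * \<psi> (T (a \<otimes> v))) = (if a = \<zero> then 0 else - of_nat u / \<omega> ^ lg a)"
proof (cases "a = \<zero>")
  case True
  then have "(\<Sum>v\<in>carrier R. chi \<omega> v * \<psi> (T (a \<otimes> v))) = (\<Sum>v\<in>carrier R. chi \<omega> v)"
    using u_gt_1 by (intro sum.cong) (auto simp: T_def nat_pow_zero \<psi>_zero)
  then show ?thesis using True sum_chi by simp
next
  case False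
  note ia = field_inverse[OF a False]
  have "\<omega> \<noteq> 0" using \<omega> m_pos by (auto simp: power_0_left)
  have "- of_nat u = (\<Sum>v\<in>carrier R. chi \<omega> v * \<psi> (T v))" by (rule gauss_sum[symmetric])
  also have "\<dots> = (\<Sum>v\<in>carrier R. chi \<omega> (a \<otimes> v) * \<psi> (T (a \<otimes> v)))"
    by (rule sum.reindex_bij_witness[of _ "\<lambda>x. a \<otimes> x" "\<lambda>x. inv a \<otimes> x"])
       (use ia a in \<open>auto simp: m_assoc[symmetric]\<close>)
  also have "\<dots> = \<omega> ^ lg a * (\<Sum>v\<in>carrier R. chi \<omega> v * \<psi> (T (a \<otimes> v)))"
    unfolding sum_distrib_left using a False
    by (intro sum.cong) (auto simp: chi_mult chi_def[of _ a])
  finally show ?thesis using False \<open>\<omega> \<noteq> 0\<close> by (simp add: field_simps)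
qed

end
end
end

section \<open>Labellings of the field\<close>

lemma even_mod: "even d \<Longrightarrow> even (i mod d) \<longleftrightarrow> even (i :: nat)"
  by (simp add: dvd_mod_iff)

context quartic_extension_character
begin

definition h where "h = m * M"

lemma h_properties: "u = 1 + 2 * h" "even h" "even (u + 1)" "odd u" "even N" "h > 0"
  using u_eq M_even u_gt_1 by (auto simp: h_def N_eq)

text \<open>The index of the line over \<open>K\<close> that is orthogonal to \<open>a\<close> for the trace form, where line number \<open>i\<close>
contains \<open>gen [^] i\<close>.\<close>

definition line_index where "line_index a = (h + 1 + u * lg a) mod (u + 1)"

lemma line_index_le: "line_index a \<le> u"
  using mod_less_divisor[of "u + 1"] by (simp add: line_index_def less_Suc_eq_le)

lemma even_line_index: "even (line_index a) \<longleftrightarrow> odd (lg a)"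
  unfolding line_index_def even_mod[OF h_properties(3)] using h_properties(2,4) by simp

text \<open>For \<open>x = a \<otimes> gen [^] i\<close>, the trace of \<open>x\<close> vanishes if and only if \<open>x [^] (u - 1) = \<ominus> \<one>\<close>, that is, if the logarithm of \<open>x\<close> is
\<open>h + 1\<close> modulo \<open>u + 1\<close>.\<close>

lemma kernel_line:
  assumes a: "a \<in> carrier R" "a \<noteq> \<zero>" and i: "i \<le> u"
  shows "T (a \<otimes> gen [^] i) = \<zero> \<longleftrightarrow> i = line_index a"
proof -
  define x where "x = a \<otimes> gen [^] i"
  have x: "x \<in> carrier R" "x \<noteq> \<zero>" using a by (auto simp: x_def integral_iff)
  have lgx: "lg x mod (u + 1) = (lg a + i) mod (u + 1)"
  proof -
    have "lg x mod N = (lg a + lg (gen [^] i)) mod N"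
      unfolding x_def by (rule lg_mult) (use a in auto)
    also have "\<dots> = (lg a + i) mod N" by (metis lg_gen_pow mod_add_right_eq)
    finally show ?thesis by (rule mod_dvd_cong[OF u1_dvd_N])
  qed
  have "T x = \<zero> \<longleftrightarrow> x [^] u = \<ominus> x"
  proof
    assume "T x = \<zero>"
    then have "x [^] u \<oplus> x = \<zero>" using x by (simp add: T_def a_comm)
    then show "x [^] u = \<ominus> x" using x by (metis minus_equality nat_pow_closed)
  qed (use x in \<open>simp add: T_def r_neg\<close>)
  also have "\<dots> \<longleftrightarrow> x \<otimes> x [^] (u - 1) = x \<otimes> (\<ominus> \<one>)"
  proof -
    have "x [^] u = x \<otimes> x [^] (u - 1)"
      using x u_gt_1 nat_pow_mult[OF x(1), of 1 "u - 1"] by simp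
    then show ?thesis using x by (simp add: r_minus)
  qed
  also have "\<dots> \<longleftrightarrow> x [^] (u - 1) = \<ominus> \<one>" using x by (subst m_lcancel) auto
  also have "x [^] (u - 1) = gen [^] (2 * h * lg x)"
  proof -
    have "x [^] (u - 1) = (gen [^] lg x) [^] (2 * h)" using gen_lg[OF x] h_properties(1) by simp
    then show ?thesis using gen by (simp add: nat_pow_pow mult.commute)
  qed
  also have "\<ominus> \<one> = gen [^] (2 * h * (h + 1))"
    unfolding minus_one_eq h_def[symmetric] using h_properties(1) by (simp add: algebra_simps)
  also have "gen [^] (2 * h * lg x) = gen [^] (2 * h * (h + 1)) \<longleftrightarrow> lg x mod (u + 1) = (h + 1) mod (u + 1)"
  proof -
    have N: "N = 2 * h * (u + 1)" using h_properties(1) by (simp add: N_eq)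
    show ?thesis unfolding gen_pow_eq_iff N mult_mod_right[symmetric] using h_properties(6) by simp
  qed
  also have "\<dots> \<longleftrightarrow> i = line_index a"
  proof -
    have "(lg a + line_index a) mod (u + 1) = (h + 1 + (u + 1) * lg a) mod (u + 1)"
      unfolding line_index_def mod_add_right_eq by (simp add: algebra_simps)
    then have "(lg a + line_index a) mod (u + 1) = (h + 1) mod (u + 1)" by (simp only: mod_mult_self2)
    then have "lg x mod (u + 1) = (h + 1) mod (u + 1) \<longleftrightarrow> [lg a + i = lg a + line_index a] (mod (u + 1))"
      unfolding lgx cong_def by simp
    also have "\<dots> \<longleftrightarrow> [i = line_index a] (mod (u + 1))" by (rule cong_add_lcancel_nat)
    also have "\<dots> \<longleftrightarrow> i mod (u + 1) = line_index a mod (u + 1)" by (simp only: cong_def)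
    finally show ?thesis using i line_index_le[of a] by simp
  qed
  finally show ?thesis by (simp add: x_def)
qed

definition line where "line i = {v \<in> carrier R. v = \<zero> \<or> lg v mod (u + 1) = i}"

lemma sum_over_line:
  assumes a: "a \<in> carrier R" and i: "i \<le> u"
  shows "(\<Sum>v\<in>line i. \<psi> (T (a \<otimes> v))) = (if T (a \<otimes> gen [^] i) = \<zero> then of_nat u else 0)"
proof -
  let ?g = "gen [^] i"
  note ig = field_inverse[OF gen_pow_closed[of i] gen_pow_nonzero[of i]]
  have lgg: "lg (?g \<otimes> c) mod (u + 1) = (i + lg c) mod (u + 1)" if "c \<in> carrier R" "c \<noteq> \<zero>" for c
  proof -
    have "lg (?g \<otimes> c) mod N = (lg ?g + lg c) mod N" by (rule lg_mult) (use that in auto)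
    also have "\<dots> = (i + lg c) mod N" by (metis lg_gen_pow mod_add_left_eq)
    finally show ?thesis by (rule mod_dvd_cong[OF u1_dvd_N])
  qed
  have "(\<Sum>v\<in>line i. \<psi> (T (a \<otimes> v))) = (\<Sum>c\<in>K. \<psi> (T (a \<otimes> (?g \<otimes> c))))"
  proof (rule sum.reindex_bij_witness[of _ "\<lambda>c. ?g \<otimes> c" "\<lambda>v. inv ?g \<otimes> v"])
    fix v assume v: "v \<in> line i"
    then have vc: "v \<in> carrier R" by (simp add: line_def)
    show gv: "?g \<otimes> (inv ?g \<otimes> v) = v" using ig vc by (simp add: m_assoc[symmetric])
    show "\<psi> (T (a \<otimes> (?g \<otimes> (inv ?g \<otimes> v)))) = \<psi> (T (a \<otimes> v))" unfolding gv ..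
    show "inv ?g \<otimes> v \<in> K"
    proof (cases "v = \<zero>")
      case True
      then show ?thesis using ig zero_K by simp
    next
      case False
      let ?c = "inv ?g \<otimes> v"
      have c: "?c \<in> carrier R" "?c \<noteq> \<zero>" using ig vc False by (auto simp: integral_iff)
      have "?g \<otimes> ?c = v" using ig vc by (simp add: m_assoc[symmetric])
      then have "(i + lg ?c) mod (u + 1) = i"
        using lgg[OF c] v False by (simp add: line_def)
      then have "[i + lg ?c = i + 0] (mod (u + 1))" using i by (simp add: cong_def)
      then have "u + 1 dvd lg ?c" unfolding cong_add_lcancel_nat by (simp add: cong_0_iff)
      then show ?thesis using K_iff_dvd_lg[OF c] by simp
    qed
  next
    fix c assume c: "c \<in> K"
    then have cc: "c \<in> carrier R" by (rule K_closed)
    show "inv ?g \<otimes> (?g \<otimes> c) = c" using ig cc by (simp add: m_assoc[symmetric])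
    show "?g \<otimes> c \<in> line i"
    proof (cases "c = \<zero>")
      case False
      have "lg (?g \<otimes> c) mod (u + 1) = (i + lg c) mod (u + 1)" by (rule lgg[OF cc False])
      also have "\<dots> = i"
        using K_iff_dvd_lg[OF cc False] c i by (metis add.right_neutral le_imp_less_Suc dvd_eq_mod_eq_0 mod_add_right_eq mod_less Suc_eq_plus1)
      finally show ?thesis using cc by (simp add: line_def)
    qed (simp add: line_def)
  qed
  also have "\<dots> = (\<Sum>c\<in>K. \<psi> (T (a \<otimes> ?g) \<otimes> c))"
    using a by (intro sum.cong) (auto simp: T_scale[symmetric] m_assoc K_closed)
  also have "\<dots> = (if T (a \<otimes> ?g) = \<zero> then of_nat u else 0)"
    by (rule sum_\<psi>_K[OF T_closed]) (use a in simp)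
  finally show ?thesis .
qed

text \<open>Both labels are reduced (by \<open>mod (u + 1)\<close> and by \<open>mod (2 * m)\<close>) because an element and its negative must have
the same labels, not just congruent ones.\<close>

definition primal :: "'a labelling" where
  "primal = \<lparr>half = \<lambda>v. even (lg v),
     plus_label = \<lambda>v. if v = \<zero> then 0 else lg v mod (u + 1) div 2,
     minus_label = \<lambda>v. lg v mod (2 * m) div 2\<rparr>"

definition dual :: "'a labelling" where
  "dual = \<lparr>half = \<lambda>a. odd (lg a),
     plus_label = \<lambda>a. if a = \<zero> then 0 else line_index a div 2,
     minus_label = \<lambda>a. if even (lg a) then m - lg a mod (2 * m) div 2 else m - lg a mod (2 * m) div 2 - 1\<rparr>"

context
  fixes \<zeta> :: complex
  assumes \<zeta>: "\<zeta> ^ m = 1" "\<zeta> \<noteq> 1"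
begin

text \<open>The lines in one half get the labels \<open>0, ..., h\<close>. Since \<open>h\<close> is a multiple of \<open>m\<close>, all
residues occur equally often except for one additional \<open>0\<close>.\<close>

lemma sum_line_labels: "(\<Sum>i | i \<le> u \<and> even i = \<beta>. \<zeta> ^ (i div 2)) = 1"
proof -
  have "(\<Sum>i | i \<le> u \<and> even i = \<beta>. \<zeta> ^ (i div 2)) = (\<Sum>t<Suc h. \<zeta> ^ t)"
    by (rule sum.reindex_bij_witness[of _ "\<lambda>t. 2 * t + of_bool (\<not> \<beta>)" "\<lambda>i. i div 2"])
       (use h_properties(1) in \<open>auto elim!: evenE oddE\<close>)
  also have "\<dots> = (\<Sum>t<h. \<zeta> ^ t) + 1" using \<zeta>(1) by (simp add: h_def power_mult)
  also have "(\<Sum>t<h. \<zeta> ^ t) = 0"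
    using \<zeta> by (simp add: geometric_sum h_def power_mult)
  finally show ?thesis by simp
qed

text \<open>On each half the plus function is a combination of indicators of lines, also at \<open>\<zero>\<close>, where the
coefficients add up to \<open>1\<close>. The transform replaces each line by its orthogonal line.\<close>

lemma transform_plus:
  assumes a: "a \<in> carrier R"
  shows "(\<Sum>v\<in>carrier R. plus_fun \<zero> primal \<zeta> \<beta> v * \<psi> (T (a \<otimes> v))) = of_nat u * plus_fun \<zero> dual \<zeta> \<beta> a"
proof -
  let ?I = "{i. i \<le> u \<and> even i = \<beta>}"
  have finI: "finite ?I" by simp
  have pf: "plus_fun \<zero> primal \<zeta> \<beta> v = (\<Sum>i\<in>?I. if v \<in> line i then \<zeta> ^ (i div 2) else 0)"
    if v: "v \<in> carrier R" for v
  proof (cases "v = \<zero>")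
    case True
    then show ?thesis using sum_line_labels by (simp add: plus_fun_def primal_def line_def)
  next
    case False
    have "(\<Sum>i\<in>?I. if v \<in> line i then \<zeta> ^ (i div 2) else 0)
        = (\<Sum>i\<in>?I. if i = lg v mod (u + 1) then \<zeta> ^ (i div 2) else 0)"
      using v False by (intro sum.cong) (auto simp: line_def)
    also have "\<dots> = (if lg v mod (u + 1) \<in> ?I then \<zeta> ^ (lg v mod (u + 1) div 2) else 0)"
      using finI by simp
    also have "lg v mod (u + 1) \<in> ?I \<longleftrightarrow> even (lg v) = \<beta>"
      using even_mod[OF h_properties(3)] mod_less_divisor[of "u + 1" "lg v"] by (simp add: less_Suc_eq_le)
    finally show ?thesis using False by (simp add: plus_fun_def primal_def)
  qed
  have "(\<Sum>v\<in>carrier R. plus_fun \<zero> primal \<zeta> \<beta> v * \<psi> (T (a \<otimes> v)))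
      = (\<Sum>v\<in>carrier R. \<Sum>i\<in>?I. if v \<in> line i then \<zeta> ^ (i div 2) * \<psi> (T (a \<otimes> v)) else 0)"
    by (intro sum.cong refl) (auto simp: pf sum_distrib_right intro!: sum.cong)
  also have "\<dots> = (\<Sum>i\<in>?I. \<Sum>v\<in>carrier R. if v \<in> line i then \<zeta> ^ (i div 2) * \<psi> (T (a \<otimes> v)) else 0)"
    by (rule sum.swap)
  also have "\<dots> = (\<Sum>i\<in>?I. \<zeta> ^ (i div 2) * (\<Sum>v\<in>line i. \<psi> (T (a \<otimes> v))))"
  proof (intro sum.cong refl)
    fix i
    have "(\<Sum>v\<in>carrier R. if v \<in> line i then \<zeta> ^ (i div 2) * \<psi> (T (a \<otimes> v)) else 0)
        = (\<Sum>v\<in>line i. \<zeta> ^ (i div 2) * \<psi> (T (a \<otimes> v)))"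
      by (rule sum.mono_neutral_cong_right) (use finite_carrier in \<open>auto simp: line_def\<close>)
    then show "(\<Sum>v\<in>carrier R. if v \<in> line i then \<zeta> ^ (i div 2) * \<psi> (T (a \<otimes> v)) else 0)
        = \<zeta> ^ (i div 2) * (\<Sum>v\<in>line i. \<psi> (T (a \<otimes> v)))" by (simp add: sum_distrib_left)
  qed
  also have "\<dots> = (\<Sum>i\<in>?I. \<zeta> ^ (i div 2) * (if T (a \<otimes> gen [^] i) = \<zero> then of_nat u else 0))"
    using a by (intro sum.cong refl) (simp add: sum_over_line)
  also have "\<dots> = of_nat u * plus_fun \<zero> dual \<zeta> \<beta> a"
  proof (cases "a = \<zero>")
    case True
    have "T \<zero> = \<zero>" using u_gt_1 by (simp add: T_def nat_pow_zero)
    then have "(\<Sum>i\<in>?I. \<zeta> ^ (i div 2) * (if T (a \<otimes> gen [^] i) = \<zero> then of_nat u else 0))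
       = (\<Sum>i\<in>?I. \<zeta> ^ (i div 2)) * of_nat u" using True by (simp add: sum_distrib_right)
    then show ?thesis using True by (simp add: sum_line_labels plus_fun_def dual_def)
  next
    case False
    have "(\<Sum>i\<in>?I. \<zeta> ^ (i div 2) * (if T (a \<otimes> gen [^] i) = \<zero> then of_nat u else 0))
       = (\<Sum>i\<in>?I. if i = line_index a then \<zeta> ^ (i div 2) * of_nat u else 0)"
      using a False by (intro sum.cong) (auto simp: kernel_line)
    also have "\<dots> = (if line_index a \<in> ?I then \<zeta> ^ (line_index a div 2) * of_nat u else 0)"
      using finI by simp
    also have "line_index a \<in> ?I \<longleftrightarrow> odd (lg a) = \<beta>" using line_index_le even_line_index by simp
    finally show ?thesis using False by (simp add: plus_fun_def dual_def)
  qed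
  finally show ?thesis .
qed

text \<open>With a square root \<open>\<omega>\<close> of \<open>\<zeta>\<close>, the minus functions on the two halves are the even and the odd part of \<open>chi\<close>
under \<open>\<omega> \<mapsto> - \<omega>\<close>, up to a factor \<open>\<omega>\<close> for the odd one. Both \<open>\<omega>\<close> and \<open>- \<omega>\<close> are \<open>2m\<close>-th roots of unity
different from \<open>1\<close>.\<close>

lemma transform_minus:
  assumes a: "a \<in> carrier R"
  shows "(\<Sum>v\<in>carrier R. minus_fun \<zero> primal \<zeta> \<beta> v * \<psi> (T (a \<otimes> v))) = - of_nat u * minus_fun \<zero> dual \<zeta> (\<not> \<beta>) a"
proof -
  define \<omega> where "\<omega> = csqrt \<zeta>"
  have \<omega>2: "\<omega> * \<omega> = \<zeta>" by (metis \<omega>_def power2_csqrt power2_eq_square)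
  have \<zeta>0: "\<zeta> \<noteq> 0" using \<zeta>(1) m_pos by (auto simp: power_0_left)
  then have \<omega>0: "\<omega> \<noteq> 0" using \<omega>2 by auto
  have \<omega>pow: "\<omega> ^ (2 * k) = \<zeta> ^ k" for k using \<omega>2 by (simp add: power_mult power2_eq_square)
  have "x \<noteq> 1" if "x * x = \<zeta>" for x using that \<zeta>(2) by auto
  from this[of \<omega>] this[of "- \<omega>"]
  have \<omega>: "\<omega> ^ (2 * m) = 1" "(- \<omega>) ^ (2 * m) = 1" "\<omega> \<noteq> 1" "- \<omega> \<noteq> 1"
    using \<zeta> \<omega>2 by (simp_all add: \<omega>pow)
  define r where "r v = lg v mod (2 * m) div 2" for v
  have r_less: "r v < m" for v using m_pos mod_less_divisor[of "2 * m" "lg v"] unfolding r_def by linarith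
  have lgm: "lg v mod (2 * m) = 2 * r v + of_bool (odd (lg v))" for v
    using even_mod[of "2 * m" "lg v"] unfolding r_def by (simp add: of_bool_def)
  have pw: "\<omega> ^ lg v = (if even (lg v) then \<zeta> ^ r v else \<omega> * \<zeta> ^ r v)" for v
  proof -
    have "\<omega> ^ lg v = \<omega> ^ (lg v mod (2 * m))" by (rule power_cong_mod[OF \<omega>(1)]) simp
    then show ?thesis by (simp add: lgm power_add \<omega>pow)
  qed
  have pw': "(- \<omega>) ^ lg v = (if even (lg v) then \<zeta> ^ r v else - (\<omega> * \<zeta> ^ r v))" for v
    using pw[of v] by (simp add: power_minus_odd)
  have inv\<zeta>: "1 / \<zeta> ^ k = \<zeta> ^ (m - k)" if "k \<le> m" for k
    using that \<zeta>(1) \<zeta>0 by (simp add: power_diff)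
  show ?thesis
  proof (cases \<beta>)
    case True
    have "(\<Sum>v\<in>carrier R. minus_fun \<zero> primal \<zeta> \<beta> v * \<psi> (T (a \<otimes> v)))
        = (\<Sum>v\<in>carrier R. (chi \<omega> v * \<psi> (T (a \<otimes> v)) + chi (- \<omega>) v * \<psi> (T (a \<otimes> v))) / 2)"
      using True by (intro sum.cong) (auto simp: minus_fun_def primal_def chi_def pw pw' r_def)
    also have "\<dots> = ((\<Sum>v\<in>carrier R. chi \<omega> v * \<psi> (T (a \<otimes> v))) + (\<Sum>v\<in>carrier R. chi (- \<omega>) v * \<psi> (T (a \<otimes> v)))) / 2"
      by (simp only: sum_divide_distrib[symmetric] sum.distrib)
    also have "\<dots> = - of_nat u * minus_fun \<zero> dual \<zeta> (\<not> \<beta>) a"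
    proof (cases "a \<noteq> \<zero> \<and> even (lg a)")
      case even: True
      have "1 / \<zeta> ^ r a = \<zeta> ^ (m - r a)" using r_less[of a] by (intro inv\<zeta>) simp
      then have "of_nat u / \<zeta> ^ r a = of_nat u * \<zeta> ^ (m - r a)"
        by (simp add: divide_inverse)
      moreover have "minus_fun \<zero> dual \<zeta> (\<not> \<beta>) a = \<zeta> ^ (m - r a)"
        using even True by (simp add: minus_fun_def dual_def r_def)
      ultimately show ?thesis
        unfolding transform_chi[OF \<omega>(1,3) a] transform_chi[OF \<omega>(2,4) a] pw pw'
        using even by simp
    next
      case False
      then show ?thesis
        unfolding transform_chi[OF \<omega>(1,3) a] transform_chi[OF \<omega>(2,4) a] pw pw'
        using True by (auto simp: minus_fun_def dual_def)
    qed
    finally show ?thesis .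
  next
    case False
    have "(\<Sum>v\<in>carrier R. minus_fun \<zero> primal \<zeta> \<beta> v * \<psi> (T (a \<otimes> v)))
        = (\<Sum>v\<in>carrier R. (chi \<omega> v * \<psi> (T (a \<otimes> v)) - chi (- \<omega>) v * \<psi> (T (a \<otimes> v))) / (2 * \<omega>))"
      using False \<omega>0 by (intro sum.cong) (auto simp: minus_fun_def primal_def chi_def pw pw' r_def)
    also have "\<dots> = ((\<Sum>v\<in>carrier R. chi \<omega> v * \<psi> (T (a \<otimes> v))) - (\<Sum>v\<in>carrier R. chi (- \<omega>) v * \<psi> (T (a \<otimes> v)))) / (2 * \<omega>)"
      by (simp only: sum_divide_distrib[symmetric] sum_subtractf)
    also have "\<dots> = - of_nat u * minus_fun \<zero> dual \<zeta> (\<not> \<beta>) a"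
    proof (cases "a \<noteq> \<zero> \<and> odd (lg a)")
      case odd: True
      have "1 / \<zeta> ^ (r a + 1) = \<zeta> ^ (m - (r a + 1))" using r_less[of a] by (intro inv\<zeta>) simp
      then have "1 / (\<omega> * (\<omega> * \<zeta> ^ r a)) = \<zeta> ^ (m - r a - 1)" by (simp add: \<omega>2 mult.assoc[symmetric])
      then have "of_nat u / (\<omega> * (\<omega> * \<zeta> ^ r a)) = of_nat u * \<zeta> ^ (m - r a - 1)"
        by (simp add: divide_inverse)
      moreover have "(- of_nat u / (\<omega> * \<zeta> ^ r a) - - of_nat u / - (\<omega> * \<zeta> ^ r a)) / (2 * \<omega>)
          = - (of_nat u / (\<omega> * (\<omega> * \<zeta> ^ r a)))"
        by (simp add: mult.left_commute mult.commute)
      moreover have "minus_fun \<zero> dual \<zeta> (\<not> \<beta>) a = \<zeta> ^ (m - r a - 1)"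
        using odd False by (simp add: minus_fun_def dual_def r_def)
      ultimately show ?thesis
        unfolding transform_chi[OF \<omega>(1,3) a] transform_chi[OF \<omega>(2,4) a] pw pw'
        using odd by simp
    next
      case not_odd: False
      then show ?thesis
        unfolding transform_chi[OF \<omega>(1,3) a] transform_chi[OF \<omega>(2,4) a] pw pw'
        using False by (auto simp: minus_fun_def dual_def)
    qed
    finally show ?thesis .
  qed
qed

end

lemma lg_minus:
  assumes v: "v \<in> carrier R"
  shows "even (lg (\<ominus> v)) = even (lg v)" "v \<noteq> \<zero> \<Longrightarrow> lg (\<ominus> v) mod (u + 1) = lg v mod (u + 1)"
    "lg (\<ominus> v) mod (2 * m) = lg v mod (2 * m)"
proof -
  have *: "lg (\<ominus> v) mod d = lg v mod d" if d: "d dvd N" "d dvd (u + 1) * h" and v0: "v \<noteq> \<zero>" for d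
  proof -
    have "\<ominus> v = \<ominus> \<one> \<otimes> v" using v by (simp add: l_minus)
    then have "\<ominus> v = gen [^] ((u + 1) * h) \<otimes> v" unfolding minus_one_eq h_def .
    then have "lg (\<ominus> v) mod N = (lg (gen [^] ((u + 1) * h)) + lg v) mod N"
      using v v0 by (simp only: lg_mult gen_pow_closed gen_pow_nonzero not_False_eq_True)
    also have "\<dots> = ((u + 1) * h + lg v) mod N" by (metis lg_gen_pow mod_add_left_eq)
    finally have "lg (\<ominus> v) mod d = ((u + 1) * h + lg v) mod d" by (rule mod_dvd_cong[OF d(1)])
    then show ?thesis using d(2) by (metis add.left_neutral dvd_eq_mod_eq_0 mod_add_left_eq)
  qed
  have two: "2 * m dvd (u + 1) * h"
    unfolding h_def using mult_dvd_mono[OF h_properties(3) dvd_triv_left[of m M]] by simp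
  have twoN: "2 * m dvd N" using two_m_dvd(2)[of 1] by simp
  show m: "lg (\<ominus> v) mod (2 * m) = lg v mod (2 * m)"
    using *[OF twoN two] by (cases "v = \<zero>") auto
  show "even (lg (\<ominus> v)) = even (lg v)"
    using arg_cong[OF m, of even] by (simp add: even_mod)
  show "v \<noteq> \<zero> \<Longrightarrow> lg (\<ominus> v) mod (u + 1) = lg v mod (u + 1)"
    by (rule *[OF u1_dvd_N dvd_triv_left])
qed

theorem has_dual_labellings_add_monoid: "has_dual_labellings (add_monoid R) m (q\<^sup>2)"
proof -
  let ?A = "add_monoid R"
  define W where "W v a = \<psi> (T (a \<otimes> v))" for v a
  have inv: "inv\<^bsub>?A\<^esub> v = \<ominus> v" for v by (simp add: a_inv_def)
  have T0: "T \<zero> = \<zero>" using u_gt_1 by (simp add: T_def nat_pow_zero)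
  have "self_pairing ?A W"
    unfolding self_pairing_def W_def
  proof (intro conjI ballI impI)
    fix g h' y assume "g \<in> carrier ?A" "h' \<in> carrier ?A" "y \<in> carrier ?A"
    then show "\<psi> (T (y \<otimes> (g \<otimes>\<^bsub>?A\<^esub> h'))) = \<psi> (T (y \<otimes> g)) * \<psi> (T (y \<otimes> h'))"
      by (simp add: r_distr T_add \<psi>_add K_closed T_closed)
  next
    fix g assume g: "g \<in> carrier ?A" "g \<noteq> \<one>\<^bsub>?A\<^esub>"
    have "(\<Sum>y\<in>carrier R. \<psi> (T (y \<otimes> g))) = (\<Sum>y\<in>carrier R. \<psi> (T (g \<otimes> y)))"
      using g by (intro sum.cong) (auto simp: m_comm)
    then show "(\<Sum>y\<in>carrier ?A. \<psi> (T (y \<otimes> g))) = 0" "(\<Sum>y\<in>carrier ?A. \<psi> (T (g \<otimes> y))) = 0"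
      using g sum_\<psi>_T[of g] by simp_all
  qed (auto simp: T0 \<psi>_zero)
  moreover have "card (carrier ?A) = (q\<^sup>2)\<^sup>2" using card_carrier by simp
  moreover have "plus_label primal (\<ominus> v) = plus_label primal v" "minus_label primal (\<ominus> v) = minus_label primal v"
    "half primal (\<ominus> v) = half primal v" if v: "v \<in> carrier R" for v
    using lg_minus[OF v] v by (auto simp: primal_def)
  moreover have "plus_label primal \<zero> = 0" "plus_label dual \<zero> = 0" by (simp_all add: primal_def dual_def)
  moreover have "transform ?A W f a = (\<Sum>v\<in>carrier R. f v * \<psi> (T (a \<otimes> v)))" for f a
    by (simp add: transform_def W_def)
  ultimately have "dual_labellings ?A m (q\<^sup>2) W primal dual"
    unfolding dual_labellings_def
    using a_comm_group finite_carrier transform_plus transform_minus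
    by (simp add: inv u_def)
  then show ?thesis by (auto simp: has_dual_labellings_def)
qed

end

section \<open>Latin square type graphs on products of elementary abelian groups\<close>

text \<open>The exponent of \<open>G\<close> is the prime that divides \<open>q\<close>, so \<open>G\<close> is isomorphic to the additive group of the field
with \<open>q^4\<close> elements.\<close>

lemma has_dual_labellings_elementary_abelian:
  fixes G :: "('a, 'b) monoid_scheme" and q m :: nat
  assumes G: "elementary_abelian_group G" and order: "order G = q ^ 4"
    and q: "primepow q" and m: "m > 0" "2 * m dvd q + 1"
  shows "has_dual_labellings G m (q\<^sup>2)"
proof -
  obtain p' where comm: "comm_group G" and p': "Factorial_Ring.prime (p' :: nat)"
    and expG: "\<And>x. x \<in> carrier G \<Longrightarrow> x [^]\<^bsub>G\<^esub> p' = \<one>\<^bsub>G\<^esub>"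
    using G by (auto simp: elementary_abelian_group_def)
  interpret G: comm_group G by fact
  obtain p n where p: "Factorial_Ring.prime p" and n: "n > 0" and qpn: "q = p ^ n"
    using q by (auto simp: primepow_def)
  have q1: "q > 1" using primepow_gt_Suc_0[OF q] by simp
  have cardG: "card (carrier G) = q ^ 4" using order by (simp add: order_def)
  have finG: "finite (carrier G)" using cardG q1 by (intro card_ge_0_finite) simp
  have "p' = p"
  proof -
    have "card (carrier G) > 1" unfolding cardG using q1 by (rule one_less_power) simp
    then have "carrier G \<noteq> {\<one>\<^bsub>G\<^esub>}" by auto
    then obtain x where x: "x \<in> carrier G" "x \<noteq> \<one>\<^bsub>G\<^esub>" using G.one_closed by blast
    have "G.ord x dvd p'" using expG[OF x(1)] G.pow_eq_id[OF x(1)] by simp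
    moreover have "G.ord x \<noteq> 1" using x G.ord_eq_1 by blast
    ultimately have "G.ord x = p'" using p' by (auto simp: prime_nat_iff)
    then have "p' dvd p ^ (n * 4)" using G.ord_dvd_group_order[OF x(1)] order by (simp add: qpn power_mult)
    then have "p' dvd p" using p' prime_dvd_power by blast
    then show ?thesis using p p' primes_dvd_imp_eq by blast
  qed
  obtain R :: "((int list \<times> nat) multiset \<Rightarrow> int) ring" where R: "field R" "finite (carrier R)"
    "card (carrier R) = p ^ (n * 4)" "[p] \<cdot>\<^bsub>R\<^esub> \<one>\<^bsub>R\<^esub> = \<zero>\<^bsub>R\<^esub>"
    using exists_finite_field[OF p, of "n * 4"] n by auto
  interpret R: field R by fact
  interpret R: quartic_extension R q m
  proof
    show "card (carrier R) = q ^ 4" using R(3) by (simp add: qpn power_mult)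
    show "(x \<oplus>\<^bsub>R\<^esub> y) [^]\<^bsub>R\<^esub> q = x [^]\<^bsub>R\<^esub> q \<oplus>\<^bsub>R\<^esub> y [^]\<^bsub>R\<^esub> q" if "x \<in> carrier R" "y \<in> carrier R" for x y
      unfolding qpn by (rule R.frobenius_additive[OF p R(4) that])
  qed (use R(2) m q1 in auto)
  let ?A = "add_monoid R"
  have commA: "comm_group ?A" by (rule R.a_comm_group)
  have expA: "x [^]\<^bsub>?A\<^esub> p = \<one>\<^bsub>?A\<^esub>" if "x \<in> carrier ?A" for x
    using R.char_add_pow[OF R(4), of x 1] that by (simp add: add_pow_def)
  obtain \<phi> where \<phi>: "\<phi> \<in> iso G ?A"
    by (rule elementary_abelian_groups_isomorphic[OF comm commA p expG[unfolded \<open>p' = p\<close>] expA finG])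
       (use R(2,3) cardG in \<open>auto simp: qpn power_mult\<close>)
  have subk: "subgroup R.k ?A"
    by (rule R.add.subgroupI) (use R.zero_k in \<open>auto simp: R.k_closed R.k_add R.k_minus a_inv_def[symmetric]\<close>)
  have "\<exists>k0\<in>R.K. k0 \<notin> R.k"
  proof (rule ccontr)
    assume "\<not> ?thesis"
    then have "R.K \<subseteq> R.k" by blast
    then have "R.u \<le> q" using card_mono[OF R.finite_k] R.card_K R.card_k by metis
    then show False using q1 by (simp add: R.u_def power2_eq_square)
  qed
  then obtain k0 where k0: "k0 \<in> R.K" "k0 \<notin> R.k" by blast
  have finA: "finite (carrier ?A)" and k0A: "k0 \<in> carrier ?A" using R(2) R.K_closed[OF k0(1)] by simp_all
  obtain \<psi> :: "_ \<Rightarrow> complex" where \<psi>: "\<And>x y. x \<in> carrier ?A \<Longrightarrow> y \<in> carrier ?A \<Longrightarrow> \<psi> (x \<otimes>\<^bsub>?A\<^esub> y) = \<psi> x * \<psi> y"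
    "\<And>x. x \<in> R.k \<Longrightarrow> \<psi> x = 1" "\<psi> k0 \<noteq> 1"
    by (rule elementary_abelian_separating_character[OF commA p expA finA subk k0A k0(2)]) auto
  interpret quartic_extension_character R q m \<psi> k0
    by unfold_locales (use \<psi> k0 in auto)
  show ?thesis
    by (rule has_dual_labellings_iso[OF comm \<phi> has_dual_labellings_add_monoid])
qed

theorem theorem1p5:
  fixes m s u :: nat
    and q :: "nat \<Rightarrow> nat"
    and G :: "nat \<Rightarrow> ('a, 'b) monoid_scheme"
    and c :: int
  assumes "m > 0"
    and "s \<ge> 1"
    and "\<And>i. i \<in> {1..s} \<Longrightarrow> primepow (q i)"
    and "\<And>i. i \<in> {1..s} \<Longrightarrow> 2 * m dvd q i + 1"
    and "\<And>i. i \<in> {1..s} \<Longrightarrow> elementary_abelian_group (G i)"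
    and "\<And>i. i \<in> {1..s} \<Longrightarrow> order (G i) = q i ^ 4"
    and "u = (\<Prod>i\<in>{1..s}. (q i)\<^sup>2)"
    and "(\<exists>h j :: int. 0 \<le> h \<and> h \<le> int m - 2 \<and> j \<in> {0, 1, 2} \<and>
            real_of_int c = real_of_int (h + j) * (real u - 1) / real m + real_of_int j) \<or>
         (\<exists>h j :: int. 0 \<le> h \<and> h \<le> int m - 1 \<and> j \<in> {0, 1} \<and>
            real_of_int c = real_of_int (h + j) * (real u - 1) / real m + 2 * real_of_int j)"
  shows "\<exists>\<Gamma>. Cayley_graph_on (product_group {1..s} G) \<Gamma> \<and>
           strongly_regular_graph \<Gamma> ((int u)\<^sup>2) (c * (int u - 1))
             (int u + c\<^sup>2 - 3 * c) (c\<^sup>2 - c)"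
proof -
  let ?P = "product_group {1..s} G"
  have P: "has_dual_labellings ?P m u"
    unfolding assms(7) using assms(1,3-6)
    by (intro has_dual_labellings_product_group has_dual_labellings_elementary_abelian) auto
  have u1: "u \<ge> 1"
  proof -
    have "(q i)\<^sup>2 > 0" if "i \<in> {1..s}" for i using primepow_gt_0_nat[OF assms(3)[OF that]] by simp
    then show ?thesis unfolding assms(7) using prod_pos[of "{1..s}" "\<lambda>i. (q i)\<^sup>2"] by (simp add: Suc_le_eq)
  qed
  have dvd: "m dvd u - 1"
  proof -
    have "(q i)\<^sup>2 mod m = 1 mod m" if i: "i \<in> {1..s}" for i
    proof -
      have "m dvd q i + 1" using assms(4)[OF i] by (rule dvd_mult_right)
      then have "m dvd (q i + 1) * (q i - 1)" by (rule dvd_mult2)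
      moreover have "(q i + 1) * (q i - 1) = (q i)\<^sup>2 - 1"
        by (simp add: power2_eq_square algebra_simps diff_mult_distrib2)
      moreover have "(q i)\<^sup>2 \<ge> 1" using primepow_gt_0_nat[OF assms(3)[OF i]] by simp
      ultimately show ?thesis using mod_eq_dvd_iff_nat[of 1 "(q i)\<^sup>2" m] by (simp only:)
    qed
    then have "(\<Prod>i\<in>{1..s}. (q i)\<^sup>2 mod m) mod m = (\<Prod>i\<in>{1..s}. 1 mod m) mod m" by simp
    then have "u mod m = (\<Prod>i\<in>{1..s}. 1) mod m" unfolding assms(7) mod_prod_eq .
    then have "u mod m = 1 mod m" by simp
    then show ?thesis using mod_eq_dvd_iff_nat[OF u1, of m] by (simp only:)
  qed
  define D where "D = (int u - 1) div int m"
  have D: "int u - 1 = int m * D"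
  proof -
    have "int m dvd int (u - 1)" using dvd by (simp only: of_nat_dvd_iff)
    then show ?thesis using u1 by (simp add: D_def of_nat_diff)
  qed
  have c_eq: "c = k * D + e" if "real_of_int c = real_of_int k * (real u - 1) / real m + real_of_int e" for k e
  proof -
    have "real u - 1 = real m * real_of_int D"
      using arg_cong[OF D, of real_of_int] by simp
    then have "real_of_int c = real_of_int (k * D + e)" using that assms(1) by simp
    then show ?thesis by (simp only: of_int_eq_iff)
  qed
  from assms(8) show ?thesis
  proof (elim disjE exE conjE)
    fix h j :: int
    assume h: "0 \<le> h" "h \<le> int m - 2" and j: "j \<in> {0, 1, 2}"
      and c: "real_of_int c = real_of_int (h + j) * (real u - 1) / real m + real_of_int j"
    \<comment> \<open>labels with total excess \<open>j\<close>: with \<open>s = 1\<close> the labels \<open>0\<close> and \<open>1\<close> have one additional line each, the others none\<close>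
    define I where "I = {0..<nat j} \<union> {2..<2 + nat h}"
    have "card I = nat h + nat j" unfolding I_def using j by (subst card_Un_disjoint) auto
    moreover have "int (of_bool (0 \<in> I)) + of_bool (1 \<in> I) = j" using j by (auto simp: I_def)
    ultimately have "c = int (card I) * ((int u - 1) div int m) + of_bool (0 \<in> I) + of_bool (1 \<in> I)"
      using c_eq[OF c] h j by (auto simp: D_def)
    then show ?thesis
      by (rule strongly_regular_Cayley_graph_of_labelling[OF P assms(1) dvd, rotated 2])
         (use h j in \<open>auto simp: I_def\<close>)
  next
    fix h j :: int
    assume h: "0 \<le> h" "h \<le> int m - 1" and j: "j \<in> {0, 1}"
      and c: "real_of_int c = real_of_int (h + j) * (real u - 1) / real m + 2 * real_of_int j"
    \<comment> \<open>with \<open>s = 0\<close> the label \<open>0\<close> carries both additional lines\<close>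
    define I where "I = {0..<nat j} \<union> {1..<1 + nat h}"
    have "card I = nat h + nat j" unfolding I_def using j by (subst card_Un_disjoint) auto
    moreover have "int (of_bool (0 \<in> I)) + of_bool (0 \<in> I) = 2 * j" using j by (auto simp: I_def)
    ultimately have "c = int (card I) * ((int u - 1) div int m) + of_bool (0 \<in> I) + of_bool (0 \<in> I)"
      using c_eq[of "h + j" "2 * j"] c h j by (auto simp: D_def)
    then show ?thesis
      by (rule strongly_regular_Cayley_graph_of_labelling[OF P assms(1) dvd, rotated 2])
         (use h j assms(1) in \<open>auto simp: I_def\<close>)
  qed
qed

end
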